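(* Let $n\ge2$ and let $\Omega\subset\mathbb{R}^n$ be a smooth bounded domain. There is a constant $C$ such that the following holds. Let $F\in L^1(\Omega;\mathbb{R}^n)$ with $\operatorname{div}F=0$. Then there exists a unique weak solution $U\in W^{1,n}_0(\Omega;\mathbb{R}^n)$ of the system $$-\operatorname{div}(|\nabla U|^{n-2}\nabla U)=F\ \text{ in }\Omega,\qquad U=0\ \text{ on }\partial\Omega .$$ Moreover, $$\|\nabla U\|_{L^n(\Omega;\mathbb{R}^{n\times n})}\le C\,\|F\|_{L^1(\Omega;\mathbb{R}^n)}^{1/(n-1)},$$ where the constant $C$ is independent of $F$.
   Context: $\operatorname{div}F=0$ is understood in the sense of distributions in $\Omega$. A weak solution $U\in W^{1,n}_0(\Omega;\mathbb{R}^n)$ is one satisfying $\int_\Omega|\nabla U|^{n-2}\nabla U\cdot\nabla\Phi\,dx=\int_\Omega F\cdot\Phi\,dx$ for all $\Phi\in C_c^\infty(\Omega;\mathbb{R}^n)$, where $\cdot$ is the Euclidean inner product and $|\cdot|$ the Euclidean norm on $n\times n$ matrices. *)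

theory Defs
  imports "HOL-Analysis.Analysis"
begin

(* For k > 0: differentiable everywhere, with all directional derivatives of class C^(k-1).
   On a finite-dimensional domain this is the usual class C^k. *)
primrec class_C :: "nat \<Rightarrow> ('a::euclidean_space \<Rightarrow> 'b::real_normed_vector) \<Rightarrow> bool" where
  "class_C 0 f \<longleftrightarrow> continuous_on UNIV f"
| "class_C (Suc k) f \<longleftrightarrow>
     (\<forall>x. f differentiable (at x)) \<and> (\<forall>v. class_C k (\<lambda>x. frechet_derivative f (at x) v))"

definition smooth :: "('a::euclidean_space \<Rightarrow> 'b::real_normed_vector) \<Rightarrow> bool" where
  "smooth f \<longleftrightarrow> (\<forall>k. class_C k f)"

definition test_functions :: "'a::euclidean_space set \<Rightarrow> ('a \<Rightarrow> 'b::real_normed_vector) set" where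
  "test_functions \<Omega> = {\<phi>. smooth \<phi> \<and> (\<exists>K. compact K \<and> K \<subseteq> \<Omega> \<and> (\<forall>x. x \<notin> K \<longrightarrow> \<phi> x = 0))}"

(* Near each boundary point the set is, in suitable orthonormal coordinates, the strict epigraph
   of a smooth function of the coordinates orthogonal to nu. A function on the hyperplane
   orthogonal to nu is represented by a function g on the whole space that is constant in
   the direction nu. *)
definition smooth_boundary :: "'a::euclidean_space set \<Rightarrow> bool" where
  "smooth_boundary \<Omega> \<longleftrightarrow>
     (\<forall>x\<^sub>0\<in>frontier \<Omega>. \<exists>r>0. \<exists>\<nu> g. norm \<nu> = 1 \<and> smooth (g :: 'a \<Rightarrow> real) \<and>
        (\<forall>x t. g (x + t *\<^sub>R \<nu>) = g x) \<and>
        \<Omega> \<inter> ball x\<^sub>0 r = {x \<in> ball x\<^sub>0 r. g x < x \<bullet> \<nu>})"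

definition smooth_bounded_domain :: "'a::euclidean_space set \<Rightarrow> bool" where
  "smooth_bounded_domain \<Omega> \<longleftrightarrow>
     open \<Omega> \<and> connected \<Omega> \<and> \<Omega> \<noteq> {} \<and> bounded \<Omega> \<and> smooth_boundary \<Omega>"

(* Elements of Lebesgue and Sobolev spaces are represented by functions on the whole space; only
   their values almost everywhere in Omega matter. *)
definition Lp :: "real \<Rightarrow> 'a::euclidean_space set \<Rightarrow> ('a \<Rightarrow> 'b::euclidean_space) set" where
  "Lp p \<Omega> = {f. f \<in> borel_measurable (lebesgue_on \<Omega>) \<and>
                integrable (lebesgue_on \<Omega>) (\<lambda>x. norm (f x) powr p)}"

definition Lp_norm :: "real \<Rightarrow> 'a::euclidean_space set \<Rightarrow> ('a \<Rightarrow> 'b::euclidean_space) \<Rightarrow> real" where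
  "Lp_norm p \<Omega> f = (LINT x|lebesgue_on \<Omega>. norm (f x) powr p) powr (1 / p)"

definition L1_loc :: "'a::euclidean_space set \<Rightarrow> ('a \<Rightarrow> 'b::euclidean_space) set" where
  "L1_loc \<Omega> = {f. f \<in> borel_measurable (lebesgue_on \<Omega>) \<and>
                  (\<forall>K. compact K \<and> K \<subseteq> \<Omega> \<longrightarrow> integrable (lebesgue_on K) f)}"

definition grad :: "(real^'n \<Rightarrow> real) \<Rightarrow> real^'n \<Rightarrow> real^'n" where
  "grad \<phi> x = (\<chi> j. frechet_derivative \<phi> (at x) (axis j 1))"

definition div_free_on :: "(real^'n) set \<Rightarrow> (real^'n \<Rightarrow> real^'n) \<Rightarrow> bool" where
  "div_free_on \<Omega> F \<longleftrightarrow> (\<forall>\<phi>\<in>test_functions \<Omega>. (LINT x|lebesgue_on \<Omega>. F x \<bullet> grad \<phi> x) = 0)"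

(* The (i, j) entry of G is the weak j-th partial derivative of the i-th component of U. *)
definition has_weak_gradient ::
    "(real^'n) set \<Rightarrow> (real^'n \<Rightarrow> real^'n) \<Rightarrow> (real^'n \<Rightarrow> real^'n^'n) \<Rightarrow> bool" where
  "has_weak_gradient \<Omega> U G \<longleftrightarrow> U \<in> L1_loc \<Omega> \<and> G \<in> L1_loc \<Omega> \<and>
     (\<forall>\<phi>\<in>test_functions \<Omega>. \<forall>i j.
        (LINT x|lebesgue_on \<Omega>. U x $ i * grad \<phi> x $ j) =
        - (LINT x|lebesgue_on \<Omega>. G x $ i $ j * \<phi> x))"

(* A representative of the weak gradient, which is determined up to null sets in Omega. *)
definition weak_gradient ::
    "(real^'n) set \<Rightarrow> (real^'n \<Rightarrow> real^'n) \<Rightarrow> real^'n \<Rightarrow> real^'n^'n" where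
  "weak_gradient \<Omega> U = (SOME G. has_weak_gradient \<Omega> U G)"

definition W1p :: "real \<Rightarrow> (real^'n) set \<Rightarrow> (real^'n \<Rightarrow> real^'n) set" where
  "W1p p \<Omega> = {U. U \<in> Lp p \<Omega> \<and> (\<exists>G. has_weak_gradient \<Omega> U G \<and> G \<in> Lp p \<Omega>)}"

definition W1p_norm :: "real \<Rightarrow> (real^'n) set \<Rightarrow> (real^'n \<Rightarrow> real^'n) \<Rightarrow> real" where
  "W1p_norm p \<Omega> U = Lp_norm p \<Omega> U + Lp_norm p \<Omega> (weak_gradient \<Omega> U)"

(* The closure of the test functions in W1p. *)
definition W1p_0 :: "real \<Rightarrow> (real^'n) set \<Rightarrow> (real^'n \<Rightarrow> real^'n) set" where
  "W1p_0 p \<Omega> = {U \<in> W1p p \<Omega>. \<forall>\<epsilon>>0. \<exists>\<Phi>\<in>test_functions \<Omega>. W1p_norm p \<Omega> (\<lambda>x. U x - \<Phi> x) < \<epsilon>}"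

(* Norm and inner product on real^'n^'n are the Euclidean (Frobenius) ones. *)
definition weak_solution ::
    "(real^'n) set \<Rightarrow> (real^'n \<Rightarrow> real^'n) \<Rightarrow> (real^'n \<Rightarrow> real^'n) \<Rightarrow> bool" where
  "weak_solution \<Omega> F U \<longleftrightarrow> U \<in> W1p_0 (real CARD('n)) \<Omega> \<and>
     (\<forall>\<Phi>\<in>test_functions \<Omega>.
        (LINT x|lebesgue_on \<Omega>.
           (norm (weak_gradient \<Omega> U x) ^ (CARD('n) - 2) *\<^sub>R weak_gradient \<Omega> U x)
             \<bullet> jacobian \<Phi> (at x)) =
        (LINT x|lebesgue_on \<Omega>. F x \<bullet> \<Phi> x))"

end

theory Submission
  imports Defs "HOL-Computational_Algebra.Polynomial"
begin

text \<open>The heart of the matter is the estimate \<open>|\<integral> F \<bullet> \<Phi>| \<le> C \<parallel>F\<parallel>\<^sub>1 \<parallel>\<nabla>\<Phi>\<parallel>\<^sub>n\<close> for divergence-free \<open>F\<close>, in the spirit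
  of Van Schaftingen's elementary proof of the Bourgain-Brezis inequality. Cut \<open>\<Omega>\<close> into thin slabs
  along a coordinate direction. On each slice a scalar test function \<open>\<phi>\<close> is Hoelder continuous by
  Morrey's inequality in \<open>n - 1\<close> dimensions, so an inf-convolution \<open>w\<close> of its positive part is
  Lipschitz and uniformly close to it. Extending \<open>w\<close> constantly along a direction \<open>e\<close> and cutting off gives
  a Lipschitz test function, and \<open>div F = 0\<close> bounds the flux of \<open>F\<close> against \<open>w\<close> through the slab.
  The boundary of \<open>\<Omega>\<close> does no harm: \<open>w \<le> \<phi>\<close> vanishes where \<open>\<phi>\<close> does, and \<open>e\<close> is chosen inward, so
  that translating the support of \<open>w\<close> along \<open>e\<close> never leaves \<open>\<Omega>\<close>. Morrey's inequality is used in the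
  linearised form \<open>\<phi> y - \<phi> z \<le> c D + c D\<^bsup>1-n\<^esup> |y - z| \<integral> |\<nabla>\<phi>|\<^sup>n\<close> with a free parameter \<open>D\<close>, which is
  finally chosen to be \<open>\<parallel>\<nabla>\<Phi>\<parallel>\<^sub>n\<close>; this makes Hoelder's inequality unnecessary.

  By the estimate, \<open>\<Phi> \<mapsto> \<integral> |\<nabla>\<Phi>|\<^sup>n / n - \<integral> F \<bullet> \<Phi>\<close> is bounded below on test functions, and Clarkson's
  inequality makes a minimising sequence Cauchy; its limit is the solution. Comparing
  with the value at \<open>0\<close> gives the bound, and strict monotonicity of
  \<open>A \<mapsto> |A|\<^bsup>n-2\<^esup> A\<close> with Poincare's inequality gives uniqueness.\<close>

section \<open>Smooth functions\<close>

text \<open>Why the slabs add up: let N be the L^1 norm of F and \<delta> the width of the slabs. On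
  the slice at the base of slab k, Morrey's inequality leaves an additive error of order D and a
  Lipschitz constant of order D^(1-n) G_k / \<delta>, where G_k is the slice energy times the
  thickness. The additive error is paid against the mass of F in that slab, in total D N. The flux
  costs \<delta> N times the Lipschitz constant, in total D^(1-n) N times the sum of the G_k; that
  sum is close to the integral of |grad \<phi>|^n, hence of order D^n, and the cost is again D N. No
  power of \<delta> survives, so the slabs may be as thin as the uniform continuity of \<phi> and
  grad \<phi> demands. The slabs are orthogonal to coordinate axis i although the extension runs
  along an oblique e: with a parallel to the axis and a . e = 1, one inward direction serves all
  components of F as soon as no e_i vanishes. The underlying obstacle is that W^{1,n} does not embed
  into bounded functions, so F, being merely integrable, need not pair with a Sobolev function; the
  minimisation evaluates the pairing on test functions only.\<close>

lemma class_C_SucI: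
  assumes "\<And>x. (f has_derivative f' x) (at x)" "\<And>v. class_C k (\<lambda>x. f' x v)"
  shows "class_C (Suc k) f"
proof -
  have "frechet_derivative f (at x) = f' x" for x
    using frechet_derivative_at[OF assms(1)] by simp
  with assms show ?thesis by (auto simp: differentiable_def)
qed

lemma class_C_Suc_has_derivative:
  "class_C (Suc k) f \<Longrightarrow> (f has_derivative frechet_derivative f (at x)) (at x)"
  by (simp add: frechet_derivative_works)

text \<open>For the product rule: each differentiation leaves one factor undifferentiated, hence of
  order \<open>Suc k\<close>, where the induction hypothesis asks for order
  \<open>k\<close>.\<close>

lemma class_C_SucD: "class_C (Suc k) f \<Longrightarrow> class_C k f"
proof (induction k arbitrary: f)
  case 0
  then show ?case
    by (auto intro!: continuous_at_imp_continuous_on differentiable_imp_continuous_within)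
qed auto

lemma class_C_const: "class_C k (\<lambda>x. c)"
proof (induction k arbitrary: c)
  case (Suc k)
  show ?case by (rule class_C_SucI[where f' = "\<lambda>x v. 0"]) (auto simp: Suc)
qed auto

lemma class_C_add: "class_C k f \<Longrightarrow> class_C k g \<Longrightarrow> class_C k (\<lambda>x. f x + g x)"
proof (induction k arbitrary: f g)
  case (Suc k)
  show ?case
    by (rule class_C_SucI[OF has_derivative_add])
      (use Suc in \<open>auto intro: class_C_Suc_has_derivative\<close>)
qed (auto intro: continuous_intros)

lemma class_C_linear:
  assumes "bounded_linear L"
  shows "class_C k f \<Longrightarrow> class_C k (\<lambda>x. L (f x))"
proof (induction k arbitrary: f)
  case (Suc k)
  show ?case
    by (rule class_C_SucI[OF bounded_linear.has_derivative[OF assms]])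
      (use Suc in \<open>auto intro: class_C_Suc_has_derivative\<close>)
qed (use assms in \<open>auto intro: bounded_linear.continuous_on\<close>)

lemma class_C_mult:
  fixes f g :: "'a::euclidean_space \<Rightarrow> real"
  shows "class_C k f \<Longrightarrow> class_C k g \<Longrightarrow> class_C k (\<lambda>x. f x * g x)"
proof (induction k arbitrary: f g)
  case (Suc k)
  have "class_C k f" "class_C k g"
    using Suc.prems by (blast intro: class_C_SucD)+
  with Suc show ?case
    by (intro class_C_SucI[OF has_derivative_mult])
      (auto intro!: class_C_Suc_has_derivative class_C_add)
qed (auto intro: continuous_intros)

lemma class_C_prod:
  fixes f :: "'i \<Rightarrow> 'a::euclidean_space \<Rightarrow> real"
  shows "(\<And>i. i \<in> I \<Longrightarrow> class_C k (f i)) \<Longrightarrow> class_C k (\<lambda>x. \<Prod>i\<in>I. f i x)"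
  by (induction I rule: infinite_finite_induct) (auto intro: class_C_const class_C_mult)

text \<open>The smooth function on the line is given as the whole chain of its derivatives. One
  differentiation moves from \<open>D j\<close> to \<open>D (Suc j)\<close>, so the induction runs
  over all \<open>j\<close> at once.\<close>

lemma class_C_compose_affine:
  fixes D :: "nat \<Rightarrow> real \<Rightarrow> real"
  assumes "\<And>j x. (D j has_real_derivative D (Suc j) x) (at x)"
  shows "class_C k (\<lambda>x. D j (a \<bullet> x + c))"
proof (induction k arbitrary: j)
  case 0
  have "continuous_on UNIV (D j)"
    using assms DERIV_continuous by (blast intro: continuous_at_imp_continuous_on)
  then show ?case
    by (auto intro!: continuous_intros elim: continuous_on_compose2)
next
  case (Suc k)
  show ?case
  proof (rule class_C_SucI)
    show "((\<lambda>x. D j (a \<bullet> x + c)) has_derivative (\<lambda>v. D (Suc j) (a \<bullet> x + c) * (a \<bullet> v))) (at x)" for x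
      by (rule has_derivative_eq_rhs[OF DERIV_compose_FDERIV[OF assms]])
        (auto intro!: derivative_eq_intros)
    show "class_C k (\<lambda>x. D (Suc j) (a \<bullet> x + c) * (a \<bullet> v))" for v
      by (intro class_C_mult Suc class_C_const)
  qed
qed

lemma smooth_const: "smooth (\<lambda>x. c)"
  by (simp add: smooth_def class_C_const)

lemma smooth_add: "smooth f \<Longrightarrow> smooth g \<Longrightarrow> smooth (\<lambda>x. f x + g x)"
  by (simp add: smooth_def class_C_add)

lemma smooth_linear: "bounded_linear L \<Longrightarrow> smooth f \<Longrightarrow> smooth (\<lambda>x. L (f x))"
  by (simp add: smooth_def class_C_linear)

lemma smooth_has_derivative: "smooth f \<Longrightarrow> (f has_derivative frechet_derivative f (at x)) (at x)"
  unfolding smooth_def using class_C_Suc_has_derivative by blast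

lemma smooth_directional: "smooth f \<Longrightarrow> smooth (\<lambda>x. frechet_derivative f (at x) v)"
  unfolding smooth_def using class_C.simps(2) by blast

lemma smooth_continuous: "smooth f \<Longrightarrow> continuous_on UNIV f"
  unfolding smooth_def using class_C.simps(1) by blast

subsection \<open>Bump functions\<close>

text \<open>With y = 1/x this is the flatness at 0 of every derivative of exp(-1/x).\<close>

lemma poly_mult_exp_minus_tendsto_0: "((\<lambda>y. poly p y * exp (- y)) \<longlongrightarrow> (0::real)) at_top"
proof -
  have "((\<lambda>y. \<Sum>i\<le>degree p. coeff p i * (y ^ i / exp y)) \<longlongrightarrow> (\<Sum>i\<le>degree p. coeff p i * 0)) at_top"
    by (intro tendsto_intros tendsto_power_div_exp_0)
  then show ?thesis
    by (simp add: poly_altdef exp_minus sum_distrib_right divide_inverse mult.assoc)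
qed

text \<open>On x > 0 the j-th derivative of exp(-1/x) is P_j(1/x) exp(-1/x); differentiating once
  more gives P_(j+1)(y) = y^2 (P_j(y) - P_j'(y)).\<close>

fun flat_poly :: "nat \<Rightarrow> real poly" where
  "flat_poly 0 = 1"
| "flat_poly (Suc j) = monom 1 2 * (flat_poly j - pderiv (flat_poly j))"

definition flat_deriv :: "nat \<Rightarrow> real \<Rightarrow> real" where
  "flat_deriv j x = (if x > 0 then poly (flat_poly j) (1 / x) * exp (- (1 / x)) else 0)"

definition flat :: "real \<Rightarrow> real" where
  "flat x = (if x > 0 then exp (- (1 / x)) else 0)"

lemma flat_deriv_0: "flat_deriv 0 = flat"
  by (auto simp: flat_deriv_def flat_def)

lemma flat_deriv_has_real_derivative:
  "(flat_deriv j has_real_derivative flat_deriv (Suc j) x) (at x)"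
proof -
  consider "x > 0" | "x < 0" | "x = 0" by linarith
  then show ?thesis
  proof cases
    case 1
    have "((\<lambda>x. poly (flat_poly j) (1 / x) * exp (- (1 / x))) has_real_derivative flat_deriv (Suc j) x) (at x)"
      using 1 by (auto intro!: derivative_eq_intros simp: flat_deriv_def poly_monom field_simps power2_eq_square)
    moreover have "\<forall>\<^sub>F y in nhds x. poly (flat_poly j) (1 / y) * exp (- (1 / y)) = flat_deriv j y"
      using eventually_nhds_in_open[of "{0<..}" x] 1
      by (auto elim!: eventually_mono simp: flat_deriv_def)
    ultimately show ?thesis by (subst DERIV_cong_ev[symmetric]) auto
  next
    case 2
    have "\<forall>\<^sub>F y in nhds x. 0 = flat_deriv j y"
      using eventually_nhds_in_open[of "{..<0}" x] 2
      by (auto elim!: eventually_mono simp: flat_deriv_def)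
    then show ?thesis
      using 2 by (subst DERIV_cong_ev[symmetric, where f = "\<lambda>_. 0" and x = x]) (auto simp: flat_deriv_def)
  next
    case 3
    \<comment> \<open>The difference quotient at 0 is \<open>flat_deriv j h / h\<close>; in terms of
      y = 1/h the division by h is the extra factor y.\<close>
    have "((\<lambda>y. poly ([:0, 1:] * flat_poly j) y * exp (- y)) \<longlongrightarrow> 0) at_top"
      by (rule poly_mult_exp_minus_tendsto_0)
    then have "((\<lambda>x. poly ([:0, 1:] * flat_poly j) (inverse x) * exp (- inverse x)) \<longlongrightarrow> 0) (at_right 0)"
      by (rule filterlim_compose) (rule filterlim_inverse_at_top_right)
    then have "((\<lambda>h. flat_deriv j h / h) \<longlongrightarrow> 0) (at_right 0)"
      by (rule Lim_transform_eventually)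
        (auto simp: flat_deriv_def eventually_at_right_less field_simps intro!: eventually_at_rightI[of 0 1])
    moreover have "((\<lambda>h. flat_deriv j h / h) \<longlongrightarrow> 0) (at_left 0)"
      by (rule Lim_transform_eventually[where f = "\<lambda>_. 0"])
        (auto simp: flat_deriv_def intro!: eventually_at_leftI[of "-1" 0])
    ultimately have "((\<lambda>h. flat_deriv j h / h) \<longlongrightarrow> 0) (at 0)"
      by (simp add: filterlim_split_at)
    then show ?thesis using 3 by (simp add: DERIV_def flat_deriv_def)
  qed
qed

lemma flat_nonneg: "0 \<le> flat x" and flat_pos: "0 < x \<Longrightarrow> 0 < flat x"
  and flat_le_1: "flat x \<le> 1" and flat_eq_0: "x \<le> 0 \<Longrightarrow> flat x = 0"
  by (auto simp: flat_def)

lemma class_C_flat_affine: "class_C k (\<lambda>x. flat (a \<bullet> x + c))"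
  using class_C_compose_affine[of flat_deriv, OF flat_deriv_has_real_derivative, of k 0] by (simp add: flat_deriv_0)

lemma flat_scaled_tendsto: "(\<lambda>k. flat (real k * x)) \<longlonglongrightarrow> (if x > 0 then 1 else 0)"
proof (cases "x > 0")
  case True
  have "(\<lambda>k. exp (- (1 / x * (1 / real k)))) \<longlonglongrightarrow> exp (- (1 / x * 0))"
    by (intro tendsto_intros lim_1_over_n)
  then have "(\<lambda>k. exp (- (1 / (real k * x)))) \<longlonglongrightarrow> 1" by (simp add: mult.commute)
  moreover have "\<forall>\<^sub>F k in sequentially. exp (- (1 / (real k * x))) = flat (real k * x)"
    using eventually_gt_at_top[of 0] by eventually_elim (use True in \<open>auto simp: flat_def\<close>)
  ultimately show ?thesis using True by (auto intro: Lim_transform_eventually)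
next
  case False
  then show ?thesis by (auto simp: flat_def zero_less_mult_iff)
qed

text \<open>The parameter k sharpens the bump towards the indicator of the open box. With k = 1 it
  is the mollifier kernel; letting k grow turns vanishing against test functions into vanishing
  integrals over boxes.\<close>

definition box_bump :: "real \<Rightarrow> real^'n \<Rightarrow> real^'n \<Rightarrow> real^'n \<Rightarrow> real" where
  "box_bump k a b x = (\<Prod>i\<in>UNIV. flat (k * (x $ i - a $ i)) * flat (k * (b $ i - x $ i)))"

lemma smooth_box_bump: "smooth (box_bump k a b)"
proof -
  have 1: "class_C j (\<lambda>x. flat (k * (x $ i - c)))" for j i c
    using class_C_flat_affine[of j "axis i k" "- k * c"]
    by (simp add: inner_axis algebra_simps inner_axis')
  have 2: "class_C j (\<lambda>x. flat (k * (c - x $ i)))" for j i c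
    using class_C_flat_affine[of j "axis i (-k)" "k * c"]
    by (simp add: inner_axis algebra_simps inner_axis')
  show ?thesis
    unfolding smooth_def box_bump_def by (intro allI class_C_prod class_C_mult 1 2)
qed

lemma box_bump_nonneg: "0 \<le> box_bump k a b x" and box_bump_le_1: "box_bump k a b x \<le> 1"
  unfolding box_bump_def by (auto intro!: prod_nonneg prod_le_1 mult_nonneg_nonneg mult_le_one flat_nonneg flat_le_1)

lemma box_bump_pos: "k > 0 \<Longrightarrow> x \<in> box a b \<Longrightarrow> 0 < box_bump k a b x"
  unfolding box_bump_def mem_box_cart by (auto intro!: prod_pos mult_pos_pos flat_pos)

lemma box_bump_eq_0: "k \<ge> 0 \<Longrightarrow> x \<notin> box a b \<Longrightarrow> box_bump k a b x = 0"
  unfolding box_bump_def mem_box_cart not_all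
  by (auto simp: not_less prod_zero_iff intro!: flat_eq_0 mult_nonneg_nonpos)

lemma box_bump_tendsto: "(\<lambda>k. box_bump (real k) a b x) \<longlonglongrightarrow> indicator (box a b) x"
proof -
  have "(\<lambda>k. box_bump (real k) a b x) \<longlonglongrightarrow>
      (\<Prod>i\<in>UNIV. (if x $ i - a $ i > 0 then 1 else 0) * (if b $ i - x $ i > 0 then 1 else 0))"
    unfolding box_bump_def by (intro tendsto_intros flat_scaled_tendsto)
  also have "(\<Prod>i\<in>UNIV. (if x $ i - a $ i > 0 then 1 else 0) * (if b $ i - x $ i > 0 then 1 else 0)) = (indicator (box a b) x :: real)"
    by (auto simp: indicator_def mem_box_cart)
  finally show ?thesis .
qed

lemma box_bump_test: "k \<ge> 0 \<Longrightarrow> cbox a b \<subseteq> \<Omega> \<Longrightarrow> box_bump k a b \<in> test_functions \<Omega>"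
  unfolding test_functions_def
  using box_subset_cbox by (auto intro!: smooth_box_bump exI[of _ "cbox a b"] box_bump_eq_0)

subsection \<open>Integration of compactly supported functions\<close>

lemma integrable_compact_support:
  fixes f :: "'a::euclidean_space \<Rightarrow> 'b::{banach, second_countable_topology}"
  assumes "continuous_on UNIV f" "compact K" "\<And>x. x \<notin> K \<Longrightarrow> f x = 0"
  shows "integrable lborel f"
proof -
  have "integrable lborel (\<lambda>x. indicator K x *\<^sub>R f x)"
    by (intro borel_integrable_compact assms continuous_on_subset[OF assms(1)]) auto
  moreover have "(\<lambda>x. indicator K x *\<^sub>R f x) = f"
    using assms(3) by (auto simp: indicator_def fun_eq_iff)
  ultimately show ?thesis by simp
qed

lemma bounded_compact_support:
  fixes f :: "'a::euclidean_space \<Rightarrow> 'b::real_normed_vector"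
  assumes "continuous_on UNIV f" "compact K" "\<And>x. x \<notin> K \<Longrightarrow> f x = 0"
  obtains B where "B \<ge> 0" "\<And>x. norm (f x) \<le> B"
proof -
  have "bounded (f ` K)"
    by (intro compact_imp_bounded compact_continuous_image assms continuous_on_subset[OF assms(1)]) auto
  then obtain B where B: "\<forall>x\<in>K. norm (f x) \<le> B" by (auto simp: bounded_iff)
  show ?thesis
  proof (rule that[of "max B 0"])
    show "norm (f x) \<le> max B 0" for x using B assms(3)[of x] by (cases "x \<in> K") (auto intro: le_max_iff_disj[THEN iffD2])
  qed simp
qed

lemma derivative_zero_off_support:
  assumes "compact K" "\<And>x. x \<notin> K \<Longrightarrow> f x = 0" "(f has_derivative D) (at x)" "x \<notin> K"
  shows "D v = 0"
proof -
  have "\<forall>\<^sub>F y in at x. y \<in> - K"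
    using assms by (intro eventually_at_in_open' open_Compl compact_imp_closed) auto
  then have "((\<lambda>_. 0) has_derivative D) (at x)"
    using assms by (intro has_derivative_transform_eventually[OF assms(3)]) (auto elim: eventually_mono)
  then have "D = (\<lambda>_. 0)" by (rule has_derivative_unique) simp
  then show ?thesis by simp
qed

lemma DERIV_along_line:
  fixes f :: "'a::real_normed_vector \<Rightarrow> real"
  assumes "(f has_derivative D) (at (x + s *\<^sub>R v))"
  shows "((\<lambda>h. f (x + h *\<^sub>R v)) has_real_derivative D v) (at s)"
proof -
  have "((\<lambda>h. f (x + h *\<^sub>R v)) has_derivative (\<lambda>h. D (h *\<^sub>R v))) (at s)"
    by (rule has_derivative_compose[of "\<lambda>h. x + h *\<^sub>R v" "\<lambda>h. h *\<^sub>R v" s UNIV f D, simplified])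
      (use assms in \<open>auto intro!: derivative_eq_intros\<close>)
  moreover have "(\<lambda>h. D (h *\<^sub>R v)) = (*) (D v)"
    using has_derivative_bounded_linear[OF assms]
    by (auto simp: fun_eq_iff bounded_linear.linear linear_cmul)
  ultimately show ?thesis by (simp add: has_field_derivative_def)
qed

lemma gradient_off_support:
  assumes "compact K" "\<And>x. x \<notin> K \<Longrightarrow> f x = 0" "\<And>x. (f has_derivative (\<lambda>v. g x \<bullet> v)) (at x)" "x \<notin> K"
  shows "g x = 0"
  using derivative_zero_off_support[OF assms(1,2,3,4), of "g x"] by simp

lemma lborel_integral_translate:
  fixes f :: "'a::euclidean_space \<Rightarrow> 'b::{banach, second_countable_topology}"
  assumes "f \<in> borel_measurable borel"
  shows "(LINT x|lborel. f (x + c)) = (LINT x|lborel. f x)"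
  using integral_distr[of "(+) c" lborel borel f] assms by (simp add: lborel_distr_plus add.commute)

lemma lborel_integral_reflect:
  fixes f :: "'a::euclidean_space \<Rightarrow> 'b::{banach, second_countable_topology}"
  assumes "f \<in> borel_measurable borel"
  shows "(LINT x|lborel. f (c - x)) = (LINT x|lborel. f x)"
proof -
  have "lborel = distr lborel borel (\<lambda>x::'a. c - x)"
    by (subst lborel_affine[of "-1" c]) (auto simp: density_1)
  then have "(LINT x|lborel. f x) = (LINT x|distr lborel borel (\<lambda>x. c - x). f x)" by simp
  also have "\<dots> = (LINT x|lborel. f (c - x))"
    by (rule integral_distr) (use assms in auto)
  finally show ?thesis by simp
qed

text \<open>Translation invariance makes the integral of every difference quotient along v vanish,
  and dominated convergence carries this to the derivative. Integration by parts follows in any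
  direction, without iterated integrals.\<close>

lemma integral_directional_derivative_zero:
  fixes f :: "'a::euclidean_space \<Rightarrow> real"
  assumes f: "\<And>x. (f has_derivative f' x) (at x)"
    and cont: "continuous_on UNIV (\<lambda>x. f' x v)"
    and K: "compact K" "\<And>x. x \<notin> K \<Longrightarrow> f x = 0"
  shows "integrable lborel (\<lambda>x. f' x v)" "(LINT x|lborel. f' x v) = 0"
proof -
  have z: "f' x v = 0" if "x \<notin> K" for x
    using derivative_zero_off_support[OF K f that] by simp
  show int: "integrable lborel (\<lambda>x. f' x v)"
    by (rule integrable_compact_support[OF cont K(1) z])
  have cf: "continuous_on UNIV f"
    using f by (auto intro!: continuous_at_imp_continuous_on has_derivative_continuous)
  have intf: "integrable lborel f" by (rule integrable_compact_support[OF cf K])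
  then have [measurable]: "f \<in> borel_measurable borel" by auto
  obtain B where B: "B \<ge> 0" "\<And>x. norm (f' x v) \<le> B"
    using bounded_compact_support[OF cont K(1) z] by blast
  obtain R where R: "R > 0" "\<And>x. x \<in> K \<Longrightarrow> norm x \<le> R"
    using compact_imp_bounded[OF K(1)] by (auto simp: bounded_pos)
  define t where "t k = 1 / real (Suc k)" for k
  have t: "0 < t k" "t k \<le> 1" for k by (auto simp: t_def)
  define q where "q k x = (f (x + t k *\<^sub>R v) - f x) / t k" for k x
  have q0: "(LINT x|lborel. q k x) = 0" for k
  proof -
    have "integrable lborel (\<lambda>x. f (x + t k *\<^sub>R v))"
      using integrable_distr[of "(+) (t k *\<^sub>R v)" lborel borel f] intf
      by (simp add: lborel_distr_plus add.commute)
    then show ?thesis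
      using intf lborel_integral_translate[of f "t k *\<^sub>R v"] by (simp add: q_def)
  qed
  have "(\<lambda>k. LINT x|lborel. q k x) \<longlonglongrightarrow> (LINT x|lborel. f' x v)"
  proof (rule integral_dominated_convergence)
    \<comment> \<open>The mean value theorem bounds the quotients by B, and as the steps are at most
      1 the translated support stays in the ball of radius R + |v|.\<close>
    show "integrable lborel (\<lambda>x. indicator (cball (0::'a) (R + norm v)) x *\<^sub>R B)"
      by (intro borel_integrable_compact) auto
    show "AE x in lborel. (\<lambda>k. q k x) \<longlonglongrightarrow> f' x v"
    proof (intro AE_I2)
      fix x
      have "((\<lambda>h. (f (x + h *\<^sub>R v) - f x) / h) \<longlongrightarrow> f' x v) (at 0)"
        using DERIV_along_line[of f "f' x" x 0 v] f by (simp add: DERIV_def)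
      moreover have "filterlim t (at 0) sequentially"
        unfolding filterlim_at using t(1) LIMSEQ_inverse_real_of_nat
        by (auto simp: t_def[abs_def] inverse_eq_divide intro!: always_eventually)
      ultimately show "(\<lambda>k. q k x) \<longlonglongrightarrow> f' x v"
        unfolding q_def by (rule filterlim_compose)
    qed
    show "AE x in lborel. norm (q k x) \<le> indicator (cball 0 (R + norm v)) x *\<^sub>R B" for k
    proof (intro AE_I2)
      fix x
      show "norm (q k x) \<le> indicator (cball 0 (R + norm v)) x *\<^sub>R B"
      proof (cases "norm x \<le> R + norm v")
        case True
        have d: "((\<lambda>s. f (x + s *\<^sub>R v)) has_real_derivative f' (x + s *\<^sub>R v) v) (at s)" for s
          by (rule DERIV_along_line[OF f])
        obtain s where "f (x + t k *\<^sub>R v) - f (x + 0 *\<^sub>R v) = (t k - 0) * f' (x + s *\<^sub>R v) v"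
          using MVT2[OF t(1)[of k], of "\<lambda>s. f (x + s *\<^sub>R v)" "\<lambda>s. f' (x + s *\<^sub>R v) v"] d by auto
        then have "q k x = f' (x + s *\<^sub>R v) v" using t(1)[of k] by (simp add: q_def)
        then show ?thesis using B(2) True by (simp add: mem_cball)
      next
        case False
        have "x \<notin> K" using R(2)[of x] False norm_ge_zero[of v] by linarith
        moreover have "x + t k *\<^sub>R v \<notin> K"
        proof
          assume "x + t k *\<^sub>R v \<in> K"
          then have "norm (x + t k *\<^sub>R v) \<le> R" by (rule R)
          moreover have "norm (t k *\<^sub>R v) \<le> norm v" using t[of k] mult_right_mono[of "t k" 1 "norm v"] by simp
          ultimately show False
            using False norm_triangle_ineq4[of "x + t k *\<^sub>R v" "t k *\<^sub>R v"] by simp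
        qed
        ultimately show ?thesis using K False by (simp add: q_def mem_cball)
      qed
    qed
  qed (use int in \<open>auto simp: q_def[abs_def]\<close>)
  then show "(LINT x|lborel. f' x v) = 0"
    using q0 by (simp add: LIMSEQ_const_iff)
qed

subsection \<open>Mollification\<close>

text \<open>Differentiation falls on \<rho> alone, so a directional derivative is a convolution of
  the same kind and the induction generalises over \<rho>. Writing the convolution as a gauge
  integral over the box gives access to the Leibniz rule.\<close>

lemma smooth_convolution:
  fixes \<rho> \<zeta> :: "'a::euclidean_space \<Rightarrow> real"
  assumes "smooth \<rho>" and \<zeta>: "continuous_on UNIV \<zeta>" "\<And>x. x \<notin> cbox a b \<Longrightarrow> \<zeta> x = 0"
  shows "smooth (\<lambda>x. LINT y|lborel. \<rho> (x - y) * \<zeta> y)"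
proof -
  have eq: "(LINT y|lborel. \<rho> (x - y) * \<zeta> y) = integral (cbox a b) (\<lambda>y. \<rho> (x - y) * \<zeta> y)"
    if "smooth \<rho>" for x and \<rho> :: "'a \<Rightarrow> real"
  proof -
    have "set_integrable lborel (cbox a b) (\<lambda>y. \<rho> (x - y) * \<zeta> y)"
      unfolding set_integrable_def
      by (intro borel_integrable_compact)
        (auto intro!: continuous_intros continuous_on_compose2[OF smooth_continuous[OF that]] continuous_on_subset[OF \<zeta>(1)])
    then have "(LINT y:cbox a b|lborel. \<rho> (x - y) * \<zeta> y) = integral (cbox a b) (\<lambda>y. \<rho> (x - y) * \<zeta> y)"
      by (rule set_borel_integral_eq_integral)
    moreover have "(LINT y:cbox a b|lborel. \<rho> (x - y) * \<zeta> y) = (LINT y|lborel. \<rho> (x - y) * \<zeta> y)"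
      unfolding set_lebesgue_integral_def
      using \<zeta>(2) by (intro Bochner_Integration.integral_cong) (auto simp: indicator_def)
    ultimately show ?thesis by simp
  qed
  have "class_C k (\<lambda>x. integral (cbox a b) (\<lambda>y. \<rho> (x - y) * \<zeta> y))" if "smooth \<rho>" for k and \<rho> :: "'a \<Rightarrow> real"
    using that
  proof (induction k arbitrary: \<rho>)
    case 0
    have "continuous_on (UNIV \<times> cbox a b) (\<lambda>(x, y). \<rho> (x - y) * \<zeta> y)"
      unfolding split_beta
      by (auto intro!: continuous_intros continuous_on_compose2[OF smooth_continuous[OF 0]] continuous_on_compose2[OF \<zeta>(1)])
    then show ?case
      by (auto intro!: integral_continuous_on_param)
  next
    case (Suc k)
    define D where "D x y = \<zeta> y *\<^sub>R Blinfun (frechet_derivative \<rho> (at (x - y)))" for x y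
    have bl: "bounded_linear (frechet_derivative \<rho> (at z))" for z
      using smooth_has_derivative[OF Suc.prems] by (rule has_derivative_bounded_linear)
    have D: "blinfun_apply (D x y) v = frechet_derivative \<rho> (at (x - y)) v * \<zeta> y" for x y v
      by (simp add: D_def blinfun.scaleR_left bounded_linear_Blinfun_apply[OF bl])
    have cD: "continuous_on (UNIV \<times> cbox a b) (\<lambda>(x, y). D x y)"
      unfolding split_beta
      by (rule continuous_on_blinfun_componentwise)
        (auto simp: D intro!: continuous_intros continuous_on_compose2[OF smooth_continuous[OF smooth_directional[OF Suc.prems]]] continuous_on_compose2[OF \<zeta>(1)])
    have der: "((\<lambda>x. integral (cbox a b) (\<lambda>y. \<rho> (x - y) * \<zeta> y)) has_derivative
        blinfun_apply (integral (cbox a b) (D x0))) (at x0 within UNIV)" for x0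
    proof (rule leibniz_rule[where fx = D])
      show "((\<lambda>x. \<rho> (x - t) * \<zeta> t) has_derivative blinfun_apply (D x t)) (at x within UNIV)" for x t
      proof -
        have "((\<lambda>x. \<rho> (x - t)) has_derivative frechet_derivative \<rho> (at (x - t))) (at x)"
          by (rule has_derivative_compose[of "\<lambda>x. x - t" "\<lambda>x. x" x UNIV \<rho>, simplified])
            (auto intro!: derivative_eq_intros smooth_has_derivative[OF Suc.prems])
        moreover have "blinfun_apply (D x t) = (\<lambda>v. frechet_derivative \<rho> (at (x - t)) v * \<zeta> t)"
          by (simp add: D fun_eq_iff)
        ultimately show ?thesis using has_derivative_mult_left[of _ _ _ "\<zeta> t"] by simp
      qed
      show "(\<lambda>y. \<rho> (x - y) * \<zeta> y) integrable_on cbox a b" for x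
        by (rule integrable_continuous)
         (auto intro!: continuous_intros continuous_on_compose2[OF smooth_continuous[OF Suc.prems]] continuous_on_subset[OF \<zeta>(1)])
    qed (use cD in auto)
    show ?case
    proof (rule class_C_SucI)
      show "((\<lambda>x. integral (cbox a b) (\<lambda>y. \<rho> (x - y) * \<zeta> y)) has_derivative
        blinfun_apply (integral (cbox a b) (D x0))) (at x0)" for x0 using der by simp
      fix v
      have "blinfun_apply (integral (cbox a b) (D x)) v = integral (cbox a b) (\<lambda>y. frechet_derivative \<rho> (at (x - y)) v * \<zeta> y)" for x
      proof -
        have "continuous_on (cbox a b) (D x)"
          by (rule continuous_on_compose2[OF cD, of _ "\<lambda>y. (x, y)", simplified]) (auto intro!: continuous_intros)
        then show ?thesis
          by (subst blinfun_apply_integral) (auto intro: integrable_continuous simp: D)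
      qed
      then show "class_C k (\<lambda>x. blinfun_apply (integral (cbox a b) (D x)) v)"
        using Suc.IH[OF smooth_directional[OF Suc.prems]] by simp
    qed
  qed
  moreover have "(\<lambda>x. LINT y|lborel. \<rho> (x - y) * \<zeta> y) = (\<lambda>x. integral (cbox a b) (\<lambda>y. \<rho> (x - y) * \<zeta> y))"
    using eq[OF assms(1)] by blast
  ultimately show ?thesis using assms(1) by (simp add: smooth_def)
qed

lemma mollifier_exists:
  assumes "\<kappa> > 0"
  obtains \<rho> :: "real^'n \<Rightarrow> real" where "smooth \<rho>" "\<And>x. 0 \<le> \<rho> x" "\<And>x. x \<notin> cball 0 \<kappa> \<Longrightarrow> \<rho> x = 0"
    "(LINT x|lborel. \<rho> x) = 1"
proof -
  \<comment> \<open>On this box every coordinate is at most \<kappa> / n in modulus, so the l^1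
    norm, and with it the Euclidean norm, is at most \<kappa>.\<close>
  define b :: "real^'n" where "b = (\<chi> i. \<kappa> / real CARD('n))"
  have b: "0 \<in> box (-b) b" "box (-b) b \<subseteq> cball 0 \<kappa>"
  proof -
    show "0 \<in> box (-b) b" using assms by (simp add: mem_box_cart b_def)
    show "box (-b) b \<subseteq> cball 0 \<kappa>"
    proof
      fix x assume "x \<in> box (-b) b"
      then have "\<bar>x $ i\<bar> \<le> \<kappa> / real CARD('n)" for i
        by (simp add: mem_box_cart b_def abs_le_iff) (smt (verit))
      then have "(\<Sum>i\<in>UNIV. \<bar>x $ i\<bar>) \<le> (\<Sum>i\<in>(UNIV::'n set). \<kappa> / real CARD('n))"
        by (intro sum_mono)
      then have "norm x \<le> \<kappa>" using norm_le_l1_cart[of x] by simp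
      then show "x \<in> cball 0 \<kappa>" by simp
    qed
  qed
  let ?\<beta> = "box_bump 1 (-b) b"
  have int: "integrable lborel ?\<beta>"
    by (rule integrable_compact_support[OF smooth_continuous[OF smooth_box_bump], of "cbox (-b) b"])
      (use box_subset_cbox[of "-b" b] in \<open>auto intro!: box_bump_eq_0\<close>)
  have pos: "(LINT x|lborel. ?\<beta> x) > 0"
  proof (rule ccontr)
    assume "\<not> ?thesis"
    moreover have "(LINT x|lborel. ?\<beta> x) \<ge> 0"
      by (intro integral_nonneg_AE AE_I2 box_bump_nonneg)
    ultimately have "(LINT x|lborel. ?\<beta> x) = 0" by linarith
    moreover have "AE x in lborel. 0 \<le> ?\<beta> x"
      by (intro AE_I2 box_bump_nonneg)
    ultimately have *: "AE x in lborel. ?\<beta> x = 0"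
      using integral_nonneg_eq_0_iff_AE[OF int] by simp
    have "AE x in lborel. x \<notin> box (-b) b"
      using * by (rule eventually_mono) (metis box_bump_pos less_irrefl zero_less_one)
    then have "box (-b) b \<in> null_sets lborel"
      by (subst (asm) AE_iff_null_sets[symmetric]) auto
    then have "negligible (box (-b) b)"
      by (simp add: negligible_iff_null_sets null_sets_completionI)
    then show False using b(1) open_not_negligible[OF open_box, of "-b" b] by blast
  qed
  show ?thesis
  proof (rule that[of "\<lambda>x. inverse (LINT x|lborel. ?\<beta> x) * ?\<beta> x"])
    show "smooth (\<lambda>x. inverse (LINT x|lborel. ?\<beta> x) * ?\<beta> x)"
      by (rule smooth_linear[OF bounded_linear_mult_right smooth_box_bump])
    show "inverse (LINT x|lborel. ?\<beta> x) * ?\<beta> x = 0" if "x \<notin> cball 0 \<kappa>" for x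
    proof -
      have "x \<notin> box (-b) b" using b(2) that by blast
      then show ?thesis by (simp add: box_bump_eq_0)
    qed
  qed (use pos box_bump_nonneg[of 1 "-b" b] in \<open>auto intro: less_imp_le\<close>)
qed

text \<open>All that is needed of a mollification: difference quotients of \<open>\<zeta>\<close> near \<open>x\<close> control the
  derivative of \<open>\<psi>\<close> at \<open>x\<close>.\<close>

lemma mollification_exists:
  fixes \<zeta> :: "real^'n \<Rightarrow> real"
  assumes \<zeta>: "continuous_on UNIV \<zeta>" and K: "compact K" "\<And>x. x \<notin> K \<Longrightarrow> \<zeta> x = 0" and \<kappa>: "\<kappa> > 0"
  obtains \<psi> where "smooth \<psi>" "\<And>x. (\<And>z. z \<in> cball x \<kappa> \<Longrightarrow> \<zeta> z = 0) \<Longrightarrow> \<psi> x = 0"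
    "\<And>x v c \<eta> t0. 0 < t0 \<Longrightarrow>
       (\<And>z t. z \<in> cball x \<kappa> \<Longrightarrow> 0 < t \<Longrightarrow> t < t0 \<Longrightarrow> \<bar>\<zeta> (z + t *\<^sub>R v) - \<zeta> z - t * c\<bar> \<le> \<eta> * t) \<Longrightarrow>
       \<bar>frechet_derivative \<psi> (at x) v - c\<bar> \<le> \<eta>"
proof -
  obtain \<rho> :: "real^'n \<Rightarrow> real" where \<rho>: "smooth \<rho>" "\<And>x. 0 \<le> \<rho> x" "\<And>x. x \<notin> cball 0 \<kappa> \<Longrightarrow> \<rho> x = 0"
    "(LINT x|lborel. \<rho> x) = 1" by (rule mollifier_exists[OF \<kappa>]) blast
  obtain a b where ab: "K \<subseteq> cbox a b"
    using bounded_subset_cbox_symmetric[OF compact_imp_bounded[OF K(1)]] by blast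
  note c\<rho> = smooth_continuous[OF \<rho>(1)]
  have [measurable]: "\<rho> \<in> borel_measurable borel" "\<zeta> \<in> borel_measurable borel"
    using c\<rho> \<zeta> by (auto intro: borel_measurable_continuous_onI)
  define \<psi> where "\<psi> x = (LINT y|lborel. \<rho> (x - y) * \<zeta> y)" for x
  have sm: "smooth \<psi>"
    unfolding \<psi>_def by (rule smooth_convolution[OF \<rho>(1) \<zeta>, of a b]) (use ab K in auto)
  \<comment> \<open>The defining form, with x inside \<rho>, yields smoothness; this reflected form
    averages translates of \<zeta> and yields the bound on difference quotients.\<close>
  have \<psi>: "\<psi> x = (LINT y|lborel. \<rho> y * \<zeta> (x - y))" for x
    using lborel_integral_reflect[of "\<lambda>y. \<rho> y * \<zeta> (x - y)" x] by (simp add: \<psi>_def)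
  have int\<rho>: "integrable lborel \<rho>"
    by (rule integrable_compact_support[OF c\<rho> compact_cball \<rho>(3)])
  have int: "integrable lborel (\<lambda>y. \<rho> y * \<zeta> (x - y))" for x
    by (rule integrable_compact_support[OF _ compact_cball[of 0 \<kappa>]])
      (auto intro!: continuous_intros c\<rho> continuous_on_compose2[OF \<zeta>] simp: \<rho>(3))
  show ?thesis
  proof (rule that[OF sm])
    fix x assume z: "\<And>z. z \<in> cball x \<kappa> \<Longrightarrow> \<zeta> z = 0"
    have "\<rho> y * \<zeta> (x - y) = 0" for y
      using z[of "x - y"] \<rho>(3)[of y] by (cases "y \<in> cball 0 \<kappa>") (auto simp: dist_norm)
    then have "(\<lambda>y. \<rho> y * \<zeta> (x - y)) = (\<lambda>_. 0)" by blast
    then show "\<psi> x = 0" unfolding \<psi> by simp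
  next
    fix x v :: "real^'n" and c \<eta> t0 :: real
    assume t0: "0 < t0" and *: "\<And>z t. z \<in> cball x \<kappa> \<Longrightarrow> 0 < t \<Longrightarrow> t < t0 \<Longrightarrow> \<bar>\<zeta> (z + t *\<^sub>R v) - \<zeta> z - t * c\<bar> \<le> \<eta> * t"
    \<comment> \<open>Since \<rho> is a probability density on the ball of radius \<kappa>, the
      increment of \<psi> at x is an average of increments of \<zeta> at points x - y of the ball
      around x.\<close>
    have b: "\<bar>(\<psi> (x + t *\<^sub>R v) - \<psi> x) / t - c\<bar> \<le> \<eta>" if t: "0 < t" "t < t0" for t
    proof -
      have "\<psi> (x + t *\<^sub>R v) - \<psi> x - t * c = (LINT y|lborel. \<rho> y * \<zeta> (x + t *\<^sub>R v - y) - \<rho> y * \<zeta> (x - y) - \<rho> y * (t * c))"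
        using int[of x] int[of "x + t *\<^sub>R v"] int\<rho> \<rho>(4) by (simp add: \<psi>)
      also have "\<bar>\<dots>\<bar> \<le> (LINT y|lborel. \<rho> y * (\<eta> * t))"
      proof (rule order_trans[OF integral_abs_bound integral_mono])
        show "integrable lborel (\<lambda>y. \<bar>\<rho> y * \<zeta> (x + t *\<^sub>R v - y) - \<rho> y * \<zeta> (x - y) - \<rho> y * (t * c)\<bar>)"
          using int[of x] int[of "x + t *\<^sub>R v"] int\<rho> by auto
        show "\<bar>\<rho> y * \<zeta> (x + t *\<^sub>R v - y) - \<rho> y * \<zeta> (x - y) - \<rho> y * (t * c)\<bar> \<le> \<rho> y * (\<eta> * t)" for y
        proof (cases "y \<in> cball 0 \<kappa>")
          case True
          have "\<rho> y * \<zeta> (x + t *\<^sub>R v - y) - \<rho> y * \<zeta> (x - y) - \<rho> y * (t * c) = \<rho> y * (\<zeta> ((x - y) + t *\<^sub>R v) - \<zeta> (x - y) - t * c)"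
            by (simp add: algebra_simps)
          moreover have "\<bar>\<zeta> ((x - y) + t *\<^sub>R v) - \<zeta> (x - y) - t * c\<bar> \<le> \<eta> * t"
            using True by (intro *) (auto simp: dist_norm t)
          ultimately show ?thesis using \<rho>(2)[of y] by (simp add: abs_mult mult_left_mono)
        qed (simp add: \<rho>(3))
      qed (use int\<rho> in auto)
      also have "\<dots> = \<eta> * t" using \<rho>(4) by simp
      finally have "\<bar>\<psi> (x + t *\<^sub>R v) - \<psi> x - t * c\<bar> \<le> \<eta> * t" .
      moreover have "(\<psi> (x + t *\<^sub>R v) - \<psi> x) / t - c = (\<psi> (x + t *\<^sub>R v) - \<psi> x - t * c) / t" using t by (simp add: field_simps)
      ultimately show ?thesis using t by (simp add: abs_divide field_simps)
    qed
    have "((\<lambda>h. (\<psi> (x + h *\<^sub>R v) - \<psi> x) / h) \<longlongrightarrow> frechet_derivative \<psi> (at x) v) (at_right 0)"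
      using DERIV_along_line[of \<psi> "frechet_derivative \<psi> (at x)" x 0 v] smooth_has_derivative[OF sm, of x]
      by (simp add: DERIV_def filterlim_at_split)
    then have "((\<lambda>h. \<bar>(\<psi> (x + h *\<^sub>R v) - \<psi> x) / h - c\<bar>) \<longlongrightarrow> \<bar>frechet_derivative \<psi> (at x) v - c\<bar>) (at_right 0)"
      by (intro tendsto_intros)
    moreover have "\<forall>\<^sub>F h in at_right 0. \<bar>(\<psi> (x + h *\<^sub>R v) - \<psi> x) / h - c\<bar> \<le> \<eta>"
      using b t0 by (intro eventually_at_rightI[of 0 t0]) auto
    ultimately show "\<bar>frechet_derivative \<psi> (at x) v - c\<bar> \<le> \<eta>"
      by (rule tendsto_upperbound) simp
  qed
qed

section \<open>Weak gradients\<close>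

text \<open>Open boxes form an intersection-stable generator, so vanishing spreads to all Borel
  sets, in particular to the sets where h is positive or negative. The enclosing box makes the
  integral over the whole space vanish, which the complement step needs.\<close>

lemma AE_zero_if_box_integrals_zero:
  fixes h :: "'a::euclidean_space \<Rightarrow> real"
  assumes h: "integrable lborel h" and z: "\<And>a b. (LINT x|lborel. indicator (box a b) x * h x) = 0"
    and c: "\<And>x. x \<notin> box c d \<Longrightarrow> h x = 0"
  shows "AE x in lborel. h x = 0"
proof -
  have i: "integrable lborel (\<lambda>x. indicator A x * h x)" if "A \<in> sets borel" for A
    using integrable_mult_indicator[OF _ h, of A] that by simp
  have P: "(LINT x|lborel. indicator A x * h x) = 0" if "A \<in> sets borel" for A
  proof -
    have "Int_stable (range (\<lambda>(a, b). box a b :: 'a set))"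
      by (auto simp: Int_stable_def box_Int_box)
    moreover have "(range (\<lambda>(a, b). box a b :: 'a set)) \<subseteq> Pow UNIV" by auto
    moreover have "A \<in> sigma_sets UNIV (range (\<lambda>(a, b). box a b))"
      using that unfolding borel_eq_box by simp
    ultimately show ?thesis
    proof (induction rule: sigma_sets_induct_disjoint)
      case (basic A)
      then show ?case using z by auto
    next
      case empty
      then show ?case by simp
    next
      case (compl A)
      then have [measurable]: "A \<in> sets borel" by (simp add: borel_eq_box)
      have "(LINT x|lborel. h x) = (LINT x|lborel. indicator (box c d) x * h x)"
        using c by (intro Bochner_Integration.integral_cong) (auto simp: indicator_def)
      then have "(LINT x|lborel. h x) = 0" using z by simp
      moreover have "(LINT x|lborel. indicator (UNIV - A) x * h x) = (LINT x|lborel. h x - indicator A x * h x)"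
        by (intro Bochner_Integration.integral_cong) (auto simp: indicator_def)
      ultimately show ?case using compl h i[of A] by simp
    next
      case (union F)
      then have [measurable]: "\<And>i. F i \<in> sets borel" by (simp add: borel_eq_box subset_eq)
      have "(LINT x:(\<Union>i. F i)|lborel. h x) = (\<Sum>i. (LINT x:(F i)|lborel. h x))"
        using union(1) i[of "\<Union>i. F i"]
        by (intro lebesgue_integral_countable_add) (auto simp: disjoint_family_on_def set_integrable_def)
      then show ?case using union(3) by (simp add: set_lebesgue_integral_def)
    qed
  qed
  have [measurable]: "h \<in> borel_measurable borel" using h by auto
  have "AE x in lborel. indicator {x. h x > 0} x * h x = 0"
    using integral_nonneg_eq_0_iff_AE[of lborel "\<lambda>x. indicator {x. h x > 0} x * h x"] i[of "{x. h x > 0}"] P[of "{x. h x > 0}"]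
    by (auto simp: indicator_def)
  moreover have "AE x in lborel. indicator {x. h x < 0} x * - h x = 0"
    using integral_nonneg_eq_0_iff_AE[of lborel "\<lambda>x. indicator {x. h x < 0} x * - h x"] i[of "{x. h x < 0}"] P[of "{x. h x < 0}"]
    by (auto simp: indicator_def)
  ultimately show ?thesis
    by eventually_elim (auto simp: indicator_def split: if_splits)
qed

section \<open>Compactly supported and locally integrable functions under restricted Lebesgue
  measure\<close>

lemma borel_measurable_continuous_lebesgue_on:
  fixes f :: "'a::euclidean_space \<Rightarrow> 'b::{second_countable_topology, real_normed_vector}"
  assumes "continuous_on UNIV f"
  shows "f \<in> borel_measurable (lebesgue_on S)"
proof -
  have "f \<in> borel_measurable lborel" using assms by (simp add: borel_measurable_continuous_onI)
  then show ?thesis by (intro measurable_restrict_space1 measurable_completion)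
qed

lemma integral_lebesgue_on_eq_lborel:
  fixes f :: "'a::euclidean_space \<Rightarrow> 'b::{banach, second_countable_topology}"
  assumes "continuous_on UNIV f" "S \<in> sets lebesgue" "\<And>x. x \<notin> S \<Longrightarrow> f x = 0"
  shows "(LINT x|lebesgue_on S. f x) = (LINT x|lborel. f x)"
    "integrable (lebesgue_on S) f \<longleftrightarrow> integrable lborel f"
proof -
  have eq: "(\<lambda>x. indicator S x *\<^sub>R f x) = f"
    using assms(3) by (auto simp: indicator_def fun_eq_iff)
  have m: "f \<in> borel_measurable lborel" using assms(1) by (simp add: borel_measurable_continuous_onI)
  show "(LINT x|lebesgue_on S. f x) = (LINT x|lborel. f x)"
    using assms(2) by (simp add: integral_restrict_space eq integral_completion[OF m])
  show "integrable (lebesgue_on S) f \<longleftrightarrow> integrable lborel f"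
    using assms(2) by (simp add: integrable_restrict_space eq integrable_completion[OF m])
qed

lemma test_functionsE:
  assumes "\<phi> \<in> test_functions \<Omega>"
  obtains K where "smooth \<phi>" "compact K" "K \<subseteq> \<Omega>" "\<And>x. x \<notin> K \<Longrightarrow> \<phi> x = 0"
  using assms unfolding test_functions_def by blast

lemma L1_loc_linear:
  assumes "g \<in> L1_loc \<Omega>" "bounded_linear L"
  shows "(\<lambda>x. L (g x)) \<in> L1_loc \<Omega>"
proof -
  have "(\<lambda>x. L (g x)) \<in> borel_measurable (lebesgue_on \<Omega>)"
    using assms(1) borel_measurable_continuous_onI[OF linear_continuous_on[OF assms(2)]]
    unfolding L1_loc_def by (auto intro: measurable_compose)
  moreover have "integrable (lebesgue_on K) (\<lambda>x. L (g x))" if "compact K" "K \<subseteq> \<Omega>" for K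
    using assms(1) that unfolding L1_loc_def by (intro integrable_bounded_linear[OF assms(2)]) blast
  ultimately show ?thesis unfolding L1_loc_def by blast
qed

lemma L1_loc_diff:
  assumes "g \<in> L1_loc \<Omega>" "h \<in> L1_loc \<Omega>"
  shows "(\<lambda>x. g x - h x) \<in> L1_loc \<Omega>"
  using assms by (auto simp: L1_loc_def)

lemma L1_loc_mult_integrable:
  fixes g :: "'a::euclidean_space \<Rightarrow> real"
  assumes \<Omega>: "open \<Omega>" and g: "g \<in> L1_loc \<Omega>" and \<phi>: "continuous_on UNIV \<phi>" "compact K" "K \<subseteq> \<Omega>" "\<And>x. x \<notin> K \<Longrightarrow> \<phi> x = 0"
  shows "integrable (lebesgue_on \<Omega>) (\<lambda>x. g x * \<phi> x)"
    "(LINT x|lebesgue_on \<Omega>. g x * \<phi> x) = (LINT x|lebesgue. indicator K x * g x * \<phi> x)"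
    "integrable lebesgue (\<lambda>x. indicator K x * g x)"
proof -
  have [measurable]: "K \<in> sets lebesgue" "\<Omega> \<in> sets lebesgue"
    using \<phi>(2) \<Omega> by (auto simp: lmeasurable_compact fmeasurableD)
  show int: "integrable lebesgue (\<lambda>x. indicator K x * g x)"
    using g \<phi>(2,3) by (auto simp: L1_loc_def integrable_restrict_space)
  obtain B where B: "B \<ge> 0" "\<And>x. norm (\<phi> x) \<le> B"
    using bounded_compact_support[OF \<phi>(1,2,4)] by blast
  have [measurable]: "\<phi> \<in> borel_measurable lebesgue"
    using borel_measurable_continuous_lebesgue_on[OF \<phi>(1), of UNIV] by (simp add: lebesgue_on_UNIV_eq)
  have "integrable lebesgue (\<lambda>x. indicator K x * g x * \<phi> x)"
  proof (rule Bochner_Integration.integrable_bound)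
    show "integrable lebesgue (\<lambda>x. B * (indicator K x * g x))" using int by simp
    show "AE x in lebesgue. norm (indicator K x * g x * \<phi> x) \<le> norm (B * (indicator K x * g x))"
      using B by (auto intro!: AE_I2 simp: abs_mult indicator_def mult.commute mult_right_mono)
  qed (use int in auto)
  moreover have eq: "(\<lambda>x. indicator \<Omega> x *\<^sub>R (g x * \<phi> x)) = (\<lambda>x. indicator K x * g x * \<phi> x)"
    using \<phi>(3,4) by (auto simp: indicator_def fun_eq_iff)
  ultimately show "integrable (lebesgue_on \<Omega>) (\<lambda>x. g x * \<phi> x)"
    by (simp add: integrable_restrict_space)
  show "(LINT x|lebesgue_on \<Omega>. g x * \<phi> x) = (LINT x|lebesgue. indicator K x * g x * \<phi> x)"
    by (simp only: eq[symmetric]) (simp add: integral_restrict_space)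
qed

text \<open>The fundamental lemma of the calculus of variations: sharpening bumps gives vanishing
  integrals over boxes with closure in \<Omega>, hence g = 0 almost everywhere on each such box, and
  countably many of them exhaust \<Omega>.\<close>

lemma L1_loc_zero:
  fixes g :: "real^'n \<Rightarrow> real"
  assumes \<Omega>: "open \<Omega>" and g: "g \<in> L1_loc \<Omega>"
    and z: "\<And>\<phi>. \<phi> \<in> test_functions \<Omega> \<Longrightarrow> (LINT x|lebesgue_on \<Omega>. g x * \<phi> x) = 0"
  shows "AE x in lebesgue_on \<Omega>. g x = 0"
proof -
  have box0: "(LINT x|lebesgue. indicator (box a b) x * g x) = 0" if ab: "cbox a b \<subseteq> \<Omega>" for a b
  proof -
    let ?\<phi> = "\<lambda>k. box_bump (real k) a b"
    have off: "?\<phi> k x = 0" if "x \<notin> cbox a b" for k x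
      using that box_subset_cbox[of a b] by (auto intro!: box_bump_eq_0)
    note c = smooth_continuous[OF smooth_box_bump]
    have *: "(LINT x|lebesgue. indicator (cbox a b) x * g x * ?\<phi> k x) = 0" for k
      using z[OF box_bump_test[of "real k" a b \<Omega>]] ab
        L1_loc_mult_integrable(2)[OF \<Omega> g c compact_cbox ab off, of k] by simp
    have int: "integrable lebesgue (\<lambda>x. indicator (cbox a b) x * g x)"
      by (rule L1_loc_mult_integrable(3)[OF \<Omega> g c compact_cbox ab off])
    have "(\<lambda>k. LINT x|lebesgue. indicator (cbox a b) x * g x * ?\<phi> k x) \<longlonglongrightarrow> (LINT x|lebesgue. indicator (box a b) x * g x)"
    proof (rule integral_dominated_convergence)
      show "integrable lebesgue (\<lambda>x. \<bar>indicator (cbox a b) x * g x\<bar>)" using int by auto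
      show "AE x in lebesgue. (\<lambda>k. indicator (cbox a b) x * g x * ?\<phi> k x) \<longlonglongrightarrow> indicator (box a b) x * g x"
      proof (intro AE_I2)
        fix x
        have "(\<lambda>k. indicator (cbox a b) x * g x * ?\<phi> k x) \<longlonglongrightarrow> indicator (cbox a b) x * g x * indicator (box a b) x"
          by (intro tendsto_intros box_bump_tendsto)
        then show "(\<lambda>k. indicator (cbox a b) x * g x * ?\<phi> k x) \<longlonglongrightarrow> indicator (box a b) x * g x"
          using box_subset_cbox[of a b] by (auto simp: indicator_def split: if_splits)
      qed
      show "AE x in lebesgue. norm (indicator (cbox a b) x * g x * ?\<phi> k x) \<le> \<bar>indicator (cbox a b) x * g x\<bar>" for k
        by (intro AE_I2) (auto simp: abs_mult mult_left_le box_bump_nonneg box_bump_le_1)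
      have m: "?\<phi> k \<in> borel_measurable lebesgue" for k
        using borel_measurable_continuous_lebesgue_on[OF c, where S = UNIV] by (simp add: lebesgue_on_UNIV_eq)
      then show "(\<lambda>x. indicator (cbox a b) x * g x * ?\<phi> k x) \<in> borel_measurable lebesgue" for k
        by (rule borel_measurable_times[OF borel_measurable_integrable[OF int]])
      have "(\<lambda>x. indicator (box a b) x * (indicator (cbox a b) x * g x)) \<in> borel_measurable lebesgue"
        by (intro borel_measurable_times borel_measurable_indicator borel_measurable_integrable[OF int]) auto
      moreover have "(\<lambda>x. indicator (box a b) x * (indicator (cbox a b) x * g x)) = (\<lambda>x. indicator (box a b) x * g x)"
        using box_subset_cbox[of a b] by (auto simp: indicator_def fun_eq_iff)
      ultimately show "(\<lambda>x. indicator (box a b) x * g x) \<in> borel_measurable lebesgue" by simp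
    qed
    then show ?thesis using * by (simp add: LIMSEQ_const_iff)
  qed
  have cb: "AE x in lebesgue. x \<in> cbox c d \<longrightarrow> g x = 0" if cd: "cbox c d \<subseteq> \<Omega>" for c d
  proof -
    define h where "h x = indicator (box c d) x * g x" for x
    have "integrable lebesgue (\<lambda>x. indicator (cbox c d) x * g x)"
      using L1_loc_mult_integrable(3)[OF \<Omega> g continuous_on_const[of _ 0] compact_cbox cd] by simp
    then have "integrable lebesgue (\<lambda>x. indicator (box c d) x *\<^sub>R (indicator (cbox c d) x * g x))"
      by (intro integrable_mult_indicator) auto
    moreover have "(\<lambda>x. indicator (box c d) x *\<^sub>R (indicator (cbox c d) x * g x)) = h"
      using box_subset_cbox[of c d] by (auto simp: indicator_def fun_eq_iff h_def)
    ultimately have ih: "integrable lebesgue h" by simp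
    \<comment> \<open>The box criterion concerns Borel functions under \<open>lborel\<close>,
      whereas g is only Lebesgue measurable; a Borel representative is cut off to the open box again
      so that it keeps its support.\<close>
    then obtain h' where h': "h' \<in> borel_measurable lborel" "AE x in lborel. h x = h' x"
      using completion_ex_borel_measurable_real[of h lborel] by auto
    define k where "k x = indicator (box c d) x * h' x" for x
    have [measurable]: "k \<in> borel_measurable lborel" unfolding k_def using h'(1) by measurable
    have hk: "AE x in lebesgue. h x = k x"
      using AE_completion[OF h'(2)] by (auto simp: h_def k_def indicator_def elim!: eventually_mono)
    have mk: "k \<in> borel_measurable lebesgue" by (rule measurable_completion) measurable
    have "integrable lebesgue k"
      using integrable_cong_AE[OF borel_measurable_integrable[OF ih] mk hk] ih by blast
    then have ik: "integrable lborel k" by (simp add: integrable_completion)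
    have "AE x in lborel. k x = 0"
    proof (rule AE_zero_if_box_integrals_zero[OF ik, where c = c and d = d])
      fix a b :: "real^'n"
      obtain e f where ef: "box a b \<inter> box c d = box e f" "cbox a b \<inter> cbox c d = cbox e f"
        unfolding box_Int_box Int_interval by blast
      have "(LINT x|lborel. indicator (box a b) x * k x) = (LINT x|lebesgue. indicator (box a b) x * k x)"
        by (subst integral_completion) auto
      also have "\<dots> = (LINT x|lebesgue. indicator (box a b) x * h x)"
        by (intro integral_cong_AE borel_measurable_times borel_measurable_indicator mk borel_measurable_integrable[OF ih])
          (use hk in \<open>auto elim: eventually_mono\<close>)
      also have "\<dots> = (LINT x|lebesgue. indicator (box e f) x * g x)"
        unfolding h_def ef(1)[symmetric] by (simp add: indicator_inter_arith mult.assoc)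
      also have "\<dots> = 0" using ef(2) cd by (intro box0) blast
      finally show "(LINT x|lborel. indicator (box a b) x * k x) = 0" .
    qed (simp add: k_def)
    then have "AE x in lebesgue. k x = 0" by (rule AE_completion)
    moreover have "AE x in lebesgue. x \<notin> cbox c d - box c d"
      using negligible_frontier_interval[of c d] by (intro AE_not_in) (simp add: negligible_iff_null_sets)
    ultimately show ?thesis
      using hk by eventually_elim (auto simp: h_def)
  qed
  obtain \<D> where \<D>: "countable \<D>" "\<And>X. X \<in> \<D> \<Longrightarrow> \<exists>a b. X = cbox a b" "\<Union>\<D> = \<Omega>"
    using open_countable_Union_open_cbox[OF \<Omega>] by metis
  have "AE x in lebesgue. \<forall>X\<in>\<D>. x \<in> X \<longrightarrow> g x = 0"
    using \<D>(1)
  proof (rule AE_ball_countable[THEN iffD2, rule_format])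
    fix X assume "X \<in> \<D>"
    then obtain a b where "X = cbox a b" "cbox a b \<subseteq> \<Omega>" using \<D> by blast
    then show "AE x in lebesgue. x \<in> X \<longrightarrow> g x = 0" using cb by simp
  qed
  then have "AE x in lebesgue. x \<in> \<Omega> \<longrightarrow> g x = 0"
    by (rule eventually_mono) (use \<D>(3) in blast)
  then show ?thesis using \<Omega> by (simp add: AE_restrict_space_iff)
qed

section \<open>Classical gradients, Jacobians and weak gradients\<close>

lemma continuous_on_grad: "smooth \<phi> \<Longrightarrow> continuous_on UNIV (grad \<phi>)"
  unfolding grad_def by (intro continuous_on_vec_lambda smooth_continuous smooth_directional)

lemma grad_nth: "grad \<phi> x $ j = frechet_derivative \<phi> (at x) (axis j 1)"
  by (simp add: grad_def)

lemma grad_inner: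
  assumes "smooth \<phi>"
  shows "frechet_derivative \<phi> (at x) v = grad \<phi> x \<bullet> v"
proof -
  have l: "linear (frechet_derivative \<phi> (at x))"
    using smooth_has_derivative[OF assms] has_derivative_linear by blast
  have "frechet_derivative \<phi> (at x) v = frechet_derivative \<phi> (at x) (\<Sum>i\<in>UNIV. (v $ i) *\<^sub>R axis i 1)"
    by (simp add: basis_expansion scalar_mult_eq_scaleR[symmetric])
  also have "\<dots> = grad \<phi> x \<bullet> v"
    using l by (simp add: linear_sum linear_cmul inner_vec_def grad_def mult.commute)
  finally show ?thesis .
qed

lemma has_derivative_grad:
  fixes \<phi> :: "real^'n \<Rightarrow> real"
  shows "smooth \<phi> \<Longrightarrow> (\<phi> has_derivative (\<lambda>v. grad \<phi> x \<bullet> v)) (at x)"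
proof -
  assume "smooth \<phi>"
  moreover from this have "frechet_derivative \<phi> (at x) = (\<lambda>v. grad \<phi> x \<bullet> v)"
    by (intro ext grad_inner)
  ultimately show ?thesis using smooth_has_derivative[of \<phi> x] by simp
qed

lemma grad_off_support:
  "smooth \<phi> \<Longrightarrow> compact K \<Longrightarrow> (\<And>x. x \<notin> K \<Longrightarrow> \<phi> x = 0) \<Longrightarrow> x \<notin> K \<Longrightarrow> grad \<phi> x = 0"
  using derivative_zero_off_support[of K \<phi> "frechet_derivative \<phi> (at x)" x] smooth_has_derivative[of \<phi> x]
  by (auto simp: grad_def vec_eq_iff)

lemma has_weak_gradient_diff:
  fixes \<Omega> :: "(real^'n) set"
  assumes \<Omega>: "open \<Omega>" and "has_weak_gradient \<Omega> U G" "has_weak_gradient \<Omega> V H"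
  shows "has_weak_gradient \<Omega> (\<lambda>x. U x - V x) (\<lambda>x. G x - H x)"
  unfolding has_weak_gradient_def
proof (intro conjI ballI allI)
  fix \<phi> :: "real^'n \<Rightarrow> real" and i j assume \<phi>: "\<phi> \<in> test_functions \<Omega>"
  obtain K where K: "smooth \<phi>" "compact K" "K \<subseteq> \<Omega>" "\<And>x. x \<notin> K \<Longrightarrow> \<phi> x = 0"
    using test_functionsE[OF \<phi>] by blast
  have 1: "integrable (lebesgue_on \<Omega>) (\<lambda>x. W x $ i * grad \<phi> x $ j)" if "W \<in> L1_loc \<Omega>" for W :: "real^'n \<Rightarrow> real^'n"
    by (rule L1_loc_mult_integrable(1)[OF \<Omega> L1_loc_linear[OF that bounded_linear_vec_nth] _ K(2,3)])
      (use continuous_on_grad[OF K(1)] grad_off_support[OF K(1,2,4)] in \<open>auto intro: continuous_intros\<close>)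
  have 2: "integrable (lebesgue_on \<Omega>) (\<lambda>x. W x $ i $ j * \<phi> x)" if "W \<in> L1_loc \<Omega>" for W :: "real^'n \<Rightarrow> real^'n^'n"
    by (rule L1_loc_mult_integrable(1)[OF \<Omega> L1_loc_linear[OF L1_loc_linear[OF that bounded_linear_vec_nth] bounded_linear_vec_nth] smooth_continuous[OF K(1)] K(2,3,4)])
  show "(LINT x|lebesgue_on \<Omega>. (U x - V x) $ i * grad \<phi> x $ j) = - (LINT x|lebesgue_on \<Omega>. (G x - H x) $ i $ j * \<phi> x)"
    using 1[of U] 1[of V] 2[of G] 2[of H] assms \<phi>
    by (simp add: has_weak_gradient_def left_diff_distrib)
qed (use assms in \<open>auto simp: has_weak_gradient_def intro: L1_loc_diff\<close>)

lemma weak_gradient_zero_unique: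
  assumes \<Omega>: "open \<Omega>" and "has_weak_gradient \<Omega> U G" "\<And>x. U x = 0"
  shows "AE x in lebesgue_on \<Omega>. G x = 0"
proof -
  have "AE x in lebesgue_on \<Omega>. G x $ i $ j = 0" for i j
  proof (rule L1_loc_zero[OF \<Omega>])
    show "(\<lambda>x. G x $ i $ j) \<in> L1_loc \<Omega>"
      using assms by (auto simp: has_weak_gradient_def intro!: L1_loc_linear[OF _ bounded_linear_vec_nth] L1_loc_linear[OF L1_loc_linear[OF _ bounded_linear_vec_nth] bounded_linear_vec_nth])
    show "(LINT x|lebesgue_on \<Omega>. G x $ i $ j * \<phi> x) = 0" if "\<phi> \<in> test_functions \<Omega>" for \<phi>
    proof -
      have "(LINT x|lebesgue_on \<Omega>. U x $ i * grad \<phi> x $ j) = - (LINT x|lebesgue_on \<Omega>. G x $ i $ j * \<phi> x)"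
        using assms(2) that unfolding has_weak_gradient_def by blast
      then show ?thesis using assms(3) by simp
    qed
  qed
  then have "AE x in lebesgue_on \<Omega>. \<forall>i\<in>UNIV. \<forall>j\<in>UNIV. G x $ i $ j = 0"
    by (intro AE_finite_allI) auto
  then show ?thesis by (rule eventually_mono) (auto simp: vec_eq_iff)
qed

lemma has_weak_gradient_unique:
  assumes "open \<Omega>" "has_weak_gradient \<Omega> U G" "has_weak_gradient \<Omega> U H"
  shows "AE x in lebesgue_on \<Omega>. G x = H x"
  using weak_gradient_zero_unique[OF assms(1) has_weak_gradient_diff[OF assms]] by simp

lemma weak_gradient_works:
  "has_weak_gradient \<Omega> U G \<Longrightarrow> has_weak_gradient \<Omega> U (weak_gradient \<Omega> U)"
  unfolding weak_gradient_def by (rule someI[of "has_weak_gradient \<Omega> U"])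

text \<open>\<open>weak_gradient\<close> is an arbitrary choice; this lets any weak gradient at
  hand, such as an L^n limit of Jacobians, replace it under integrals.\<close>

lemma weak_gradient_AE:
  "open \<Omega> \<Longrightarrow> has_weak_gradient \<Omega> U G \<Longrightarrow> AE x in lebesgue_on \<Omega>. weak_gradient \<Omega> U x = G x"
  using has_weak_gradient_unique weak_gradient_works by blast

lemma jacobian_nth:
  fixes \<Phi> :: "real^'n \<Rightarrow> real^'m"
  shows "jacobian \<Phi> (at x) $ i $ j = frechet_derivative \<Phi> (at x) (axis j 1) $ i"
  by (simp add: jacobian_def matrix_def)

lemma smooth_component: "smooth \<Phi> \<Longrightarrow> smooth (\<lambda>x. \<Phi> x $ i)"
  by (rule smooth_linear[OF bounded_linear_vec_nth])

lemma jacobian_row: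
  fixes \<Phi> :: "real^'n \<Rightarrow> real^'m"
  assumes "smooth \<Phi>"
  shows "jacobian \<Phi> (at x) $ i = grad (\<lambda>x. \<Phi> x $ i) x"
proof -
  have "((\<lambda>x. \<Phi> x $ i) has_derivative (\<lambda>v. frechet_derivative \<Phi> (at x) v $ i)) (at x)"
    by (rule bounded_linear.has_derivative[OF bounded_linear_vec_nth smooth_has_derivative[OF assms]])
  then have "frechet_derivative (\<lambda>x. \<Phi> x $ i) (at x) = (\<lambda>v. frechet_derivative \<Phi> (at x) v $ i)"
    by (rule frechet_derivative_at[symmetric])
  then show ?thesis by (simp add: vec_eq_iff jacobian_nth grad_nth)
qed

lemma continuous_on_jacobian:
  fixes \<Phi> :: "real^'n \<Rightarrow> real^'m"
  assumes "smooth \<Phi>"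
  shows "continuous_on UNIV (\<lambda>x. jacobian \<Phi> (at x))"
proof -
  have "continuous_on UNIV (\<lambda>x. \<chi> i. grad (\<lambda>x. \<Phi> x $ i) x)"
    by (intro continuous_on_vec_lambda continuous_on_grad smooth_component assms)
  moreover have "(\<lambda>x. jacobian \<Phi> (at x)) = (\<lambda>x. \<chi> i. grad (\<lambda>x. \<Phi> x $ i) x)"
    by (simp add: fun_eq_iff vec_eq_iff jacobian_row[OF assms])
  ultimately show ?thesis by (simp only:)
qed

lemma jacobian_off_support:
  fixes \<Phi> :: "real^'n \<Rightarrow> real^'m"
  assumes "smooth \<Phi>" "compact K" "\<And>x. x \<notin> K \<Longrightarrow> \<Phi> x = 0" "x \<notin> K"
  shows "jacobian \<Phi> (at x) = 0"
proof -
  have "jacobian \<Phi> (at x) $ i = 0" for i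
    unfolding jacobian_row[OF assms(1)]
    by (rule grad_off_support[OF smooth_component[OF assms(1)] assms(2) _ assms(4)]) (simp add: assms(3))
  then show ?thesis by (simp add: vec_eq_iff)
qed

lemma L1_loc_continuous:
  fixes f :: "'a::euclidean_space \<Rightarrow> 'b::euclidean_space"
  assumes "continuous_on UNIV f"
  shows "f \<in> L1_loc \<Omega>"
  unfolding L1_loc_def
proof (safe intro!: borel_measurable_continuous_lebesgue_on assms)
  fix K :: "'a set" assume K: "compact K"
  have "integrable lborel (\<lambda>x. indicator K x *\<^sub>R f x)"
    by (intro borel_integrable_compact K continuous_on_subset[OF assms]) auto
  then have "integrable lebesgue (\<lambda>x. indicator K x *\<^sub>R f x)"
    by (subst integrable_completion) auto
  then show "integrable (lebesgue_on K) f"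
    using K by (subst integrable_restrict_space) (auto simp: lmeasurable_compact fmeasurableD)
qed

text \<open>Integration by parts: the product of a component of \<Phi> with \<phi> is compactly
  supported, so its derivative along axis j has integral zero.\<close>

lemma has_weak_gradient_test:
  fixes \<Phi> :: "real^'n \<Rightarrow> real^'n"
  assumes \<Omega>: "open \<Omega>" and \<Phi>: "smooth \<Phi>"
  shows "has_weak_gradient \<Omega> \<Phi> (\<lambda>x. jacobian \<Phi> (at x))"
  unfolding has_weak_gradient_def
proof (intro conjI ballI allI L1_loc_continuous smooth_continuous[OF \<Phi>] continuous_on_jacobian[OF \<Phi>])
  fix \<phi> :: "real^'n \<Rightarrow> real" and i j assume "\<phi> \<in> test_functions \<Omega>"
  then obtain K where K: "smooth \<phi>" "compact K" "K \<subseteq> \<Omega>" "\<And>x. x \<notin> K \<Longrightarrow> \<phi> x = 0"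
    using test_functionsE by blast
  have \<Omega>m: "\<Omega> \<in> sets lebesgue" using \<Omega> by auto
  let ?f = "\<lambda>x. \<Phi> x $ i"
  note sf = smooth_component[OF \<Phi>, of i]
  have c1: "continuous_on UNIV (\<lambda>x. ?f x * grad \<phi> x $ j)"
    by (intro continuous_intros smooth_continuous[OF sf] continuous_on_grad[OF K(1)])
  have c2: "continuous_on UNIV (\<lambda>x. grad ?f x $ j * \<phi> x)"
    by (intro continuous_intros smooth_continuous[OF K(1)] continuous_on_grad[OF sf])
  have z1: "?f x * grad \<phi> x $ j = 0" if "x \<notin> K" for x using grad_off_support[OF K(1,2,4) that] by simp
  have z2: "grad ?f x $ j * \<phi> x = 0" if "x \<notin> K" for x using K(4)[OF that] by simp
  have "((\<lambda>x. ?f x * \<phi> x) has_derivative (\<lambda>v. ?f x * (grad \<phi> x \<bullet> v) + (grad ?f x \<bullet> v) * \<phi> x)) (at x)" for x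
    by (intro has_derivative_mult has_derivative_grad K(1) sf)
  from integral_directional_derivative_zero(2)[OF this, of "axis j 1" K]
  have "(LINT x|lborel. ?f x * grad \<phi> x $ j + grad ?f x $ j * \<phi> x) = 0"
    using c1 c2 K(2,4) by (simp add: inner_axis continuous_on_add)
  then have "(LINT x|lborel. ?f x * grad \<phi> x $ j) + (LINT x|lborel. grad ?f x $ j * \<phi> x) = 0"
    using integrable_compact_support[OF c1 K(2) z1] integrable_compact_support[OF c2 K(2) z2] by simp
  moreover have "(LINT x|lebesgue_on \<Omega>. ?f x * grad \<phi> x $ j) = (LINT x|lborel. ?f x * grad \<phi> x $ j)"
    by (rule integral_lebesgue_on_eq_lborel[OF c1 \<Omega>m]) (use z1 K(3) in blast)
  moreover have "(LINT x|lebesgue_on \<Omega>. grad ?f x $ j * \<phi> x) = (LINT x|lborel. grad ?f x $ j * \<phi> x)"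
    by (rule integral_lebesgue_on_eq_lborel[OF c2 \<Omega>m]) (use z2 K(3) in blast)
  ultimately show "(LINT x|lebesgue_on \<Omega>. \<Phi> x $ i * grad \<phi> x $ j) = - (LINT x|lebesgue_on \<Omega>. jacobian \<Phi> (at x) $ i $ j * \<phi> x)"
    by (simp add: jacobian_row[OF \<Phi>])
qed

section \<open>Divergence-free fields tested with Lipschitz functions\<close>

lemma Lp_1_iff: "F \<in> Lp 1 \<Omega> \<longleftrightarrow> integrable (lebesgue_on \<Omega>) F"
  unfolding Lp_def using integrable_norm_iff by (auto simp: powr_one')

lemma Lp_norm_1: "Lp_norm 1 \<Omega> F = (LINT x|lebesgue_on \<Omega>. norm (F x))"
  by (simp add: Lp_norm_def)

text \<open>F is split into (F . a) e and a remainder tangent to the level sets of a. Along e the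
  function \<zeta> must have a derivative d almost everywhere, locally uniformly in the base point,
  so that mollified derivatives converge to d; across e a bound on increments is enough.
  Differentiability of \<zeta> in all directions is thereby avoided. Testing with mollifications,
  div F = 0 trades the e-part for the tangential part.\<close>

lemma div_free_Lipschitz_test:
  fixes F :: "real^'n \<Rightarrow> real^'n" and \<zeta> d :: "real^'n \<Rightarrow> real"
  assumes \<Omega>: "open \<Omega>" and F: "integrable (lebesgue_on \<Omega>) F" "div_free_on \<Omega> F"
    and Lip: "\<And>x y. \<bar>\<zeta> x - \<zeta> y\<bar> \<le> L * norm (x - y)"
    and K: "compact K" "K \<subseteq> \<Omega>" "\<And>x. x \<notin> K \<Longrightarrow> \<zeta> x = 0"
    and ae: "a \<bullet> e = 1"
    and dm: "d \<in> borel_measurable (lebesgue_on \<Omega>)"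
    and d: "AE x in lebesgue_on \<Omega>. \<forall>\<eta>>0. \<exists>\<kappa>>0. \<forall>z\<in>cball x \<kappa>. \<forall>t. 0 < t \<and> t < \<kappa> \<longrightarrow>
              \<bar>\<zeta> (z + t *\<^sub>R e) - \<zeta> z - t * d x\<bar> \<le> \<eta> * t"
    and tang: "\<And>z v t. v \<bullet> a = 0 \<Longrightarrow> 0 < t \<Longrightarrow> \<bar>\<zeta> (z + t *\<^sub>R v) - \<zeta> z\<bar> \<le> \<Lambda> * norm v * t"
  shows "\<bar>LINT x|lebesgue_on \<Omega>. (F x \<bullet> a) * d x\<bar> \<le> \<Lambda> * (LINT x|lebesgue_on \<Omega>. norm (F x - (F x \<bullet> a) *\<^sub>R e))"
proof -
  have c\<zeta>: "continuous_on UNIV \<zeta>"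
  proof -
    have "(max L 0)-lipschitz_on UNIV \<zeta>"
    proof (rule lipschitz_onI)
      fix x y
      show "dist (\<zeta> x) (\<zeta> y) \<le> max L 0 * dist x y"
        using Lip[of x y] mult_right_mono[of L "max L 0" "norm (x - y)"] by (simp add: dist_norm)
    qed simp
    then show ?thesis by (rule lipschitz_on_continuous_on)
  qed
  obtain r where r: "r > 0" "(\<Union>x\<in>K. ball x r) \<subseteq> \<Omega>"
    using compact_subset_open_imp_ball_epsilon_subset[OF K(1) \<Omega> K(2)] by blast
  \<comment> \<open>All radii stay at most r/2, so every mollification is supported in the same
    compact set \<open>K'\<close> inside \<Omega>.\<close>
  define \<kappa> where "\<kappa> m = r / real (m + 2)" for m
  have \<kappa>: "0 < \<kappa> m" "\<kappa> m \<le> r / 2" for m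
    using r(1) by (auto simp: \<kappa>_def field_simps)
  have \<kappa>0: "\<kappa> \<longlonglongrightarrow> 0"
    unfolding \<kappa>_def using LIMSEQ_ignore_initial_segment[OF lim_const_over_n[of r], of 2] by simp
  define K' where "K' = (\<Union>x\<in>K. cball x (r / 2))"
  have K': "compact K'" unfolding K'_def by (rule compact_minkowski_sum_cball[OF K(1)])
  have "K' \<subseteq> \<Omega>" using r unfolding K'_def by (force simp: subset_iff)
  \<comment> \<open>The properties of a mollification are packed into one predicate so that a whole
    sequence can be chosen.\<close>
  define M where "M m \<psi> \<longleftrightarrow> smooth \<psi> \<and> (\<forall>x. (\<forall>z. z \<in> cball x (\<kappa> m) \<longrightarrow> \<zeta> z = 0) \<longrightarrow> \<psi> x = 0) \<and>
    (\<forall>x v c \<eta> t0. 0 < t0 \<longrightarrow>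
       (\<forall>z t. z \<in> cball x (\<kappa> m) \<longrightarrow> 0 < t \<longrightarrow> t < t0 \<longrightarrow> \<bar>\<zeta> (z + t *\<^sub>R v) - \<zeta> z - t * c\<bar> \<le> \<eta> * t) \<longrightarrow>
       \<bar>frechet_derivative \<psi> (at x) v - c\<bar> \<le> \<eta>)" for m and \<psi> :: "real^'n \<Rightarrow> real"
  have "\<exists>\<psi>. M m \<psi>" for m
    by (rule mollification_exists[OF c\<zeta> K(1) K(3) \<kappa>(1)[of m]]) (unfold M_def, blast+)
  then obtain \<psi> where M: "\<And>m. M m (\<psi> m)" by metis
  have sm: "smooth (\<psi> m)" for m using M[of m] by (simp add: M_def)
  have der: "\<bar>frechet_derivative (\<psi> m) (at x) v - c\<bar> \<le> \<eta>"
    if "0 < t0" "\<And>z t. z \<in> cball x (\<kappa> m) \<Longrightarrow> 0 < t \<Longrightarrow> t < t0 \<Longrightarrow> \<bar>\<zeta> (z + t *\<^sub>R v) - \<zeta> z - t * c\<bar> \<le> \<eta> * t"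
    for x v c \<eta> t0 m using M[of m] that unfolding M_def by blast
  have off: "\<psi> m x = 0" if "x \<notin> K'" for m x
  proof -
    have "\<zeta> z = 0" if "z \<in> cball x (\<kappa> m)" for z
    proof (rule K(3), rule)
      assume "z \<in> K"
      moreover have "x \<in> cball z (r / 2)" using that \<kappa>(2)[of m] by (simp add: dist_commute)
      ultimately show False using \<open>x \<notin> K'\<close> unfolding K'_def by blast
    qed
    then show ?thesis using M[of m] by (simp add: M_def)
  qed
  have test: "\<psi> m \<in> test_functions \<Omega>" for m
    unfolding test_functions_def using sm off K' \<open>K' \<subseteq> \<Omega>\<close> by blast
  define p where "p m x = frechet_derivative (\<psi> m) (at x) e" for m x
  \<comment> \<open>By a . e = 1 this is the part of F tangent to the level sets of a; only
    \<open>tang\<close> is used on it.\<close>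
  define w where "w x = F x - (F x \<bullet> a) *\<^sub>R e" for x
  have w: "w x \<bullet> a = 0" for x using ae unfolding w_def inner_diff_left inner_scaleR_left by (simp add: inner_commute)
  have Fm[measurable]: "F \<in> borel_measurable (lebesgue_on \<Omega>)" using F(1) by auto
  have pm[measurable]: "p m \<in> borel_measurable (lebesgue_on \<Omega>)" for m
    unfolding p_def by (intro borel_measurable_continuous_lebesgue_on smooth_continuous smooth_directional sm)
  have pb: "\<bar>p m x\<bar> \<le> L * norm e" for m x
  proof -
    have "\<bar>frechet_derivative (\<psi> m) (at x) e - 0\<bar> \<le> L * norm e"
    proof (rule der[of 1])
      fix z and t :: real assume "0 < t"
      then show "\<bar>\<zeta> (z + t *\<^sub>R e) - \<zeta> z - t * 0\<bar> \<le> L * norm e * t"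
        using Lip[of "z + t *\<^sub>R e" z] by (simp add: mult_ac)
    qed simp
    then show ?thesis by (simp add: p_def)
  qed
  have iFa: "integrable (lebesgue_on \<Omega>) (\<lambda>x. F x \<bullet> a)" using F(1) by simp
  have iw: "integrable (lebesgue_on \<Omega>) (\<lambda>x. norm (w x))"
    unfolding w_def using F(1) by (intro integrable_norm Bochner_Integration.integrable_diff integrable_scaleR_left) auto
  have ip: "integrable (lebesgue_on \<Omega>) (\<lambda>x. (F x \<bullet> a) * p m x)" for m
  proof (rule Bochner_Integration.integrable_bound)
    show "integrable (lebesgue_on \<Omega>) (\<lambda>x. (L * norm e) * (F x \<bullet> a))" using iFa by simp
    show "AE x in lebesgue_on \<Omega>. norm ((F x \<bullet> a) * p m x) \<le> norm ((L * norm e) * (F x \<bullet> a))"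
    proof (rule AE_I2)
      fix x
      have "\<bar>p m x\<bar> \<le> \<bar>L * norm e\<bar>" using pb[of m x] by linarith
      then show "norm ((F x \<bullet> a) * p m x) \<le> norm ((L * norm e) * (F x \<bullet> a))"
        unfolding real_norm_def abs_mult[of "F x \<bullet> a"] abs_mult[of "L * norm e"]
        by (subst mult.commute) (rule mult_right_mono, auto)
    qed
  qed simp
  have dec: "\<bar>(F x \<bullet> a) * p m x - F x \<bullet> grad (\<psi> m) x\<bar> \<le> \<Lambda> * norm (w x)" for m x
  proof -
    have "\<bar>frechet_derivative (\<psi> m) (at x) (w x) - 0\<bar> \<le> \<Lambda> * norm (w x)"
      by (rule der[of 1]) (use tang[OF w] in auto)
    moreover have "F x \<bullet> grad (\<psi> m) x = (F x \<bullet> a) * p m x + frechet_derivative (\<psi> m) (at x) (w x)"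
      by (simp add: p_def grad_inner[OF sm] w_def inner_diff_right inner_commute)
    ultimately show ?thesis by simp
  qed
  have ig: "integrable (lebesgue_on \<Omega>) (\<lambda>x. F x \<bullet> grad (\<psi> m) x)" for m
  proof (rule Bochner_Integration.integrable_bound)
    show "integrable (lebesgue_on \<Omega>) (\<lambda>x. \<bar>(F x \<bullet> a) * p m x\<bar> + \<Lambda> * norm (w x))"
      using ip iw by simp
    have [measurable]: "grad (\<psi> m) \<in> borel_measurable (lebesgue_on \<Omega>)"
      by (intro borel_measurable_continuous_lebesgue_on continuous_on_grad sm)
    show "(\<lambda>x. F x \<bullet> grad (\<psi> m) x) \<in> borel_measurable (lebesgue_on \<Omega>)" by measurable
    show "AE x in lebesgue_on \<Omega>. norm (F x \<bullet> grad (\<psi> m) x) \<le> norm (\<bar>(F x \<bullet> a) * p m x\<bar> + \<Lambda> * norm (w x))"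
    proof (rule AE_I2)
      show "norm (F x \<bullet> grad (\<psi> m) x) \<le> norm (\<bar>(F x \<bullet> a) * p m x\<bar> + \<Lambda> * norm (w x))" for x
        using dec[of x m] unfolding real_norm_def by linarith
    qed
  qed
  have b: "\<bar>LINT x|lebesgue_on \<Omega>. (F x \<bullet> a) * p m x\<bar> \<le> \<Lambda> * (LINT x|lebesgue_on \<Omega>. norm (w x))" for m
  proof -
    have "(LINT x|lebesgue_on \<Omega>. F x \<bullet> grad (\<psi> m) x) = 0"
      using F(2) test unfolding div_free_on_def by blast
    then have "(LINT x|lebesgue_on \<Omega>. (F x \<bullet> a) * p m x) = (LINT x|lebesgue_on \<Omega>. (F x \<bullet> a) * p m x - F x \<bullet> grad (\<psi> m) x)"
      using ip ig by simp
    also have "\<bar>\<dots>\<bar> \<le> (LINT x|lebesgue_on \<Omega>. \<Lambda> * norm (w x))"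
      by (rule order_trans[OF integral_abs_bound integral_mono])
        (use ip ig iw dec in \<open>auto intro!: integrable_abs Bochner_Integration.integrable_diff\<close>)
    finally show ?thesis by simp
  qed
  have "(\<lambda>m. LINT x|lebesgue_on \<Omega>. (F x \<bullet> a) * p m x) \<longlonglongrightarrow> (LINT x|lebesgue_on \<Omega>. (F x \<bullet> a) * d x)"
  proof (rule integral_dominated_convergence)
    show "integrable (lebesgue_on \<Omega>) (\<lambda>x. \<bar>F x \<bullet> a\<bar> * (L * norm e))" using iFa by simp
    show "AE x in lebesgue_on \<Omega>. (\<lambda>m. (F x \<bullet> a) * p m x) \<longlonglongrightarrow> (F x \<bullet> a) * d x"
      using d
    proof (rule eventually_mono)
      fix x assume dx: "\<forall>\<eta>>0. \<exists>\<kappa>>0. \<forall>z\<in>cball x \<kappa>. \<forall>t. 0 < t \<and> t < \<kappa> \<longrightarrow> \<bar>\<zeta> (z + t *\<^sub>R e) - \<zeta> z - t * d x\<bar> \<le> \<eta> * t"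
      have "(\<lambda>m. p m x) \<longlonglongrightarrow> d x"
      proof (rule LIMSEQ_I)
        fix \<eta> :: real assume "\<eta> > 0"
        then have "\<eta> / 2 > 0" by simp
        then obtain \<kappa>' where k: "\<kappa>' > 0" "\<And>z t. z \<in> cball x \<kappa>' \<Longrightarrow> 0 < t \<Longrightarrow> t < \<kappa>' \<Longrightarrow> \<bar>\<zeta> (z + t *\<^sub>R e) - \<zeta> z - t * d x\<bar> \<le> \<eta> / 2 * t"
          using dx by meson
        obtain m0 where m0: "\<And>m. m \<ge> m0 \<Longrightarrow> \<kappa> m < \<kappa>'"
          using LIMSEQ_D[OF \<kappa>0 k(1)] \<kappa>(1) by (auto simp: abs_of_pos)
        have "\<bar>p m x - d x\<bar> \<le> \<eta> / 2" if "m \<ge> m0" for m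
          unfolding p_def
        proof (rule der[OF k(1)])
          fix z t assume "z \<in> cball x (\<kappa> m)" "0 < t" "t < \<kappa>'"
          then show "\<bar>\<zeta> (z + t *\<^sub>R e) - \<zeta> z - t * d x\<bar> \<le> \<eta> / 2 * t"
            using m0[OF that] by (intro k(2)) auto
        qed
        then show "\<exists>no. \<forall>m\<ge>no. norm (p m x - d x) < \<eta>"
          using \<open>\<eta> > 0\<close> by (intro exI[of _ m0]) (force simp: field_simps)
      qed
      then show "(\<lambda>m. (F x \<bullet> a) * p m x) \<longlonglongrightarrow> (F x \<bullet> a) * d x" by (intro tendsto_intros)
    qed
    show "AE x in lebesgue_on \<Omega>. norm ((F x \<bullet> a) * p m x) \<le> \<bar>F x \<bullet> a\<bar> * (L * norm e)" for m
      using pb by (auto simp: abs_mult intro!: mult_left_mono)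
  qed (use dm in measurable)
  then have "(\<lambda>m. \<bar>LINT x|lebesgue_on \<Omega>. (F x \<bullet> a) * p m x\<bar>) \<longlonglongrightarrow> \<bar>LINT x|lebesgue_on \<Omega>. (F x \<bullet> a) * d x\<bar>"
    by (rule tendsto_rabs)
  then show ?thesis
    unfolding w_def[symmetric] by (rule LIMSEQ_le_const2) (use b in blast)
qed

section \<open>A Morrey estimate on hyperplane slices\<close>

text \<open>Young's inequality in linearised form: if X exceeds D then X / D is greater than 1, so X
  is at most X (X / D)^(n-1).\<close>

lemma le_add_power_div:
  fixes X D :: real
  assumes "X \<ge> 0" "D > 0" "n \<ge> 1"
  shows "X \<le> D + X ^ n / D ^ (n - 1)"
proof (cases "X \<le> D")
  case True
  then show ?thesis using assms by (simp add: add_increasing2)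
next
  case False
  have "X * D ^ (n - 1) \<le> X * X ^ (n - 1)"
    using False assms by (intro mult_left_mono power_mono) auto
  also have "\<dots> = X ^ n" using assms(3) by (simp add: power_eq_if)
  finally have "X \<le> X ^ n / D ^ (n - 1)" using assms by (simp add: field_simps)
  then show ?thesis using assms by simp
qed

text \<open>Orthogonal projection to the hyperplane x_i = s. An integral over an (n-1)-dimensional
  slice is represented by the integral over a slab of the function composed with this projection, so
  no lower-dimensional measure is needed.\<close>

definition slice_proj :: "'n \<Rightarrow> real \<Rightarrow> real^'n \<Rightarrow> real^'n" where
  "slice_proj i s x = x + (s - x $ i) *\<^sub>R axis i 1"

lemma slice_proj_nth: "slice_proj i s x $ j = (if j = i then s else x $ j)"
  by (simp add: slice_proj_def axis_def)

lemma continuous_on_slice_proj: "continuous_on S f \<Longrightarrow> continuous_on S (\<lambda>x. slice_proj i s (f x))"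
  unfolding slice_proj_def by (intro continuous_intros)

text \<open>The integrand is constant in x_i and so not compactly supported by itself; within the
  slab the support is contained in a box.\<close>

lemma integrable_slab:
  fixes h :: "real^'n \<Rightarrow> real"
  assumes h: "continuous_on UNIV h" "compact K" "\<And>x. x \<notin> K \<Longrightarrow> h x = 0"
  shows "integrable lborel (\<lambda>x. indicator {x. lo \<le> x $ i \<and> x $ i \<le> hi} x * h (slice_proj i s x))"
proof -
  obtain a b where ab: "K \<subseteq> cbox a b"
    using bounded_subset_cbox_symmetric[OF compact_imp_bounded[OF h(2)]] by blast
  define l where "l = (\<chi> j. if j = i then lo else a $ j)"
  define u where "u = (\<chi> j. if j = i then hi else b $ j)"
  have "integrable lborel (\<lambda>x. indicator (cbox l u) x *\<^sub>R h (slice_proj i s x))"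
    by (intro borel_integrable_compact compact_cbox continuous_on_compose2[OF h(1)] continuous_on_slice_proj continuous_intros) auto
  moreover have "(\<lambda>x. indicator (cbox l u) x *\<^sub>R h (slice_proj i s x)) =
      (\<lambda>x. indicator {x. lo \<le> x $ i \<and> x $ i \<le> hi} x * h (slice_proj i s x))"
  proof
    fix x
    show "indicator (cbox l u) x *\<^sub>R h (slice_proj i s x) = indicator {x. lo \<le> x $ i \<and> x $ i \<le> hi} x * h (slice_proj i s x)"
    proof (cases "slice_proj i s x \<in> K")
      case True
      then have "slice_proj i s x \<in> cbox a b" using ab by blast
      then have "\<forall>j. j \<noteq> i \<longrightarrow> a $ j \<le> x $ j \<and> x $ j \<le> b $ j"
        by (auto simp: mem_box_cart slice_proj_nth split: if_splits)
      then have "x \<in> cbox l u \<longleftrightarrow> x \<in> {x. lo \<le> x $ i \<and> x $ i \<le> hi}"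
        by (auto simp: mem_box_cart l_def u_def)
      then show ?thesis by (simp add: indicator_def)
    qed (simp add: h(3))
  qed
  ultimately show ?thesis by simp
qed

lemma lborel_diagonal_affine:
  fixes f :: "real^'n \<Rightarrow> real" and c t :: "real^'n"
  assumes f: "integrable lborel f" and c: "\<And>j. c $ j > 0"
  shows "integrable lborel (\<lambda>x. f (\<chi> j. t $ j + c $ j * x $ j))"
    "(LINT x|lborel. f x) = (\<Prod>j\<in>UNIV. c $ j) * (LINT x|lborel. f (\<chi> j. t $ j + c $ j * x $ j))"
proof -
  let ?T = "\<lambda>x. t + (\<Sum>j\<in>Basis. ((c \<bullet> j) * (x \<bullet> j)) *\<^sub>R j)"
  have B: "Basis = (\<lambda>j. axis j 1 :: real^'n) ` UNIV" by (auto simp: Basis_vec_def)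
  have inj: "inj (\<lambda>j. axis j 1 :: real^'n)" by (auto simp: inj_on_def axis_eq_axis)
  have T: "?T = (\<lambda>x. \<chi> j. t $ j + c $ j * x $ j)"
  proof
    fix x
    have "(\<Sum>b\<in>Basis. ((c \<bullet> b) * (x \<bullet> b)) *\<^sub>R b) $ j = c $ j * x $ j" for j
    proof -
      have "(\<Sum>b\<in>Basis. ((c \<bullet> b) * (x \<bullet> b)) *\<^sub>R b) = (\<Sum>k\<in>UNIV. (c $ k * x $ k) *\<^sub>R axis k 1)"
        unfolding B by (subst sum.reindex[OF inj]) (simp add: inner_axis)
      then show ?thesis by (simp add: axis_def if_distrib cong: if_cong)
    qed
    then show "?T x = (\<chi> j. t $ j + c $ j * x $ j)"
      by (simp add: vec_eq_iff)
  qed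
  have "(\<Prod>j\<in>Basis. \<bar>c \<bullet> j\<bar>) = (\<Prod>j\<in>UNIV. \<bar>c \<bullet> axis j 1\<bar>)"
    unfolding B by (subst prod.reindex[OF inj]) simp
  also have "\<dots> = (\<Prod>j\<in>UNIV. c $ j)"
    using c by (intro prod.cong) (auto simp: inner_axis abs_of_pos)
  finally have P: "(\<Prod>j\<in>Basis. \<bar>c \<bullet> j\<bar>) = (\<Prod>j\<in>UNIV. c $ j)" .
  have pos: "(\<Prod>j\<in>UNIV. c $ j) > 0" using c by (intro prod_pos) auto
  have eq: "lborel = density (distr lborel borel ?T) (\<lambda>_. ennreal (\<Prod>j\<in>UNIV. c $ j))"
  proof -
    have "c \<bullet> j \<noteq> 0" if "j \<in> Basis" for j using that c by (auto simp: B inner_axis less_imp_neq[symmetric])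
    from lborel_affine_euclidean[of "\<lambda>j. c \<bullet> j" t, OF this] show ?thesis by (simp add: P)
  qed
  have m: "f \<in> borel_measurable borel" using f by auto
  have Tm: "?T \<in> lborel \<rightarrow>\<^sub>M borel" by measurable
  have "integrable (density (distr lborel borel ?T) (\<lambda>_. ennreal (\<Prod>j\<in>UNIV. c $ j))) f"
    using f eq by simp
  then have "integrable (distr lborel borel ?T) (\<lambda>x. (\<Prod>j\<in>UNIV. c $ j) *\<^sub>R f x)"
    by (subst (asm) integrable_density) (use pos m in auto)
  then have "integrable (distr lborel borel ?T) f"
    using c by (simp add: less_imp_neq[symmetric])
  then have "integrable lborel (\<lambda>x. f (?T x))"
    using integrable_distr_eq[OF Tm, of f] m by blast
  then show "integrable lborel (\<lambda>x. f (\<chi> j. t $ j + c $ j * x $ j))"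
    unfolding fun_cong[OF T] .
  have "(LINT x|lborel. f x) = (LINT x|density (distr lborel borel ?T) (\<lambda>_. ennreal (\<Prod>j\<in>UNIV. c $ j)). f x)"
    using eq by simp
  also have "\<dots> = (LINT x|distr lborel borel ?T. (\<Prod>j\<in>UNIV. c $ j) *\<^sub>R f x)"
    by (rule integral_density) (use pos m in auto)
  also have "\<dots> = (\<Prod>j\<in>UNIV. c $ j) * (LINT x|distr lborel borel ?T. f x)" by simp
  also have "(LINT x|distr lborel borel ?T. f x) = (LINT x|lborel. f (\<chi> j. t $ j + c $ j * x $ j))"
    using integral_distr[OF Tm m] unfolding fun_cong[OF T] .
  finally show "(LINT x|lborel. f x) = (\<Prod>j\<in>UNIV. c $ j) * (LINT x|lborel. f (\<chi> j. t $ j + c $ j * x $ j))" .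
qed

text \<open>The path \<open>\<sigma> \<mapsto> y + \<sigma>\<^sup>n (w - y)\<close> makes the factor
  \<open>\<sigma>\<^bsup>n (n - 1)\<^esup>\<close> from Young's inequality cancel against the Jacobian of
  \<open>w \<mapsto> y + \<sigma>\<^sup>n (w - y)\<close> in the \<open>n - 1\<close> directions of the slice.\<close>

lemma morrey_average:
  fixes \<phi> :: "real^'n \<Rightarrow> real" and g :: "real^'n \<Rightarrow> real^'n" and i :: 'n
  defines "n \<equiv> CARD('n)"
  assumes \<phi>: "\<And>x. (\<phi> has_derivative (\<lambda>v. g x \<bullet> v)) (at x)" and g: "continuous_on UNIV g"
    and K: "compact K" "\<And>x. x \<notin> K \<Longrightarrow> g x = 0"
    and lh: "lo < hi" and D: "D > 0" and r: "r > 0"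
    and G: "(LINT x|lborel. indicator {x. lo \<le> x $ i \<and> x $ i \<le> hi} x * norm (g (slice_proj i s x)) ^ n) \<le> G"
    and y: "y $ i = s" "\<And>j. j \<noteq> i \<Longrightarrow> bl $ j \<le> y $ j \<and> y $ j \<le> bl $ j + r"
    and bl: "bl $ i = lo" and bu: "bu = (\<chi> j. if j = i then hi else bl $ j + r)"
  shows "\<bar>integral (cbox bl bu) (\<lambda>w. \<phi> (slice_proj i s w)) - (hi - lo) * r ^ (n - 1) * \<phi> y\<bar>
    \<le> real n * D * ((hi - lo) * r ^ (n - 1)) + real n * (real n * r) ^ n / D ^ (n - 1) * G"
proof -
  let ?Q = "slice_proj i s" and ?B = "cbox bl bu"
  have n: "n \<ge> 1" unfolding n_def using zero_less_card_finite[where 'a = 'n] by linarith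
  \<comment> \<open>Volume of the box: a slice cube of side r, thickened by hi - lo in direction
    i.\<close>
  define c where "c = (hi - lo) * r ^ (n - 1)"
  have cont_B: "measure lborel ?B = c"
  proof -
    have ne: "?B \<noteq> {}"
      using lh r bl by (auto simp: interval_ne_empty_cart bu)
    have "measure lborel ?B = (\<Prod>j\<in>UNIV. bu $ j - bl $ j)"
      by (rule content_cbox_cart[OF ne])
    also have "\<dots> = (bu $ i - bl $ i) * (\<Prod>j\<in>UNIV - {i}. bu $ j - bl $ j)"
      by (rule prod.remove) auto
    also have "(\<Prod>j\<in>UNIV - {i}. bu $ j - bl $ j) = (\<Prod>j\<in>UNIV - {i}. r)"
      by (rule prod.cong) (auto simp: bu)
    finally show ?thesis by (simp add: bu bl c_def n_def card_Diff_singleton)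
  qed
  define \<gamma> where "\<gamma> \<sigma> w = y + \<sigma> ^ n *\<^sub>R (?Q w - y)" for \<sigma> :: real and w
  \<comment> \<open>\<open>a 1\<close> integrates \<phi> over the thickened slice cube and
    \<open>a 0\<close> is c \<phi>(y), so the mean value theorem reduces the claim to a bound on
    \<open>a' \<sigma>\<close> that is uniform in \<sigma> > 0.\<close>
  define a where "a \<sigma> = integral ?B (\<lambda>w. \<phi> (\<gamma> \<sigma> w))" for \<sigma>
  define a' where "a' \<sigma> = integral ?B (\<lambda>w. real n * \<sigma> ^ (n - 1) * (g (\<gamma> \<sigma> w) \<bullet> (?Q w - y)))" for \<sigma>
  have c\<phi>: "continuous_on UNIV \<phi>"
    using \<phi> by (auto intro!: continuous_at_imp_continuous_on has_derivative_continuous)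
  have c\<gamma>: "continuous_on UNIV (\<gamma> \<sigma>)" for \<sigma>
    unfolding \<gamma>_def by (intro continuous_intros continuous_on_slice_proj)
  have cg\<gamma>: "continuous_on S (\<lambda>w. g (\<gamma> \<sigma> w))" for \<sigma> S
    by (rule continuous_on_compose2[OF g continuous_on_subset[OF c\<gamma>]]) auto
  have der: "(a has_real_derivative a' \<sigma>) (at \<sigma>)" for \<sigma>
  proof -
    have "((\<lambda>\<sigma>. integral (cbox bl bu) (\<lambda>w. \<phi> (\<gamma> \<sigma> w))) has_vector_derivative
        integral (cbox bl bu) (\<lambda>w. real n * \<sigma> ^ (n - 1) * (g (\<gamma> \<sigma> w) \<bullet> (?Q w - y)))) (at \<sigma> within UNIV)"
    proof (rule leibniz_rule_vector_derivative)
      show "((\<lambda>\<sigma>. \<phi> (\<gamma> \<sigma> w)) has_vector_derivative real n * \<sigma> ^ (n - 1) * (g (\<gamma> \<sigma> w) \<bullet> (?Q w - y))) (at \<sigma> within UNIV)" for \<sigma> w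
      proof -
        have "((\<lambda>\<sigma>. \<gamma> \<sigma> w) has_derivative (\<lambda>h. (h * (real n * \<sigma> ^ (n - 1))) *\<^sub>R (?Q w - y))) (at \<sigma>)"
          unfolding \<gamma>_def by (auto intro!: derivative_eq_intros simp: mult_ac)
        from has_derivative_compose[OF this \<phi>] show ?thesis
          by (simp add: has_vector_derivative_def mult_ac)
      qed
      show "(\<lambda>w. \<phi> (\<gamma> \<sigma> w)) integrable_on cbox bl bu" for \<sigma>
        by (intro integrable_continuous continuous_on_compose2[OF c\<phi> continuous_on_subset[OF c\<gamma>]]) auto
      have cc: "continuous_on (UNIV \<times> cbox bl bu) (\<lambda>p. \<gamma> (fst p) (snd p))"
        unfolding \<gamma>_def by (intro continuous_intros continuous_on_slice_proj)
      show "continuous_on (UNIV \<times> cbox bl bu) (\<lambda>(\<sigma>, w). real n * \<sigma> ^ (n - 1) * (g (\<gamma> \<sigma> w) \<bullet> (?Q w - y)))"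
        unfolding split_beta
        by (intro continuous_intros continuous_on_slice_proj continuous_on_compose2[OF g cc]) auto
    qed auto
    then show ?thesis
      by (simp add: a_def[abs_def] a'_def has_real_derivative_iff_has_vector_derivative)
  qed
  have bound: "\<bar>a' \<sigma>\<bar> \<le> real n * D * c + real n * (real n * r) ^ n / D ^ (n - 1) * G" if \<sigma>: "0 < \<sigma>" for \<sigma>
  proof -
    \<comment> \<open>The affine map \<open>?T\<close> contracts towards y by \<sigma>^n in the n -
      1 slice directions and fixes x_i, so it preserves the slab and has determinant
      (\<sigma>^n)^(n-1).\<close>
    define C where "C = (\<chi> j. if j = i then 1 else \<sigma> ^ n)"
    define t where "t = (\<chi> j. if j = i then 0 else y $ j - \<sigma> ^ n * y $ j)"
    let ?T = "\<lambda>w::real^'n. \<chi> j. t $ j + C $ j * w $ j"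
    let ?f = "\<lambda>x. indicator {x. lo \<le> x $ i \<and> x $ i \<le> hi} x * norm (g (?Q x)) ^ n"
    have cgn: "continuous_on UNIV (\<lambda>x. norm (g x) ^ n)" by (intro continuous_intros g)
    have gn0: "norm (g x) ^ n = 0" if "x \<notin> K" for x using K(2)[OF that] n by simp
    have f: "integrable lborel ?f" by (rule integrable_slab[OF cgn K(1) gn0])
    have C: "C $ j > 0" for j using \<sigma> by (simp add: C_def)
    have PC: "(\<Prod>j\<in>UNIV. C $ j) = (\<sigma> ^ n) ^ (n - 1)"
    proof -
      have "(\<Prod>j\<in>UNIV. C $ j) = C $ i * (\<Prod>j\<in>UNIV - {i}. C $ j)"
        by (rule prod.remove) auto
      also have "(\<Prod>j\<in>UNIV - {i}. C $ j) = (\<Prod>j\<in>UNIV - {i}. \<sigma> ^ n)"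
        by (rule prod.cong) (auto simp: C_def)
      finally show ?thesis by (simp add: C_def n_def card_Diff_singleton)
    qed
    have QT: "?Q (?T w) = \<gamma> \<sigma> w" for w
      unfolding vec_eq_iff \<gamma>_def
      by (auto simp: slice_proj_nth C_def t_def y(1) algebra_simps)
    have IB: "set_integrable lborel ?B (\<lambda>w. norm (g (\<gamma> \<sigma> w)) ^ n)"
      unfolding set_integrable_def by (intro borel_integrable_compact compact_cbox continuous_intros cg\<gamma>)
    have "integral ?B (\<lambda>w. norm (g (\<gamma> \<sigma> w)) ^ n) = (LINT w|lborel. indicator ?B w * norm (g (\<gamma> \<sigma> w)) ^ n)"
      using set_borel_integral_eq_integral(2)[OF IB] by (simp add: set_lebesgue_integral_def)
    also have "\<dots> \<le> (LINT w|lborel. ?f (?T w))"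
    proof (rule integral_mono)
      show "integrable lborel (\<lambda>w. indicator ?B w * norm (g (\<gamma> \<sigma> w)) ^ n)"
        using IB by (simp add: set_integrable_def)
      show "integrable lborel (\<lambda>w. ?f (?T w))" by (rule lborel_diagonal_affine(1)[OF f C])
      show "indicator ?B w * norm (g (\<gamma> \<sigma> w)) ^ n \<le> ?f (?T w)" for w
      proof -
        have "lo \<le> ?T w $ i \<and> ?T w $ i \<le> hi" if "w \<in> ?B"
        proof -
          have "bl $ i \<le> w $ i \<and> w $ i \<le> bu $ i" using that by (simp add: mem_box_cart)
          then show ?thesis by (simp add: t_def C_def bl bu)
        qed
        then show ?thesis unfolding QT by (auto simp: indicator_def)
      qed
    qed
    finally have "(\<sigma> ^ n) ^ (n - 1) * integral ?B (\<lambda>w. norm (g (\<gamma> \<sigma> w)) ^ n) \<le> (\<sigma> ^ n) ^ (n - 1) * (LINT w|lborel. ?f (?T w))"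
      using \<sigma> by (intro mult_left_mono) auto
    also have "\<dots> = (LINT x|lborel. ?f x)"
      using lborel_diagonal_affine(2)[OF f C, of t] by (simp add: PC)
    also have "\<dots> \<le> G" by (rule G)
    finally have IG: "(\<sigma> ^ n) ^ (n - 1) * integral ?B (\<lambda>w. norm (g (\<gamma> \<sigma> w)) ^ n) \<le> G" .
    have Ig: "(\<lambda>w. norm (g (\<gamma> \<sigma> w)) ^ n) integrable_on ?B"
      by (intro integrable_continuous continuous_intros cg\<gamma>)
    have "\<bar>a' \<sigma>\<bar> \<le> integral ?B (\<lambda>w. real n * D + real n * (real n * r) ^ n / D ^ (n - 1) * ((\<sigma> ^ n) ^ (n - 1) * norm (g (\<gamma> \<sigma> w)) ^ n))"
      unfolding a'_def real_norm_def[symmetric]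
    proof (rule integral_norm_bound_integral)
      show "(\<lambda>w. real n * \<sigma> ^ (n - 1) * (g (\<gamma> \<sigma> w) \<bullet> (?Q w - y))) integrable_on ?B"
        by (intro integrable_continuous continuous_intros continuous_on_slice_proj cg\<gamma>)
      show "(\<lambda>w. real n * D + real n * (real n * r) ^ n / D ^ (n - 1) * ((\<sigma> ^ n) ^ (n - 1) * norm (g (\<gamma> \<sigma> w)) ^ n)) integrable_on ?B"
        by (intro integrable_continuous continuous_intros cg\<gamma>)
      fix w assume w: "w \<in> ?B"
      have "\<bar>(?Q w - y) $ j\<bar> \<le> r" for j
      proof (cases "j = i")
        case False
        have "bl $ j \<le> w $ j \<and> w $ j \<le> bu $ j" using w by (simp add: mem_box_cart)
        then show ?thesis using y(2)[OF False] False
          unfolding abs_le_iff by (simp add: slice_proj_nth bu)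
      qed (use y r in \<open>simp add: slice_proj_nth\<close>)
      then have "(\<Sum>j\<in>UNIV. \<bar>(?Q w - y) $ j\<bar>) \<le> (\<Sum>j\<in>(UNIV::'n set). r)" by (intro sum_mono)
      then have Qy: "norm (?Q w - y) \<le> real n * r"
        using norm_le_l1_cart[of "?Q w - y"] by (simp add: n_def)
      let ?X = "\<sigma> ^ (n - 1) * (norm (g (\<gamma> \<sigma> w)) * (real n * r))"
      have "norm (real n * \<sigma> ^ (n - 1) * (g (\<gamma> \<sigma> w) \<bullet> (?Q w - y))) = real n * (\<sigma> ^ (n - 1) * \<bar>g (\<gamma> \<sigma> w) \<bullet> (?Q w - y)\<bar>)"
        using \<sigma> by (simp add: abs_mult)
      also have "\<dots> \<le> real n * ?X"
        using \<sigma> Qy by (intro mult_left_mono order_trans[OF Cauchy_Schwarz_ineq2]) auto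
      also have "\<dots> \<le> real n * (D + ?X ^ n / D ^ (n - 1))"
        using \<sigma> D n r by (intro mult_left_mono le_add_power_div) auto
      also have "?X ^ n = (real n * r) ^ n * ((\<sigma> ^ n) ^ (n - 1) * norm (g (\<gamma> \<sigma> w)) ^ n)"
        by (simp add: power_mult_distrib power_mult[symmetric] mult_ac)
      finally show "norm (real n * \<sigma> ^ (n - 1) * (g (\<gamma> \<sigma> w) \<bullet> (?Q w - y))) \<le>
         real n * D + real n * (real n * r) ^ n / D ^ (n - 1) * ((\<sigma> ^ n) ^ (n - 1) * norm (g (\<gamma> \<sigma> w)) ^ n)"
        by (simp add: algebra_simps)
    qed
    also have "\<dots> = real n * D * c + real n * (real n * r) ^ n / D ^ (n - 1) * ((\<sigma> ^ n) ^ (n - 1) * integral ?B (\<lambda>w. norm (g (\<gamma> \<sigma> w)) ^ n))"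
    proof (rule integral_unique)
      have "((\<lambda>w. real n * D + real n * (real n * r) ^ n / D ^ (n - 1) * ((\<sigma> ^ n) ^ (n - 1) * norm (g (\<gamma> \<sigma> w)) ^ n)) has_integral
        (measure lborel ?B *\<^sub>R (real n * D) + real n * (real n * r) ^ n / D ^ (n - 1) * ((\<sigma> ^ n) ^ (n - 1) * integral ?B (\<lambda>w. norm (g (\<gamma> \<sigma> w)) ^ n)))) ?B"
        by (intro has_integral_add has_integral_mult_right has_integral_const integrable_integral Ig)
      then show "((\<lambda>w. real n * D + real n * (real n * r) ^ n / D ^ (n - 1) * ((\<sigma> ^ n) ^ (n - 1) * norm (g (\<gamma> \<sigma> w)) ^ n)) has_integral
        (real n * D * c + real n * (real n * r) ^ n / D ^ (n - 1) * ((\<sigma> ^ n) ^ (n - 1) * integral ?B (\<lambda>w. norm (g (\<gamma> \<sigma> w)) ^ n)))) ?B"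
        by (simp add: cont_B mult.commute)
    qed
    also have "\<dots> \<le> real n * D * c + real n * (real n * r) ^ n / D ^ (n - 1) * G"
      using IG D r by (intro add_left_mono mult_left_mono) auto
    finally show ?thesis .
  qed
  obtain \<sigma> where \<sigma>: "0 < \<sigma>" "a 1 - a 0 = (1 - 0) * a' \<sigma>"
    using MVT2[of 0 1 a a'] der by auto
  have "a 1 = integral ?B (\<lambda>w. \<phi> (?Q w))" by (simp add: a_def \<gamma>_def)
  moreover have "a 0 = c * \<phi> y" using n by (simp add: a_def \<gamma>_def cont_B power_0_left)
  ultimately show ?thesis using bound[OF \<sigma>(1)] \<sigma>(2) unfolding c_def by simp
qed

text \<open>Both points are compared with the average over one slice cube of side r = |y - z| that
  contains them. Dividing r^n by the cube's volume r^(n-1) leaves the factor r, that is, a Lipschitz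
  bound up to an additive error of order D.\<close>

lemma morrey_slice:
  fixes \<phi> :: "real^'n \<Rightarrow> real" and g :: "real^'n \<Rightarrow> real^'n" and i :: 'n
  defines "n \<equiv> CARD('n)"
  assumes \<phi>: "\<And>x. (\<phi> has_derivative (\<lambda>v. g x \<bullet> v)) (at x)" and g: "continuous_on UNIV g"
    and K: "compact K" "\<And>x. x \<notin> K \<Longrightarrow> g x = 0"
    and lh: "lo < hi" and D: "D > 0"
    and G: "(LINT x|lborel. indicator {x. lo \<le> x $ i \<and> x $ i \<le> hi} x * norm (g (slice_proj i s x)) ^ n) \<le> G"
    and yz: "y $ i = s" "z $ i = s"
  shows "\<phi> y - \<phi> z \<le> 2 * real n * D + 2 * real n ^ (n + 1) * norm (y - z) * G / (D ^ (n - 1) * (hi - lo))"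
proof (cases "y = z")
  case True
  then show ?thesis using D by simp
next
  case False
  define r where "r = norm (y - z)"
  have r: "r > 0" using False by (simp add: r_def)
  have n: "n \<ge> 1" unfolding n_def using zero_less_card_finite[where 'a = 'n] by linarith
  \<comment> \<open>Starting each slice coordinate at the smaller of the two values makes the cube
    of side |y - z| contain both points.\<close>
  define bl where "bl = (\<chi> j. if j = i then lo else min (y $ j) (z $ j))"
  define bu where "bu = (\<chi> j. if j = i then hi else bl $ j + r)"
  have j: "\<bar>y $ j - z $ j\<bar> \<le> r" for j
    unfolding r_def using component_le_norm_cart[of "y - z" j] by simp
  let ?I = "integral (cbox bl bu) (\<lambda>w. \<phi> (slice_proj i s w))" and ?c = "(hi - lo) * r ^ (n - 1)"
  let ?E = "real n * D * ?c + real n * (real n * r) ^ n / D ^ (n - 1) * G"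
  have "\<bar>?I - ?c * \<phi> y\<bar> \<le> ?E"
    unfolding n_def
    by (rule morrey_average[OF \<phi> g K lh D r G[unfolded n_def] yz(1) _ _ bu_def]) (use j r in \<open>auto simp: bl_def min_def abs_le_iff less_imp_le algebra_simps\<close>)
  moreover have "\<bar>?I - ?c * \<phi> z\<bar> \<le> ?E"
    unfolding n_def
    by (rule morrey_average[OF \<phi> g K lh D r G[unfolded n_def] yz(2) _ _ bu_def]) (use j r in \<open>auto simp: bl_def min_def abs_le_iff less_imp_le algebra_simps\<close>)
  moreover have "c * (a - b) \<le> 2 * E" if "\<bar>I - c * a\<bar> \<le> E" "\<bar>I - c * b\<bar> \<le> E" for I a b c E :: real
    using that unfolding right_diff_distrib by linarith
  ultimately have "?c * (\<phi> y - \<phi> z) \<le> 2 * ?E" by blast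
  also have "\<dots> = ?c * (2 * real n * D + 2 * real n ^ (n + 1) * r * G / (D ^ (n - 1) * (hi - lo)))"
  proof -
    have e: "real n * (real n * r) ^ n = real n ^ (n + 1) * (r * r ^ (n - 1))"
      using n by (simp add: power_mult_distrib power_eq_if[of r])
    have id: "2 * (a * D * (h * b) + m * (r * b) / d * G) = h * b * (2 * a * D + 2 * m * r * G / (d * h))"
      if "h > 0" "d > 0" for a b m d h :: real
      using that by (simp add: field_simps)
    show ?thesis unfolding e by (rule id) (use lh D in auto)
  qed
  finally have "\<phi> y - \<phi> z \<le> 2 * real n * D + 2 * real n ^ (n + 1) * r * G / (D ^ (n - 1) * (hi - lo))"
    using lh r by (subst (asm) mult_le_cancel_left_pos) auto
  then show ?thesis by (simp add: r_def)
qed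

section \<open>The estimate on a slab\<close>

text \<open>The hypothesis on u is a Lipschitz bound with additive error E; inf-convolution turns it
  into a genuine Lipschitz bound at the uniform cost E while keeping 0 \<le> w \<le> u on H. The
  infimum runs over H but is taken at every point, so w is Lipschitz on the whole space.\<close>

lemma inf_convolution:
  fixes u :: "'a::real_normed_vector \<Rightarrow> real"
  assumes H: "H \<noteq> {}" and u: "\<And>y. y \<in> H \<Longrightarrow> 0 \<le> u y" and \<Lambda>: "0 \<le> \<Lambda>"
    and E: "\<And>y z. y \<in> H \<Longrightarrow> z \<in> H \<Longrightarrow> u y \<le> u z + E + \<Lambda> * norm (y - z)"
  obtains w where "\<And>y. 0 \<le> w y" "\<And>y. y \<in> H \<Longrightarrow> w y \<le> u y" "\<And>y. y \<in> H \<Longrightarrow> u y \<le> w y + E"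
    "\<And>y z. \<bar>w y - w z\<bar> \<le> \<Lambda> * norm (y - z)"
proof -
  define w where "w y = (INF z\<in>H. u z + \<Lambda> * norm (y - z))" for y
  have bdd: "bdd_below ((\<lambda>z. u z + \<Lambda> * norm (y - z)) ` H)" for y
    using u \<Lambda> by (intro bdd_belowI2[of _ 0]) auto
  have "w y \<le> w z + \<Lambda> * norm (y - z)" for y z
  proof -
    have "w y - \<Lambda> * norm (y - z) \<le> w z"
      unfolding w_def[of z]
    proof (rule cINF_greatest[OF H])
      fix x assume x: "x \<in> H"
      have "w y \<le> u x + \<Lambda> * norm (y - x)" unfolding w_def by (rule cINF_lower[OF bdd x])
      moreover have "\<Lambda> * norm (y - x) \<le> \<Lambda> * (norm (y - z) + norm (z - x))"
        using \<Lambda> norm_triangle_ineq[of "y - z" "z - x"] by (intro mult_left_mono) auto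
      ultimately show "w y - \<Lambda> * norm (y - z) \<le> u x + \<Lambda> * norm (z - x)" by (simp add: distrib_left)
    qed
    then show ?thesis by simp
  qed
  then have "\<bar>w y - w z\<bar> \<le> \<Lambda> * norm (y - z)" for y z
    using norm_minus_commute[of y z] by (simp add: abs_le_iff diff_le_eq add.commute) (metis add.commute)
  moreover have "0 \<le> w y" for y
    unfolding w_def using u \<Lambda> by (intro cINF_greatest[OF H]) auto
  moreover have "w y \<le> u y" if "y \<in> H" for y
    using cINF_lower[OF bdd that, of y] by (simp add: w_def)
  moreover have "u y \<le> w y + E" if "y \<in> H" for y
  proof -
    have "u y - E \<le> w y" unfolding w_def
    proof (rule cINF_greatest[OF H])
      show "u y - E \<le> u z + \<Lambda> * norm (y - z)" if "z \<in> H" for z using E[OF \<open>y \<in> H\<close> that] by simp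
    qed
    then show ?thesis by simp
  qed
  ultimately show ?thesis using that by blast
qed

lemma integrable_mult_bounded:
  fixes f h :: "'a \<Rightarrow> real"
  assumes f: "integrable M f" and h: "h \<in> borel_measurable M" "\<And>x. x \<in> space M \<Longrightarrow> \<bar>h x\<bar> \<le> B"
  shows "integrable M (\<lambda>x. f x * h x)" "\<bar>LINT x|M. f x * h x\<bar> \<le> B * (LINT x|M. \<bar>f x\<bar>)"
proof -
  have b: "\<bar>f x * h x\<bar> \<le> B * \<bar>f x\<bar>" if "x \<in> space M" for x
    using mult_left_mono[OF h(2)[OF that], of "\<bar>f x\<bar>"] by (simp add: abs_mult mult.commute)
  have iB: "integrable M (\<lambda>x. B * \<bar>f x\<bar>)" using f by simp
  show i: "integrable M (\<lambda>x. f x * h x)"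
  proof (rule Bochner_Integration.integrable_bound[OF iB])
    show "AE x in M. norm (f x * h x) \<le> norm (B * \<bar>f x\<bar>)"
      using b by (intro AE_I2) (metis abs_ge_self order_trans real_norm_def)
  qed (use f h in measurable)
  have "\<bar>LINT x|M. f x * h x\<bar> \<le> (LINT x|M. B * \<bar>f x\<bar>)"
    by (rule order_trans[OF integral_abs_bound integral_mono]) (use i iB b in auto)
  then show "\<bar>LINT x|M. f x * h x\<bar> \<le> B * (LINT x|M. \<bar>f x\<bar>)" by simp
qed

text \<open>Profile of the cut-off across a slab: it climbs to \<delta> with slope 1 over the slab
  and comes down with slope -\<delta>/\<tau> over the fixed length \<tau>. The height \<delta> keeps
  tangential derivatives small, and the slow descent makes its own contribution carry the factor
  \<delta>/\<tau>.\<close>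

definition ramp :: "real \<Rightarrow> real \<Rightarrow> real \<Rightarrow> real" where
  "ramp \<delta> \<tau> t = max 0 (min t (\<delta> - \<delta> / \<tau> * (t - \<delta>)))"

text \<open>The pieces are half-open like the slabs, which tile the space when translated.\<close>

definition ramp_deriv :: "real \<Rightarrow> real \<Rightarrow> real \<Rightarrow> real" where
  "ramp_deriv \<delta> \<tau> t = (if 0 \<le> t \<and> t < \<delta> then 1 else if \<delta> \<le> t \<and> t < \<delta> + \<tau> then - (\<delta> / \<tau>) else 0)"

context
  fixes \<delta> \<tau> :: real
  assumes \<delta>: "0 < \<delta>" "\<delta> \<le> \<tau>"
begin

lemma ramp_values:
  "t \<le> 0 \<Longrightarrow> ramp \<delta> \<tau> t = 0"
  "0 \<le> t \<Longrightarrow> t \<le> \<delta> \<Longrightarrow> ramp \<delta> \<tau> t = t"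
  "\<delta> \<le> t \<Longrightarrow> t \<le> \<delta> + \<tau> \<Longrightarrow> ramp \<delta> \<tau> t = \<delta> - \<delta> / \<tau> * (t - \<delta>)"
  "\<delta> + \<tau> \<le> t \<Longrightarrow> ramp \<delta> \<tau> t = 0"
proof -
  have q: "0 < \<delta> / \<tau>" "\<delta> / \<tau> \<le> 1" "\<delta> / \<tau> * \<tau> = \<delta>" using \<delta> by auto
  show "t \<le> 0 \<Longrightarrow> ramp \<delta> \<tau> t = 0" by (simp add: ramp_def)
  show "0 \<le> t \<Longrightarrow> t \<le> \<delta> \<Longrightarrow> ramp \<delta> \<tau> t = t"
  proof -
    assume t: "0 \<le> t" "t \<le> \<delta>"
    have "\<delta> / \<tau> * (t - \<delta>) \<le> 0" using q t by (intro mult_nonneg_nonpos) auto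
    then show ?thesis using t unfolding ramp_def by linarith
  qed
  show "\<delta> \<le> t \<Longrightarrow> t \<le> \<delta> + \<tau> \<Longrightarrow> ramp \<delta> \<tau> t = \<delta> - \<delta> / \<tau> * (t - \<delta>)"
  proof -
    assume t: "\<delta> \<le> t" "t \<le> \<delta> + \<tau>"
    have "\<delta> / \<tau> * (t - \<delta>) \<le> \<delta> / \<tau> * \<tau>" using q t by (intro mult_left_mono) auto
    moreover have "0 \<le> \<delta> / \<tau> * (t - \<delta>)" using q t by (intro mult_nonneg_nonneg) auto
    ultimately show ?thesis using t q unfolding ramp_def by linarith
  qed
  show "\<delta> + \<tau> \<le> t \<Longrightarrow> ramp \<delta> \<tau> t = 0"
  proof -
    assume t: "\<delta> + \<tau> \<le> t"
    have "\<delta> / \<tau> * \<tau> \<le> \<delta> / \<tau> * (t - \<delta>)" using q t by (intro mult_left_mono) auto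
    then show ?thesis using t q \<delta> unfolding ramp_def by linarith
  qed
qed

lemma ramp_bounds: "0 \<le> ramp \<delta> \<tau> t" "ramp \<delta> \<tau> t \<le> \<delta>"
proof -
  show "0 \<le> ramp \<delta> \<tau> t" by (simp add: ramp_def)
  show "ramp \<delta> \<tau> t \<le> \<delta>"
  proof (cases "t \<le> \<delta>")
    case False
    then have "0 \<le> \<delta> / \<tau> * (t - \<delta>)" using \<delta> by (intro mult_nonneg_nonneg) auto
    then show ?thesis using \<delta> unfolding ramp_def by linarith
  qed (use \<delta> in \<open>auto simp: ramp_def\<close>)
qed

lemma ramp_lipschitz: "\<bar>ramp \<delta> \<tau> t - ramp \<delta> \<tau> t'\<bar> \<le> \<bar>t - t'\<bar>"
proof -
  have "\<bar>\<delta> / \<tau> * (t - t')\<bar> \<le> 1 * \<bar>t - t'\<bar>"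
    unfolding abs_mult using \<delta> by (intro mult_right_mono) auto
  then show ?thesis unfolding ramp_def right_diff_distrib by (simp add: max_def min_def) argo
qed

lemma ramp_deriv_bound: "\<bar>ramp_deriv \<delta> \<tau> t\<bar> \<le> 1"
  using \<delta> by (auto simp: ramp_deriv_def)

lemma ramp_locally_affine:
  assumes t: "t \<notin> {0, \<delta>, \<delta> + \<tau>}"
  obtains \<kappa> where "\<kappa> > 0"
    "\<And>t1 t2. \<bar>t1 - t\<bar> < \<kappa> \<Longrightarrow> \<bar>t2 - t\<bar> < \<kappa> \<Longrightarrow> ramp \<delta> \<tau> t2 - ramp \<delta> \<tau> t1 = ramp_deriv \<delta> \<tau> t * (t2 - t1)"
proof -
  let ?\<kappa> = "min \<bar>t\<bar> (min \<bar>t - \<delta>\<bar> \<bar>t - (\<delta> + \<tau>)\<bar>)"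
  show ?thesis
  proof (rule that[of ?\<kappa>])
    show "?\<kappa> > 0" using t by auto
    fix t1 t2 assume "\<bar>t1 - t\<bar> < ?\<kappa>" "\<bar>t2 - t\<bar> < ?\<kappa>"
    then have a: "\<bar>t1 - t\<bar> < \<bar>t\<bar>" "\<bar>t1 - t\<bar> < \<bar>t - \<delta>\<bar>" "\<bar>t1 - t\<bar> < \<bar>t - (\<delta> + \<tau>)\<bar>"
      "\<bar>t2 - t\<bar> < \<bar>t\<bar>" "\<bar>t2 - t\<bar> < \<bar>t - \<delta>\<bar>" "\<bar>t2 - t\<bar> < \<bar>t - (\<delta> + \<tau>)\<bar>" by auto
    consider "t < 0" | "0 < t" "t < \<delta>" | "\<delta> < t" "t < \<delta> + \<tau>" | "\<delta> + \<tau> < t" using t by fastforce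
    then show "ramp \<delta> \<tau> t2 - ramp \<delta> \<tau> t1 = ramp_deriv \<delta> \<tau> t * (t2 - t1)"
    proof cases
      case 1
      then have "t1 \<le> 0" "t2 \<le> 0" using 1 a by linarith+
      then show ?thesis using 1 \<delta> by (simp add: ramp_values ramp_deriv_def)
    next
      case 2
      then have "0 \<le> t1" "t1 \<le> \<delta>" "0 \<le> t2" "t2 \<le> \<delta>" using 2 a by linarith+
      then show ?thesis using 2 by (simp add: ramp_values ramp_deriv_def)
    next
      case 3
      then have "\<delta> \<le> t1" "t1 \<le> \<delta> + \<tau>" "\<delta> \<le> t2" "t2 \<le> \<delta> + \<tau>" using 3 a by linarith+
      moreover have "ramp_deriv \<delta> \<tau> t = - (\<delta> / \<tau>)" using 3 by (simp add: ramp_deriv_def)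
      moreover have "\<delta> - q * (t2 - \<delta>) - (\<delta> - q * (t1 - \<delta>)) = - q * (t2 - t1)" for q
        by (simp add: algebra_simps)
      ultimately show ?thesis by (simp only: ramp_values)
    next
      case 4
      then have "\<delta> + \<tau> \<le> t1" "\<delta> + \<tau> \<le> t2" using 4 a \<delta> by linarith+
      then show ?thesis using 4 \<delta> by (simp add: ramp_values ramp_deriv_def)
    qed
  qed
qed

end

lemma norm_oblique_proj_le: "norm (x - (a \<bullet> x) *\<^sub>R e) \<le> (1 + norm a * norm e) * norm x"
proof -
  have "norm (x - (a \<bullet> x) *\<^sub>R e) \<le> norm x + \<bar>a \<bullet> x\<bar> * norm e"
    using norm_triangle_ineq4[of x "(a \<bullet> x) *\<^sub>R e"] by simp
  also have "\<dots> \<le> norm x + (norm a * norm x) * norm e"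
    by (intro add_left_mono mult_right_mono Cauchy_Schwarz_ineq2) auto
  finally show ?thesis by (simp add: algebra_simps)
qed

text \<open>The test function is \<zeta>(x) = w(P x) h(a . x - s), with P the projection along e to
  the hyperplane a . y = s and h the ramp. Along e only h varies, and its unit slope on the slab
  produces the left-hand side. Across e the variation is at most \<Lambda> \<delta>, because h is at
  most \<delta>; this gives the term with \<Lambda>. The descent of the ramp gives the term with W /
  \<tau>.\<close>

lemma slab_estimate:
  fixes F :: "real^'n \<Rightarrow> real^'n" and w :: "real^'n \<Rightarrow> real"
  assumes \<Omega>: "open \<Omega>" and F: "integrable (lebesgue_on \<Omega>) F" "div_free_on \<Omega> F"
    and ae: "a \<bullet> e = 1" and \<delta>: "0 < \<delta>" "\<delta> \<le> \<tau>"
    and w0: "\<And>y. 0 \<le> w y" and wL: "\<And>y z. \<bar>w y - w z\<bar> \<le> \<Lambda> * norm (y - z)" and \<Lambda>: "0 \<le> \<Lambda>"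
    and W: "\<And>y. a \<bullet> y = s \<Longrightarrow> w y \<le> W"
    and K: "compact K" "\<And>y. a \<bullet> y = s \<Longrightarrow> y \<notin> K \<Longrightarrow> w y = 0"
    and K\<Omega>: "\<And>p t. p \<in> K \<Longrightarrow> 0 \<le> t \<Longrightarrow> t \<le> 2 * \<tau> \<Longrightarrow> p + t *\<^sub>R e \<in> \<Omega>"
  shows "\<bar>LINT x|lebesgue_on \<Omega>. (F x \<bullet> a) * (indicator {x. s \<le> a \<bullet> x \<and> a \<bullet> x < s + \<delta>} x * w (x - (a \<bullet> x - s) *\<^sub>R e))\<bar>
     \<le> \<delta> * ((1 + norm a * norm e) * \<Lambda> + norm a * W / \<tau>) * (LINT x|lebesgue_on \<Omega>. norm (F x))"
proof -
  let ?N = "LINT x|lebesgue_on \<Omega>. norm (F x)"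
  define B where "B = 1 + norm a * norm e"
  have B: "B \<ge> 1" by (simp add: B_def)
  have a0: "a \<noteq> 0" using ae by auto
  define P where "P x = x - (a \<bullet> x - s) *\<^sub>R e" for x
  have aP: "a \<bullet> P x = s" for x using ae by (simp add: P_def inner_diff_right)
  have W0: "0 \<le> W" using w0[of "P 0"] W[OF aP, of 0] by linarith
  have Pd: "norm (P x - P y) \<le> B * norm (x - y)" for x y
  proof -
    have "P x - P y = (x - y) - (a \<bullet> (x - y)) *\<^sub>R e" by (simp add: P_def algebra_simps inner_diff_right)
    then show ?thesis unfolding B_def by (simp add: norm_oblique_proj_le)
  qed
  have wP: "\<bar>w (P x) - w (P y)\<bar> \<le> \<Lambda> * B * norm (x - y)" for x y
    using order_trans[OF wL mult_left_mono[OF Pd \<Lambda>]] by (simp add: mult_ac)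
  let ?h = "\<lambda>x. ramp \<delta> \<tau> (a \<bullet> x - s)"
  define \<zeta> where "\<zeta> x = w (P x) * ?h x" for x
  define d where "d x = w (P x) * ramp_deriv \<delta> \<tau> (a \<bullet> x - s)" for x
  note hb = ramp_bounds[OF \<delta>]
  have cwP: "continuous_on UNIV (\<lambda>x. w (P x))"
  proof -
    have "(\<Lambda> * B)-lipschitz_on UNIV (\<lambda>x. w (P x))"
      by (rule lipschitz_onI) (use wP \<Lambda> B in \<open>auto simp: dist_norm\<close>)
    then show ?thesis by (rule lipschitz_on_continuous_on)
  qed
  have [measurable]: "(\<lambda>x. w (P x)) \<in> borel_measurable borel" using cwP by (rule borel_measurable_continuous_onI)
  have leb: "f \<in> borel_measurable borel \<Longrightarrow> f \<in> borel_measurable (lebesgue_on \<Omega>)" for f :: "real^'n \<Rightarrow> real"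
    by (intro measurable_restrict_space1 measurable_completion) simp
  have dm: "d \<in> borel_measurable (lebesgue_on \<Omega>)"
    by (rule leb) (unfold d_def ramp_deriv_def, measurable)
  \<comment> \<open>Points of K moved along e by at most \<delta> + \<tau> \<le> 2 \<tau>; it
    contains the support of \<zeta>, and hypothesis \<open>K\<Omega>\<close> places it inside
    \<Omega>.\<close>
  define K' where "K' = (\<lambda>(p, t). p + t *\<^sub>R e) ` (K \<times> {0..2 * \<tau>})"
  have "compact K'" unfolding K'_def
    by (intro compact_continuous_image compact_Times K(1) compact_Icc)
      (auto intro!: continuous_intros simp: split_beta)
  have "K' \<subseteq> \<Omega>" using K\<Omega> by (auto simp: K'_def)
  have z: "\<zeta> x = 0" if "x \<notin> K'" for x
  proof (rule ccontr)
    assume "\<zeta> x \<noteq> 0"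
    then have 1: "w (P x) \<noteq> 0" "?h x \<noteq> 0" by (auto simp: \<zeta>_def)
    have "P x \<in> K" using K(2)[OF aP] 1(1) by blast
    moreover have "0 \<le> a \<bullet> x - s" "a \<bullet> x - s \<le> 2 * \<tau>"
      using 1(2) ramp_values(1,4)[OF \<delta>, of "a \<bullet> x - s"] \<delta> by linarith+
    moreover have "x = P x + (a \<bullet> x - s) *\<^sub>R e" by (simp add: P_def)
    ultimately have "x \<in> K'" unfolding K'_def by (intro image_eqI[of _ _ "(P x, a \<bullet> x - s)"]) auto
    with that show False by blast
  qed
  have Lip: "\<bar>\<zeta> x - \<zeta> y\<bar> \<le> (\<Lambda> * B * \<delta> + W * norm a) * norm (x - y)" for x y
  proof -
    have "\<zeta> x - \<zeta> y = (w (P x) - w (P y)) * ?h x + w (P y) * (?h x - ?h y)"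
      by (simp add: \<zeta>_def algebra_simps)
    then have "\<bar>\<zeta> x - \<zeta> y\<bar> \<le> \<bar>w (P x) - w (P y)\<bar> * ?h x + w (P y) * \<bar>?h x - ?h y\<bar>"
      using abs_triangle_ineq[of "(w (P x) - w (P y)) * ?h x" "w (P y) * (?h x - ?h y)"] hb w0
      by (simp add: abs_mult)
    also have "\<dots> \<le> (\<Lambda> * B * norm (x - y)) * \<delta> + W * (norm a * norm (x - y))"
    proof (intro add_mono mult_mono wP hb W aP)
      have "\<bar>?h x - ?h y\<bar> \<le> \<bar>a \<bullet> (x - y)\<bar>"
        using ramp_lipschitz[OF \<delta>, of "a \<bullet> x - s" "a \<bullet> y - s"] by (simp add: inner_diff_right)
      then show "\<bar>?h x - ?h y\<bar> \<le> norm a * norm (x - y)" using Cauchy_Schwarz_ineq2[of a "x - y"] by linarith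
    qed (use \<Lambda> B W0 in auto)
    finally show ?thesis by (simp add: algebra_simps)
  qed
  have tang: "\<bar>\<zeta> (x + t *\<^sub>R v) - \<zeta> x\<bar> \<le> (\<Lambda> * \<delta>) * norm v * t" if "v \<bullet> a = 0" "0 < t" for x v t
  proof -
    have av: "a \<bullet> (x + t *\<^sub>R v) = a \<bullet> x" using that(1) by (simp add: inner_add_right inner_commute)
    then have "P (x + t *\<^sub>R v) - P x = t *\<^sub>R v" by (simp add: P_def)
    then have "\<bar>w (P (x + t *\<^sub>R v)) - w (P x)\<bar> \<le> \<Lambda> * (norm v * t)"
      using wL[of "P (x + t *\<^sub>R v)" "P x"] that(2) by (simp add: mult.commute)
    then have "\<bar>w (P (x + t *\<^sub>R v)) - w (P x)\<bar> * ?h x \<le> \<Lambda> * (norm v * t) * \<delta>"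
      using hb \<Lambda> that by (intro mult_mono) auto
    moreover have "\<zeta> (x + t *\<^sub>R v) - \<zeta> x = (w (P (x + t *\<^sub>R v)) - w (P x)) * ?h x"
      by (simp only: \<zeta>_def av left_diff_distrib)
    ultimately show ?thesis using hb by (simp add: abs_mult mult_ac)
  qed
  \<comment> \<open>As P is constant along e, the increment of \<zeta> along e is exactly w(P z)
    times that of the ramp; off the corners the only error is the change from w(P z) to w(P x),
    controlled by the Lipschitz bound.\<close>
  have strict: "\<exists>\<kappa>>0. \<forall>z\<in>cball x \<kappa>. \<forall>t. 0 < t \<and> t < \<kappa> \<longrightarrow> \<bar>\<zeta> (z + t *\<^sub>R e) - \<zeta> z - t * d x\<bar> \<le> \<eta> * t"
    if x: "a \<bullet> x - s \<notin> {0, \<delta>, \<delta> + \<tau>}" and \<eta>: "\<eta> > 0" for x \<eta>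
  proof -
    obtain \<kappa> where \<kappa>: "\<kappa> > 0"
      "\<And>t1 t2. \<bar>t1 - (a \<bullet> x - s)\<bar> < \<kappa> \<Longrightarrow> \<bar>t2 - (a \<bullet> x - s)\<bar> < \<kappa> \<Longrightarrow>
          ramp \<delta> \<tau> t2 - ramp \<delta> \<tau> t1 = ramp_deriv \<delta> \<tau> (a \<bullet> x - s) * (t2 - t1)"
      using ramp_locally_affine[OF \<delta> x] by metis
    \<comment> \<open>The first bound keeps the heights of z and z + t e within \<kappa> of that of
      x, away from the corners of the ramp; the second makes the Lipschitz error at most
      \<eta>.\<close>
    define k where "k = min (\<kappa> / (2 * (norm a + 1))) (\<eta> / (\<Lambda> * B + 1))"
    have na: "norm a + 1 > 0" and LB: "\<Lambda> * B + 1 > 0" "\<Lambda> * B \<ge> 0"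
      using \<Lambda> B norm_ge_zero[of a] by (auto simp del: norm_ge_zero intro: add_nonneg_pos)
    have k: "k > 0" "k * (norm a + 1) \<le> \<kappa> / 2" "k * (\<Lambda> * B + 1) \<le> \<eta>"
    proof -
      show "k > 0" using \<kappa> \<eta> na LB by (simp add: k_def)
      have "k * (norm a + 1) \<le> \<kappa> / (2 * (norm a + 1)) * (norm a + 1)"
        using na by (intro mult_right_mono) (auto simp: k_def)
      moreover have "\<kappa> / (2 * m) * m = \<kappa> / 2" if "m > 0" for m using that by simp
      ultimately show "k * (norm a + 1) \<le> \<kappa> / 2" using na by metis
      have "k * (\<Lambda> * B + 1) \<le> \<eta> / (\<Lambda> * B + 1) * (\<Lambda> * B + 1)"
        using LB by (intro mult_right_mono) (auto simp: k_def)
      then show "k * (\<Lambda> * B + 1) \<le> \<eta>" using LB by simp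
    qed
    show ?thesis
    proof (intro exI[of _ k] conjI ballI allI impI k(1))
      fix z t assume zt: "z \<in> cball x k" "0 < t \<and> t < k"
      have nz: "norm (z - x) \<le> k" using zt by (simp add: dist_norm norm_minus_commute)
      have "\<bar>a \<bullet> z - a \<bullet> x\<bar> \<le> norm a * k"
        using Cauchy_Schwarz_ineq2[of a "z - x"] mult_left_mono[OF nz norm_ge_zero[of a]]
        by (simp add: inner_diff_right)
      moreover have "norm a * k + k \<le> \<kappa> / 2" using k(2) by (simp add: algebra_simps)
      ultimately have "\<bar>(a \<bullet> z - s) - (a \<bullet> x - s)\<bar> < \<kappa>" "\<bar>(a \<bullet> z - s + t) - (a \<bullet> x - s)\<bar> < \<kappa>"
        using zt k(1) \<kappa>(1) by linarith+
      from \<kappa>(2)[OF this] have h: "ramp \<delta> \<tau> (a \<bullet> z - s + t) - ?h z = ramp_deriv \<delta> \<tau> (a \<bullet> x - s) * t" by simp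
      have ez: "a \<bullet> (z + t *\<^sub>R e) - s = a \<bullet> z - s + t" using ae by (simp add: inner_add_right)
      have "P (z + t *\<^sub>R e) = P z" using ae by (simp add: P_def inner_add_right algebra_simps)
      then have "\<zeta> (z + t *\<^sub>R e) - \<zeta> z - t * d x = w (P z) * (ramp \<delta> \<tau> (a \<bullet> z - s + t) - ?h z) - t * d x"
        unfolding \<zeta>_def ez by (simp add: right_diff_distrib)
      also have "\<dots> = t * (ramp_deriv \<delta> \<tau> (a \<bullet> x - s) * (w (P z) - w (P x)))"
        unfolding h d_def by (simp add: algebra_simps)
      also have "\<bar>\<dots>\<bar> \<le> t * (1 * (\<Lambda> * B * norm (z - x)))"
        unfolding abs_mult using zt by (intro mult_mono wP ramp_deriv_bound \<delta>) auto
      also have "\<dots> \<le> t * \<eta>"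
      proof -
        have "\<Lambda> * B * norm (z - x) \<le> \<Lambda> * B * k" using nz LB by (intro mult_left_mono) auto
        then have "\<Lambda> * B * norm (z - x) \<le> \<eta>" using k(1,3) by (simp add: algebra_simps)
        then show ?thesis using zt by simp
      qed
      finally show "\<bar>\<zeta> (z + t *\<^sub>R e) - \<zeta> z - t * d x\<bar> \<le> \<eta> * t" by (simp add: mult.commute)
    qed
  qed
  have AE: "AE x in lebesgue_on \<Omega>. a \<bullet> x - s \<notin> {0, \<delta>, \<delta> + \<tau>}"
  proof -
    have "AE x in lebesgue. a \<bullet> x \<noteq> c" for c
      using AE_not_in[of "{x. a \<bullet> x = c}" lebesgue] negligible_hyperplane[of a c] a0
      by (auto simp: negligible_iff_null_sets)
    from this[of s] this[of "s + \<delta>"] this[of "s + (\<delta> + \<tau>)"]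
    have "AE x in lebesgue. x \<in> \<Omega> \<longrightarrow> a \<bullet> x - s \<notin> {0, \<delta>, \<delta> + \<tau>}"
      by eventually_elim auto
    then show ?thesis using \<Omega> by (subst AE_restrict_space_iff) auto
  qed
  have main: "\<bar>LINT x|lebesgue_on \<Omega>. (F x \<bullet> a) * d x\<bar> \<le> \<Lambda> * \<delta> * (LINT x|lebesgue_on \<Omega>. norm (F x - (F x \<bullet> a) *\<^sub>R e))"
  proof (rule div_free_Lipschitz_test[OF \<Omega> F Lip \<open>compact K'\<close> \<open>K' \<subseteq> \<Omega>\<close> z ae dm _ tang])
    show "AE x in lebesgue_on \<Omega>. \<forall>\<eta>>0. \<exists>\<kappa>>0. \<forall>z\<in>cball x \<kappa>. \<forall>t. 0 < t \<and> t < \<kappa> \<longrightarrow>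
        \<bar>\<zeta> (z + t *\<^sub>R e) - \<zeta> z - t * d x\<bar> \<le> \<eta> * t"
      using AE by (rule eventually_mono) (use strict in blast)
  qed
  have "(LINT x|lebesgue_on \<Omega>. norm (F x - (F x \<bullet> a) *\<^sub>R e)) \<le> (LINT x|lebesgue_on \<Omega>. B * norm (F x))"
  proof (rule integral_mono)
    show "integrable (lebesgue_on \<Omega>) (\<lambda>x. norm (F x - (F x \<bullet> a) *\<^sub>R e))"
      using F(1) by (intro integrable_norm Bochner_Integration.integrable_diff integrable_scaleR_left) auto
    show "norm (F x - (F x \<bullet> a) *\<^sub>R e) \<le> B * norm (F x)" for x
      using norm_oblique_proj_le[of "F x" a e] by (simp add: B_def inner_commute)
  qed (use F(1) in simp)
  then have "\<Lambda> * \<delta> * (LINT x|lebesgue_on \<Omega>. norm (F x - (F x \<bullet> a) *\<^sub>R e)) \<le> \<Lambda> * \<delta> * (B * ?N)"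
    using \<Lambda> \<delta> by (intro mult_left_mono) auto
  with main have 1: "\<bar>LINT x|lebesgue_on \<Omega>. (F x \<bullet> a) * d x\<bar> \<le> \<Lambda> * \<delta> * (B * ?N)" by linarith
  \<comment> \<open>The derivative d is the rising part \<open>?u\<close>, which is to be estimated,
    minus the descending part \<open>?v\<close>, which is small by its factor
    \<delta>/\<tau>.\<close>
  let ?u = "\<lambda>x. indicator {x. s \<le> a \<bullet> x \<and> a \<bullet> x < s + \<delta>} x * w (P x)"
  let ?v = "\<lambda>x. (\<delta> / \<tau>) * indicator {x. s + \<delta> \<le> a \<bullet> x \<and> a \<bullet> x < s + \<delta> + \<tau>} x * w (P x)"
  have iFa: "integrable (lebesgue_on \<Omega>) (\<lambda>x. F x \<bullet> a)" using F(1) by simp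
  have "\<bar>?u x\<bar> \<le> W" for x using w0[of "P x"] W[OF aP, of x] W0 by (auto simp: indicator_def)
  moreover have "?u \<in> borel_measurable (lebesgue_on \<Omega>)" by (rule leb) measurable
  ultimately have u: "integrable (lebesgue_on \<Omega>) (\<lambda>x. (F x \<bullet> a) * ?u x)"
    using integrable_mult_bounded(1)[OF iFa] by blast
  have vb: "\<bar>?v x\<bar> \<le> \<delta> / \<tau> * W" for x
    using w0[of "P x"] W[OF aP, of x] W0 \<delta> by (auto simp: indicator_def abs_mult intro!: divide_right_mono mult_left_mono)
  have vm: "?v \<in> borel_measurable (lebesgue_on \<Omega>)" by (rule leb) measurable
  note v = integrable_mult_bounded[OF iFa vm vb]
  have "d x = ?u x - ?v x" for x
    unfolding d_def ramp_deriv_def using \<delta> by (auto simp: indicator_def)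
  then have "(LINT x|lebesgue_on \<Omega>. (F x \<bullet> a) * d x) = (LINT x|lebesgue_on \<Omega>. (F x \<bullet> a) * ?u x) - (LINT x|lebesgue_on \<Omega>. (F x \<bullet> a) * ?v x)"
    using u v(1) by (simp add: right_diff_distrib)
  then have "\<bar>LINT x|lebesgue_on \<Omega>. (F x \<bullet> a) * ?u x\<bar> \<le> \<Lambda> * \<delta> * (B * ?N) + \<delta> / \<tau> * W * (LINT x|lebesgue_on \<Omega>. \<bar>F x \<bullet> a\<bar>)"
    using 1 v(2) by linarith
  also have "(LINT x|lebesgue_on \<Omega>. \<bar>F x \<bullet> a\<bar>) \<le> (LINT x|lebesgue_on \<Omega>. norm a * norm (F x))"
    by (rule integral_mono) (use F(1) Cauchy_Schwarz_ineq2 in \<open>auto simp: mult.commute[of "norm a"]\<close>)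
  then have "\<Lambda> * \<delta> * (B * ?N) + \<delta> / \<tau> * W * (LINT x|lebesgue_on \<Omega>. \<bar>F x \<bullet> a\<bar>) \<le> \<Lambda> * \<delta> * (B * ?N) + \<delta> / \<tau> * W * (norm a * ?N)"
    using \<delta> W0 by (intro add_left_mono mult_left_mono) auto
  also have "\<dots> = \<delta> * (B * \<Lambda> + norm a * W / \<tau>) * ?N"
    using \<delta> by (simp add: field_simps)
  finally show ?thesis by (simp add: B_def P_def)
qed

section \<open>The local estimate\<close>

lemma uniformly_continuous_compact_support:
  fixes f :: "'a::euclidean_space \<Rightarrow> real"
  assumes f: "continuous_on UNIV f" and K: "\<And>x. x \<notin> cball 0 R \<Longrightarrow> f x = 0" and \<eta>: "\<eta> > 0"
  obtains \<delta> where "\<delta> > 0" "\<And>x y. norm (x - y) < \<delta> \<Longrightarrow> \<bar>f x - f y\<bar> \<le> \<eta>"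
proof -
  have "uniformly_continuous_on (cball 0 (R + 1)) f"
    by (intro compact_uniformly_continuous continuous_on_subset[OF f]) auto
  then obtain d where d: "d > 0" "\<And>x y. x \<in> cball 0 (R + 1) \<Longrightarrow> y \<in> cball 0 (R + 1) \<Longrightarrow> dist y x < d \<Longrightarrow> dist (f y) (f x) < \<eta>"
    using \<eta> unfolding uniformly_continuous_on_def by metis
  show ?thesis
  proof (rule that[of "min d 1"])
    fix x y :: 'a assume xy: "norm (x - y) < min d 1"
    show "\<bar>f x - f y\<bar> \<le> \<eta>"
    proof (cases "x \<in> cball 0 R \<or> y \<in> cball 0 R")
      case True
      then have "x \<in> cball 0 (R + 1)" "y \<in> cball 0 (R + 1)"
        using xy norm_triangle_sub[of x y] norm_triangle_sub[of y x] by (auto simp: norm_minus_commute)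
      then show ?thesis using d(2)[of y x] xy by (simp add: dist_norm)
    next
      case False
      then show ?thesis using K \<eta> by auto
    qed
  qed (use d in auto)
qed

text \<open>The functional a is parallel to coordinate axis i and normalised by a . e = 1; hence its
  level sets are coordinate hyperplanes, F . a = F_i / e_i, and a . x measures the displacement
  along e. The parameters n, a and N are abbreviations fixed by equations.\<close>

locale slab_setting =
  fixes \<Omega> :: "(real^'n) set" and F :: "real^'n \<Rightarrow> real^'n" and i :: 'n and e :: "real^'n"
    and \<tau> R :: real and n :: nat and a :: "real^'n" and N :: real
  assumes n_def: "n = CARD('n)" and a_def: "a = axis i (1 / e $ i)"
    and N_def: "N = (LINT x|lebesgue_on \<Omega>. norm (F x))"
  assumes n2: "n \<ge> 2" and \<Omega>: "open \<Omega>" and F: "integrable (lebesgue_on \<Omega>) F" "div_free_on \<Omega> F"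
    and ei: "e $ i \<noteq> 0" and \<tau>: "\<tau> > 0" and R: "R > 0"
begin

lemma inner_a: "a \<bullet> x = x $ i / e $ i" for x
  by (simp add: a_def inner_axis' )

lemma ae: "a \<bullet> e = 1" using ei by (simp add: inner_a)

lemma N_nonneg: "N \<ge> 0" by (simp add: N_def)

definition slab :: "real \<Rightarrow> real \<Rightarrow> (real^'n) set" where
  "slab s \<delta> = {x. s \<le> a \<bullet> x \<and> a \<bullet> x < s + \<delta>}"

definition oblique :: "real \<Rightarrow> real^'n \<Rightarrow> real^'n" where
  "oblique s x = x - (a \<bullet> x - s) *\<^sub>R e"

text \<open>Equals |e_i| \<delta> times the (n-1)-dimensional integral of |g|^n over the slice at
  height s; heights are measured by a, so the slice is x_i = s e_i.\<close>

definition slice_energy :: "(real^'n \<Rightarrow> real^'n) \<Rightarrow> real \<Rightarrow> real \<Rightarrow> real" where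
  "slice_energy g s \<delta> = (LINT x|lborel. indicator (slab s \<delta>) x * norm (g (slice_proj i (s * e $ i) x)) ^ n)"

lemma slab_borel[measurable]: "slab s \<delta> \<in> sets borel"
  unfolding slab_def by measurable

lemma integrable_slice_energy:
  assumes "continuous_on UNIV g" "compact K" "\<And>x. x \<notin> K \<Longrightarrow> g x = 0"
  shows "integrable lborel (\<lambda>x. indicator (slab s \<delta>) x * norm (g (slice_proj i (s * e $ i) x)) ^ n)"
proof -
  let ?lo = "min (s * e $ i) ((s + \<delta>) * e $ i)" and ?hi = "max (s * e $ i) ((s + \<delta>) * e $ i)"
  have c: "continuous_on UNIV (\<lambda>x. norm (g x) ^ n)" by (intro continuous_intros assms)
  have "integrable lborel (\<lambda>x. indicator {x. ?lo \<le> x $ i \<and> x $ i \<le> ?hi} x * norm (g (slice_proj i (s * e $ i) x)) ^ n)"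
    by (rule integrable_slab[OF c assms(2)]) (use assms(3) n2 in auto)
  then have "integrable lborel (\<lambda>x. indicator (slab s \<delta>) x *\<^sub>R
      (indicator {x. ?lo \<le> x $ i \<and> x $ i \<le> ?hi} x * norm (g (slice_proj i (s * e $ i) x)) ^ n))"
    by (intro integrable_mult_indicator) simp_all
  moreover have "slab s \<delta> \<subseteq> {x. ?lo \<le> x $ i \<and> x $ i \<le> ?hi}"
  proof
    fix x assume "x \<in> slab s \<delta>"
    then have "s \<le> x $ i / e $ i" "x $ i / e $ i < s + \<delta>" by (auto simp: slab_def inner_a)
    then show "x \<in> {x. ?lo \<le> x $ i \<and> x $ i \<le> ?hi}"
      using ei by (cases "e $ i > 0") (auto simp: pos_le_divide_eq pos_divide_less_eq neg_le_divide_eq neg_divide_less_eq not_less min_le_iff_disj le_max_iff_disj)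
  qed
  then have "(\<lambda>x. indicator (slab s \<delta>) x *\<^sub>R
      (indicator {x. ?lo \<le> x $ i \<and> x $ i \<le> ?hi} x * norm (g (slice_proj i (s * e $ i) x)) ^ n)) =
      (\<lambda>x. indicator (slab s \<delta>) x * norm (g (slice_proj i (s * e $ i) x)) ^ n)"
    by (auto simp: indicator_def fun_eq_iff)
  ultimately show ?thesis by simp
qed

lemma leb_measurable: "f \<in> borel_measurable borel \<Longrightarrow> f \<in> borel_measurable (lebesgue_on \<Omega>)" for f :: "real^'n \<Rightarrow> real"
  by (intro measurable_restrict_space1 measurable_completion) simp

lemma continuous_on_oblique: "continuous_on UNIV (oblique s)"
  unfolding oblique_def by (intro continuous_intros)

text \<open>The positive part of \<phi>, extended from the base slice along e, is replaced by its
  inf-convolution w. The difference, at most E, is paid against the mass of F in the slab, and w is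
  handled by \<open>slab_estimate\<close>. Here L is \<delta> times the Lipschitz constant, so that
  \<delta> cancels and only the slice energy remains.\<close>

lemma slab_bound:
  assumes \<phi>: "\<And>x. (\<phi> has_derivative (\<lambda>v. g x \<bullet> v)) (at x)" and g: "continuous_on UNIV g"
    and K: "compact K" "\<And>x. x \<notin> K \<Longrightarrow> \<phi> x = 0" "K \<subseteq> cball 0 R"
    and K\<Omega>: "\<And>p t. p \<in> K \<Longrightarrow> 0 \<le> t \<Longrightarrow> t \<le> 2 * \<tau> \<Longrightarrow> p + t *\<^sub>R e \<in> \<Omega>"
    and D: "D > 0" and \<delta>: "0 < \<delta>" "\<delta> \<le> \<tau>"
    and E: "E = 2 * real n * D"
    and L: "L = 4 * real n ^ (n + 1) / (D ^ (n - 1) * \<bar>e $ i\<bar>) * slice_energy g s \<delta>"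
  shows "\<bar>LINT x|lebesgue_on \<Omega>. (F x \<bullet> a) * (indicator (slab s \<delta>) x * max 0 (\<phi> (oblique s x)))\<bar>
    \<le> norm a * E * (LINT x|lebesgue_on \<Omega>. indicator (slab s \<delta>) x * norm (F x))
      + ((1 + norm a * norm e) * L + norm a * (\<delta> * E + L * (2 * R + 1)) / \<tau>) * N"
proof -
  let ?s = "s * e $ i"
  define H where "H = {y. a \<bullet> y = s}"
  have H: "y \<in> H \<longleftrightarrow> y $ i = ?s" for y using ei by (auto simp: H_def inner_a field_simps)
  have ob: "oblique s x \<in> H" for x using ae by (simp add: H_def oblique_def inner_diff_right)
  have goff: "g x = 0" if "x \<notin> K" for x by (rule gradient_off_support[OF K(1,2) \<phi> that])
  define G where "G = slice_energy g s \<delta>"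
  define \<Lambda> where "\<Lambda> = L / \<delta>"
  \<comment> \<open>The middle half of the slab, a closed range of x_i inside the half-open slab for
    either sign of e_i. Its length |e_i| \<delta> / 2 turns the factor 2 of
    \<open>morrey_slice\<close> into the 4 in L.\<close>
  define lo where "lo = min (e $ i * (s + \<delta> / 4)) (e $ i * (s + 3 * \<delta> / 4))"
  define hi where "hi = max (e $ i * (s + \<delta> / 4)) (e $ i * (s + 3 * \<delta> / 4))"
  have hl: "hi - lo = \<bar>e $ i\<bar> * \<delta> / 2"
    unfolding hi_def lo_def max_def min_def using \<delta> ei by (auto simp: abs_if field_simps)
  then have lh: "lo < hi" using \<delta> ei by (simp add: field_simps) (smt (verit) divide_pos_pos mult_pos_pos zero_less_abs_iff)
  have G0: "0 \<le> G" unfolding G_def slice_energy_def by (intro integral_nonneg_AE) auto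
  have L0: "0 \<le> L" unfolding L G_def[symmetric] using G0 D ei by simp
  have \<Lambda>0: "0 \<le> \<Lambda>" using L0 \<delta> by (simp add: \<Lambda>_def)
  have GG: "(LINT x|lborel. indicator {x. lo \<le> x $ i \<and> x $ i \<le> hi} x * norm (g (slice_proj i ?s x)) ^ CARD('n)) \<le> G"
    unfolding G_def slice_energy_def n_def[symmetric]
  proof (rule integral_mono)
    have c: "continuous_on UNIV (\<lambda>x. norm (g x) ^ n)" by (intro continuous_intros g)
    show "integrable lborel (\<lambda>x. indicator {x. lo \<le> x $ i \<and> x $ i \<le> hi} x * norm (g (slice_proj i ?s x)) ^ n)"
      by (rule integrable_slab[OF c K(1)]) (use goff n2 in auto)
    show "integrable lborel (\<lambda>x. indicator (slab s \<delta>) x * norm (g (slice_proj i ?s x)) ^ n)"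
      by (rule integrable_slice_energy[OF g K(1) goff])
    have "{x. lo \<le> x $ i \<and> x $ i \<le> hi} \<subseteq> slab s \<delta>"
    proof
      fix x assume x: "x \<in> {x. lo \<le> x $ i \<and> x $ i \<le> hi}"
      have "s + \<delta> / 4 \<le> x $ i / e $ i \<and> x $ i / e $ i \<le> s + 3 * \<delta> / 4"
      proof (cases "e $ i > 0")
        case True
        have "e $ i * (s + \<delta> / 4) \<le> e $ i * (s + 3 * \<delta> / 4)" using True \<delta> by (intro mult_left_mono) auto
        then have "e $ i * (s + \<delta> / 4) \<le> x $ i" "x $ i \<le> e $ i * (s + 3 * \<delta> / 4)" using x by (auto simp: lo_def hi_def)
        then show ?thesis using True by (simp add: pos_le_divide_eq pos_divide_le_eq mult.commute)
      next
        case False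
        then have neg: "e $ i < 0" using ei by simp
        have "e $ i * (s + 3 * \<delta> / 4) \<le> e $ i * (s + \<delta> / 4)" using neg \<delta> by (intro mult_left_mono_neg) auto
        then have "e $ i * (s + 3 * \<delta> / 4) \<le> x $ i" "x $ i \<le> e $ i * (s + \<delta> / 4)" using x by (auto simp: lo_def hi_def)
        then show ?thesis using neg by (simp add: neg_le_divide_eq neg_divide_le_eq mult.commute)
      qed
      then show "x \<in> slab s \<delta>" using \<delta> unfolding slab_def inner_a by simp
    qed
    then show "indicator {x. lo \<le> x $ i \<and> x $ i \<le> hi} x * norm (g (slice_proj i ?s x)) ^ n
      \<le> indicator (slab s \<delta>) x * norm (g (slice_proj i ?s x)) ^ n" for x
      by (intro mult_right_mono) (auto simp: indicator_def)
  qed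
  have mor: "\<phi> y - \<phi> z \<le> E + \<Lambda> * norm (y - z)" if "y \<in> H" "z \<in> H" for y z
  proof -
    have "\<phi> y - \<phi> z \<le> 2 * real n * D + 2 * real n ^ (n + 1) * norm (y - z) * G / (D ^ (n - 1) * (hi - lo))"
      using morrey_slice[OF \<phi> g K(1) goff lh D GG, of y z] that by (simp add: H n_def)
    also have "2 * real n ^ (n + 1) * norm (y - z) * G / (D ^ (n - 1) * (hi - lo)) = \<Lambda> * norm (y - z)"
      unfolding hl \<Lambda>_def L G_def[symmetric] by (simp add: mult_ac)
    finally show ?thesis by (simp add: E)
  qed
  have E0: "0 \<le> E" using D by (simp add: E)
  define u where "u y = max 0 (\<phi> y)" for y
  have "H \<noteq> {}" using ob by blast
  then obtain w where w: "\<And>y. 0 \<le> w y" "\<And>y. y \<in> H \<Longrightarrow> w y \<le> u y" "\<And>y. y \<in> H \<Longrightarrow> u y \<le> w y + E"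
    "\<And>y z. \<bar>w y - w z\<bar> \<le> \<Lambda> * norm (y - z)"
  proof (rule inf_convolution[of H u \<Lambda> E])
    show "u y \<le> u z + E + \<Lambda> * norm (y - z)" if "y \<in> H" "z \<in> H" for y z
    proof -
      have "0 \<le> \<Lambda> * norm (y - z)" using \<Lambda>0 by simp
      then show ?thesis using mor[OF that] E0 unfolding u_def by linarith
    qed
  qed (use \<Lambda>0 in \<open>auto simp: u_def\<close>)
  let ?W = "E + \<Lambda> * (2 * R + 1)"
  have W0: "0 \<le> ?W" using E0 \<Lambda>0 R by simp
  have uW: "u y \<le> ?W" if y: "y \<in> H" for y
  proof (cases "y \<in> K")
    case True
    have "\<not> (UNIV :: 'n set) \<subseteq> {i}" using n2 card_mono[of "{i}" "UNIV :: 'n set"] by (auto simp: n_def)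
    then obtain j where j: "j \<noteq> i" by blast
    \<comment> \<open>A point of the same slice beyond the support of \<phi>, reached along a second
      coordinate direction, which exists because n is at least 2. Comparing with \<phi>(z) = 0
      bounds \<phi> on the slice.\<close>
    define z where "z = y + (2 * R + 1) *\<^sub>R axis j 1"
    have nz: "norm (y - z) = 2 * R + 1" using R by (simp add: z_def norm_axis_1)
    have "z \<in> H" using y j by (simp add: H z_def axis_def)
    have "norm y \<le> R" using True K(3) by auto
    then have "norm z > R" using nz R norm_triangle_ineq4[of y z] by linarith
    then have "\<phi> z = 0" using K(2,3) by force
    then have "\<phi> y \<le> ?W" using mor[OF y \<open>z \<in> H\<close>] nz by simp
    then show ?thesis using W0 by (simp add: u_def)
  qed (use K(2) W0 in \<open>simp add: u_def\<close>)
  have iFa: "integrable (lebesgue_on \<Omega>) (\<lambda>x. F x \<bullet> a)" using F(1) by simp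
  have cw: "continuous_on UNIV w"
  proof -
    have "\<Lambda>-lipschitz_on UNIV w"
      by (rule lipschitz_onI) (use w(4) \<Lambda>0 in \<open>auto simp: dist_norm\<close>)
    then show ?thesis by (rule lipschitz_on_continuous_on)
  qed
  have c\<phi>: "continuous_on UNIV \<phi>"
    using \<phi> by (auto intro!: continuous_at_imp_continuous_on has_derivative_continuous)
  have [measurable]: "(\<lambda>x. w (oblique s x)) \<in> borel_measurable borel" "(\<lambda>x. \<phi> (oblique s x)) \<in> borel_measurable borel"
    by (auto intro!: borel_measurable_continuous_onI continuous_on_compose2[OF cw] continuous_on_compose2[OF c\<phi>] continuous_on_oblique)
  let ?u = "\<lambda>x. indicator (slab s \<delta>) x * u (oblique s x)"
  let ?w = "\<lambda>x. indicator (slab s \<delta>) x * w (oblique s x)"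
  have um: "?u \<in> borel_measurable (lebesgue_on \<Omega>)" by (rule leb_measurable) (unfold u_def, measurable)
  have wm: "?w \<in> borel_measurable (lebesgue_on \<Omega>)" by (rule leb_measurable) measurable
  have u0: "0 \<le> u y" for y by (simp add: u_def)
  have wW: "w y \<le> ?W" if "y \<in> H" for y using w(2)[OF that] uW[OF that] by linarith
  have iu: "integrable (lebesgue_on \<Omega>) (\<lambda>x. (F x \<bullet> a) * ?u x)"
    by (rule integrable_mult_bounded(1)[OF iFa um, of ?W]) (use uW[OF ob] u0 W0 in \<open>auto simp: indicator_def\<close>)
  have iw: "integrable (lebesgue_on \<Omega>) (\<lambda>x. (F x \<bullet> a) * ?w x)"
    by (rule integrable_mult_bounded(1)[OF iFa wm, of ?W]) (use wW[OF ob] w(1) W0 in \<open>auto simp: indicator_def\<close>)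
  have 1: "\<bar>LINT x|lebesgue_on \<Omega>. (F x \<bullet> a) * ?w x\<bar> \<le> \<delta> * ((1 + norm a * norm e) * \<Lambda> + norm a * ?W / \<tau>) * N"
    unfolding N_def slab_def oblique_def
  proof (rule slab_estimate[OF \<Omega> F ae \<delta> w(1,4) \<Lambda>0 _ K(1) _ K\<Omega>])
    show "w y \<le> ?W" if "a \<bullet> y = s" for y using wW that by (simp add: H_def)
    show "w y = 0" if "a \<bullet> y = s" "y \<notin> K" for y
      using w(1)[of y] w(2)[of y] that K(2)[of y] by (simp add: H_def u_def)
  qed
  have iI: "integrable (lebesgue_on \<Omega>) (\<lambda>x. indicator (slab s \<delta>) x * norm (F x))"
  proof -
    have m: "(indicator (slab s \<delta>) :: real^'n \<Rightarrow> real) \<in> borel_measurable (lebesgue_on \<Omega>)" by (rule leb_measurable) measurable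
    show ?thesis
      using integrable_mult_bounded(1)[OF integrable_norm[OF F(1)] m, of 1] by (simp add: indicator_def mult.commute)
  qed
  have 2: "\<bar>LINT x|lebesgue_on \<Omega>. (F x \<bullet> a) * (?u x - ?w x)\<bar> \<le> (LINT x|lebesgue_on \<Omega>. norm a * E * (indicator (slab s \<delta>) x * norm (F x)))"
  proof (rule order_trans[OF integral_abs_bound integral_mono])
    show "integrable (lebesgue_on \<Omega>) (\<lambda>x. \<bar>(F x \<bullet> a) * (?u x - ?w x)\<bar>)"
      using iu iw by (simp add: right_diff_distrib)
    show "integrable (lebesgue_on \<Omega>) (\<lambda>x. norm a * E * (indicator (slab s \<delta>) x * norm (F x)))" using iI by simp
    fix x
    have "\<bar>u (oblique s x) - w (oblique s x)\<bar> \<le> E" using w(2,3)[OF ob, of x] E0 by linarith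
    then have "\<bar>F x \<bullet> a\<bar> * \<bar>u (oblique s x) - w (oblique s x)\<bar> \<le> (norm (F x) * norm a) * E"
      by (intro mult_mono Cauchy_Schwarz_ineq2) auto
    then show "\<bar>(F x \<bullet> a) * (?u x - ?w x)\<bar> \<le> norm a * E * (indicator (slab s \<delta>) x * norm (F x))"
      by (auto simp: indicator_def abs_mult mult_ac)
  qed
  have "(LINT x|lebesgue_on \<Omega>. (F x \<bullet> a) * ?u x) = (LINT x|lebesgue_on \<Omega>. (F x \<bullet> a) * (?u x - ?w x)) + (LINT x|lebesgue_on \<Omega>. (F x \<bullet> a) * ?w x)"
    using iu iw by (simp add: right_diff_distrib)
  then have "\<bar>LINT x|lebesgue_on \<Omega>. (F x \<bullet> a) * ?u x\<bar> \<le> norm a * E * (LINT x|lebesgue_on \<Omega>. indicator (slab s \<delta>) x * norm (F x))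
      + \<delta> * ((1 + norm a * norm e) * \<Lambda> + norm a * ?W / \<tau>) * N"
    using 1 2 by simp
  also have "\<delta> * ((1 + norm a * norm e) * \<Lambda> + norm a * ?W / \<tau>) = (1 + norm a * norm e) * L + norm a * (\<delta> * E + L * (2 * R + 1)) / \<tau>"
    using \<delta> \<tau> by (simp add: \<Lambda>_def field_simps)
  finally show ?thesis by (simp add: u_def)
qed

text \<open>The leading \<open>norm a\<close> pays for projecting \<phi> to the bases of the slabs.
  All other terms are twice a slab bound, once for each sign of \<phi>: 2 n comes from E / D, the 8
  in L is the 4 of \<open>slab_bound\<close> times the 2 in the bound 2 D^n for the total slice
  energy, and 2 |a| R + 5 bounds the number of slabs times their width.\<close>

definition local_const :: real where
  "local_const = (let L = 8 * real n ^ (n + 1) / \<bar>e $ i\<bar> in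
     norm a + 4 * real n * norm a + 2 * (1 + norm a * norm e) * L
     + 2 * norm a * (2 * real n * (2 * norm a * R + 5) + L * (2 * R + 1)) / \<tau>)"

text \<open>Summation of \<open>slab_bound\<close> over slabs whose width depends on \<phi> while
  the constant does not. The hypotheses on \<phi> stop at C^1, which is what remains after
  multiplication by a cut-off that is controlled only inside \<Omega>.\<close>

lemma local_estimate:
  assumes \<phi>: "\<And>x. (\<phi> has_derivative (\<lambda>v. g x \<bullet> v)) (at x)" and g: "continuous_on UNIV g"
    and K: "compact K" "\<And>x. x \<notin> K \<Longrightarrow> \<phi> x = 0" "K \<subseteq> cball 0 R"
    and K\<Omega>: "\<And>p t. p \<in> K \<Longrightarrow> 0 \<le> t \<Longrightarrow> t \<le> 2 * \<tau> \<Longrightarrow> p + t *\<^sub>R e \<in> \<Omega>"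
    and D: "D > 0" "(LINT x|lborel. norm (g x) ^ n) \<le> D ^ n"
  shows "\<bar>LINT x|lebesgue_on \<Omega>. (F x \<bullet> a) * \<phi> x\<bar> \<le> local_const * N * D"
proof -
  have goff: "g x = 0" if "x \<notin> K" for x by (rule gradient_off_support[OF K(1,2) \<phi> that])
  have c\<phi>: "continuous_on UNIV \<phi>"
    using \<phi> by (auto intro!: continuous_at_imp_continuous_on has_derivative_continuous)
  have cgn: "continuous_on UNIV (\<lambda>x. norm (g x) ^ n)" by (intro continuous_intros g)
  have R\<phi>: "\<phi> x = 0" and Rg: "norm (g x) ^ n = 0" if "x \<notin> cball 0 R" for x
  proof -
    have "x \<notin> K" using that K(3) by blast
    then show "\<phi> x = 0" "norm (g x) ^ n = 0" using K(2) goff n2 by auto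
  qed
  define V where "V = measure lborel (cball (0::real^'n) (R + 1))"
  \<comment> \<open>Tolerance for two errors: at most D for \<phi> itself, and at most D^n after
    integrating the error in |g|^n over the ball of radius R + 1, whose volume is V.\<close>
  define \<eta> where "\<eta> = min D (D ^ n / (V + 1))"
  have V: "0 \<le> V" by (simp add: V_def)
  have \<eta>: "0 < \<eta>" "\<eta> \<le> D" "\<eta> * V \<le> D ^ n"
  proof -
    show "0 < \<eta>" "\<eta> \<le> D" using D V by (auto simp: \<eta>_def)
    have "\<eta> * V \<le> D ^ n / (V + 1) * V" using V by (intro mult_right_mono) (auto simp: \<eta>_def)
    also have "\<dots> \<le> D ^ n" using V D by (simp add: field_simps)
    finally show "\<eta> * V \<le> D ^ n" .
  qed
  obtain d1 where d1: "d1 > 0" "\<And>x y. norm (x - y) < d1 \<Longrightarrow> \<bar>\<phi> x - \<phi> y\<bar> \<le> \<eta>"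
    using uniformly_continuous_compact_support[OF c\<phi> R\<phi> \<eta>(1)] by blast
  obtain d2 where d2: "d2 > 0" "\<And>x y. norm (x - y) < d2 \<Longrightarrow> \<bar>norm (g x) ^ n - norm (g y) ^ n\<bar> \<le> \<eta>"
    using uniformly_continuous_compact_support[OF cgn Rg \<eta>(1)] by blast
  define d where "d = min d1 (min d2 1)"
  \<comment> \<open>Both the oblique and the orthogonal projection to the base move points of a slab
    by at most \<delta> |e|, which is thereby less than d.\<close>
  define \<delta> where "\<delta> = min \<tau> (min 1 (d / (2 * (norm e + 1))))"
  have d0: "0 < d" using d1 d2 by (simp add: d_def)
  have ne: "0 < norm e + 1" using norm_ge_zero[of e] by linarith
  have \<delta>: "0 < \<delta>" "\<delta> \<le> \<tau>" "\<delta> \<le> 1" "\<delta> * norm e < d"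
  proof -
    show "0 < \<delta>" "\<delta> \<le> \<tau>" "\<delta> \<le> 1" using \<tau> d0 ne by (auto simp: \<delta>_def)
    have "\<delta> * norm e \<le> d / (2 * (norm e + 1)) * (norm e + 1)"
      using ne \<open>0 < \<delta>\<close> d0 by (intro mult_mono) (auto simp: \<delta>_def)
    also have "\<dots> = d / 2" using ne by (simp add: divide_simps)
    finally show "\<delta> * norm e < d" using d0 by simp
  qed
  define S where "S k = slab (of_int k * \<delta>) \<delta>" for k :: int
  define P where "P k = oblique (of_int k * \<delta>)" for k :: int
  define Q where "Q k = slice_proj i (of_int k * \<delta> * e $ i)" for k :: int
  define kk where "kk x = \<lfloor>(a \<bullet> x) / \<delta>\<rfloor>" for x
  have S: "x \<in> S k \<longleftrightarrow> k = kk x" for x k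
  proof -
    have "x \<in> S k \<longleftrightarrow> of_int k \<le> (a \<bullet> x) / \<delta> \<and> (a \<bullet> x) / \<delta> < of_int k + 1"
      using \<delta>(1) by (simp add: S_def slab_def pos_le_divide_eq pos_divide_less_eq distrib_right)
    then show ?thesis unfolding kk_def using floor_eq_iff[of "(a \<bullet> x) / \<delta>" k] by auto
  qed
  have near: "\<bar>a \<bullet> x - of_int k * \<delta>\<bar> \<le> \<delta>" if "x \<in> S k" for x k
  proof -
    have "of_int k * \<delta> \<le> a \<bullet> x \<and> a \<bullet> x < of_int k * \<delta> + \<delta>"
      using that unfolding S_def slab_def by simp
    then show ?thesis unfolding abs_le_iff by linarith
  qed
  have Pd: "norm (x - P k x) < d" if "x \<in> S k" for x k
  proof -
    have "norm (x - P k x) = \<bar>a \<bullet> x - of_int k * \<delta>\<bar> * norm e" by (simp add: P_def oblique_def)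
    also have "\<dots> \<le> \<delta> * norm e" using near[OF that] by (intro mult_right_mono) auto
    finally show ?thesis using \<delta>(4) by linarith
  qed
  have Qd: "norm (x - Q k x) < d" if "x \<in> S k" for x k
  proof -
    have "of_int k * \<delta> * e $ i - x $ i = - (a \<bullet> x - of_int k * \<delta>) * e $ i"
      using ei by (simp add: inner_a left_diff_distrib)
    then have "norm (x - Q k x) = \<bar>a \<bullet> x - of_int k * \<delta>\<bar> * \<bar>e $ i\<bar>"
      by (simp add: Q_def slice_proj_def norm_axis_1 abs_mult abs_minus_commute)
    also have "\<dots> \<le> \<delta> * norm e" using near[OF that] component_le_norm_cart[of e i] by (intro mult_mono) auto
    finally show ?thesis using \<delta>(4) by linarith
  qed
  \<comment> \<open>On K the modulus of a . x is at most |a| R, so the slabs with index from -m to m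
    cover K.\<close>
  define m where "m = \<lceil>norm a * R / \<delta>\<rceil> + 1"
  define I where "I = {-m..m}"
  have m0: "0 \<le> m"   proof -
    have "0 \<le> norm a * R / \<delta>" using R \<delta>(1) by simp
    then have "0 \<le> \<lceil>norm a * R / \<delta>\<rceil>" by linarith
    then show ?thesis by (simp add: m_def)
  qed
  have kI: "kk x \<in> I" if "x \<in> K" for x
  proof -
    have "norm x \<le> R" using that K(3) by auto
    then have "\<bar>a \<bullet> x\<bar> \<le> norm a * R"
      using Cauchy_Schwarz_ineq2[of a x] mult_left_mono[of "norm x" R "norm a"] by simp
    then have "\<bar>(a \<bullet> x) / \<delta>\<bar> \<le> norm a * R / \<delta>" using \<delta>(1) by (simp add: abs_divide divide_right_mono)
    then have "(a \<bullet> x) / \<delta> \<le> norm a * R / \<delta>" "- (norm a * R / \<delta>) \<le> (a \<bullet> x) / \<delta>" by linarith+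
    then show ?thesis unfolding I_def m_def kk_def atLeastAtMost_iff by (intro conjI; linarith)
  qed
  \<comment> \<open>The number of slabs times their width stays bounded for thin slabs; the rounding
    terms cost at most 5 because \<delta> \<le> 1.\<close>
  have card: "real (card I) * \<delta> \<le> 2 * norm a * R + 5"
  proof -
    have "real (card I) = 2 * of_int m + 1" using m0 by (simp add: I_def)
    also have "\<dots> \<le> 2 * (norm a * R / \<delta>) + 5" 
    proof -
      have "2 * (z + 1) + 1 \<le> 2 * c + 5" if "z \<le> c + 1" for z c :: real using that by simp
      then show ?thesis unfolding m_def of_int_add of_int_1 using of_int_ceiling_le_add_one by blast
    qed
    finally have "real (card I) * \<delta> \<le> (2 * (norm a * R / \<delta>) + 5) * \<delta>" using \<delta> by (intro mult_right_mono) auto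
    also have "\<dots> \<le> 2 * norm a * R + 5" using \<delta> by (simp add: distrib_right)
    finally show ?thesis .
  qed
  have sumI: "(\<Sum>k\<in>I. indicator (S k) x * f k) = (if kk x \<in> I then f (kk x) else 0)" for x and f :: "int \<Rightarrow> real"
  proof -
    have "(\<Sum>k\<in>I. indicator (S k) x * f k) = (\<Sum>k\<in>I. if k = kk x then f k else 0)"
      by (intro sum.cong) (auto simp: indicator_def S)
    then show ?thesis by (simp add: I_def)
  qed
  define G where "G k = slice_energy g (of_int k * \<delta>) \<delta>" for k :: int
  \<comment> \<open>A Riemann sum argument: evaluating |g|^n at the base of the slab instead of at x
    costs at most \<eta>, and only on the ball of radius R + 1, since the projection moves points by
    less than 1.\<close>
  have sumG: "(\<Sum>k\<in>I. G k) \<le> 2 * D ^ n"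
  proof -
    have iG: "integrable lborel (\<lambda>x. indicator (S k) x * norm (g (Q k x)) ^ n)" for k
      unfolding S_def Q_def by (rule integrable_slice_energy[OF g K(1) goff])
    have ig: "integrable lborel (\<lambda>x. norm (g x) ^ n)"
      by (rule integrable_compact_support[OF cgn compact_cball Rg])
    have ib: "integrable lborel (\<lambda>x. indicator (cball (0::real^'n) (R + 1)) x *\<^sub>R \<eta>)"
      by (intro borel_integrable_compact) auto
    have "(\<Sum>k\<in>I. G k) = (LINT x|lborel. (\<Sum>k\<in>I. indicator (S k) x * norm (g (Q k x)) ^ n))"
      using iG by (simp add: G_def slice_energy_def S_def Q_def)
    also have "\<dots> \<le> (LINT x|lborel. norm (g x) ^ n + indicator (cball (0::real^'n) (R + 1)) x *\<^sub>R \<eta>)"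
    proof (rule integral_mono)
      fix x :: "real^'n"
      let ?k = "kk x"
      have x: "x \<in> S ?k" by (simp add: S)
      have "norm (g (Q ?k x)) ^ n \<le> norm (g x) ^ n + indicator (cball (0::real^'n) (R + 1)) x *\<^sub>R \<eta>"
      proof (cases "x \<in> cball 0 (R + 1)")
        case True
        then show ?thesis using d2(2)[of x "Q ?k x"] Qd[OF x] by (simp add: d_def)
      next
        case False
        have "Q ?k x \<notin> cball 0 R"
          using False Qd[OF x] norm_triangle_sub[of x "Q ?k x"] by (simp add: d_def)
        then have *: "norm (g (Q ?k x)) ^ n = 0" by (rule Rg)
        show ?thesis unfolding * using \<eta>(1) by simp
      qed
      then show "(\<Sum>k\<in>I. indicator (S k) x * norm (g (Q k x)) ^ n) \<le> norm (g x) ^ n + indicator (cball (0::real^'n) (R + 1)) x *\<^sub>R \<eta>"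
        unfolding sumI using \<eta>(1) by (auto simp: indicator_def)
    qed (use iG ig ib in auto)
    also have "\<dots> = (LINT x|lborel. norm (g x) ^ n) + V * \<eta>"
      using ig ib by (simp add: V_def)
    finally show ?thesis using D(2) \<eta>(3) by (simp add: mult.commute)
  qed
  define E where "E = 2 * real n * D"
  define L where "L k = 4 * real n ^ (n + 1) / (D ^ (n - 1) * \<bar>e $ i\<bar>) * G k" for k
  define L0 where "L0 = 8 * real n ^ (n + 1) / \<bar>e $ i\<bar>"
  have E0: "0 \<le> E" using D by (simp add: E_def)
  \<comment> \<open>Here the weight D^(1-n) of Morrey's inequality meets the total energy 2 D^n and
    leaves one power of D.\<close>
  have sumL: "(\<Sum>k\<in>I. L k) \<le> L0 * D"
  proof -
    have "(\<Sum>k\<in>I. L k) = 4 * real n ^ (n + 1) / (D ^ (n - 1) * \<bar>e $ i\<bar>) * (\<Sum>k\<in>I. G k)"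
      by (simp add: L_def sum_distrib_left)
    also have "\<dots> \<le> 4 * real n ^ (n + 1) / (D ^ (n - 1) * \<bar>e $ i\<bar>) * (2 * D ^ n)"
      using D by (intro mult_left_mono sumG) auto
    also have "D ^ n = D * D ^ (n - 1)" using n2 by (simp add: power_eq_if[of D n])
    finally show ?thesis using D by (simp add: L0_def)
  qed
  let ?nu = "\<lambda>k. LINT x|lebesgue_on \<Omega>. indicator (S k) x * norm (F x)"
  have iI: "integrable (lebesgue_on \<Omega>) (\<lambda>x. indicator (S k) x * norm (F x))" for k
  proof -
    have m: "(indicator (S k) :: real^'n \<Rightarrow> real) \<in> borel_measurable (lebesgue_on \<Omega>)" unfolding S_def by (rule leb_measurable) measurable
    show ?thesis
      using integrable_mult_bounded(1)[OF integrable_norm[OF F(1)] m, of 1] by (simp add: indicator_def mult.commute)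
  qed
  have sumN: "(\<Sum>k\<in>I. ?nu k) \<le> N"
  proof -
    have "(\<Sum>k\<in>I. ?nu k) = (LINT x|lebesgue_on \<Omega>. (\<Sum>k\<in>I. indicator (S k) x * norm (F x)))" using iI by simp
    also have "\<dots> \<le> N" unfolding N_def
    proof (rule integral_mono)
      show "(\<Sum>k\<in>I. indicator (S k) x * norm (F x)) \<le> norm (F x)" for x unfolding sumI by simp
    qed (use F(1) iI in auto)
    finally show ?thesis .
  qed
  define T where "T = norm a * E * N + ((1 + norm a * norm e) * (L0 * D) + norm a * ((2 * norm a * R + 5) * E + L0 * D * (2 * R + 1)) / \<tau>) * N"
  obtain B where B: "B \<ge> 0" "\<And>x. norm (\<phi> x) \<le> B"
    using bounded_compact_support[OF c\<phi> K(1,2)] by blast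
  have iFa: "integrable (lebesgue_on \<Omega>) (\<lambda>x. F x \<bullet> a)" using F(1) by simp
  have mS[measurable]: "S k \<in> sets borel" for k unfolding S_def by measurable
  have mP[measurable]: "(\<lambda>x. \<phi> (P k x)) \<in> borel_measurable borel" for k
    unfolding P_def by (intro borel_measurable_continuous_onI continuous_on_compose2[OF c\<phi>] continuous_on_oblique) auto
  have m\<phi>[measurable]: "\<phi> \<in> borel_measurable borel" using c\<phi> by (rule borel_measurable_continuous_onI)
  \<comment> \<open>Stated for any function whose gradient has the same norm as g, so that it covers
    both \<phi> and its negative.\<close>
  have half: "\<bar>\<Sum>k\<in>I. LINT x|lebesgue_on \<Omega>. (F x \<bullet> a) * (indicator (S k) x * max 0 (\<psi> (P k x)))\<bar> \<le> T"
    if \<psi>: "\<And>x. (\<psi> has_derivative (\<lambda>v. g' x \<bullet> v)) (at x)" "continuous_on UNIV g'" "\<And>x. x \<notin> K \<Longrightarrow> \<psi> x = 0" "\<And>x. norm (g' x) = norm (g x)"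
    for \<psi> g'
  proof -
    have GG: "slice_energy g' (of_int k * \<delta>) \<delta> = G k" for k :: int
      by (simp add: G_def slice_energy_def \<psi>(4))
    have "\<bar>\<Sum>k\<in>I. LINT x|lebesgue_on \<Omega>. (F x \<bullet> a) * (indicator (S k) x * max 0 (\<psi> (P k x)))\<bar> \<le>
      (\<Sum>k\<in>I. norm a * E * ?nu k + ((1 + norm a * norm e) * L k + norm a * (\<delta> * E + L k * (2 * R + 1)) / \<tau>) * N)"
      unfolding S_def P_def
      by (rule order_trans[OF sum_abs sum_mono])
        (rule slab_bound[OF \<psi>(1,2) K(1) \<psi>(3) K(3) K\<Omega> D(1) \<delta>(1,2) E_def], simp_all add: L_def GG)
    also have "\<dots> = norm a * E * (\<Sum>k\<in>I. ?nu k) + ((1 + norm a * norm e) * (\<Sum>k\<in>I. L k)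
        + norm a * ((real (card I) * \<delta>) * E + (\<Sum>k\<in>I. L k) * (2 * R + 1)) / \<tau>) * N"
      by (simp add: sum.distrib sum_distrib_left[symmetric] sum_distrib_right[symmetric] sum_divide_distrib[symmetric] mult.assoc)
    also have "\<dots> \<le> T"
      unfolding T_def using E0 N_nonneg \<tau> R
      by (intro add_mono mult_left_mono mult_right_mono divide_right_mono sumN sumL card) auto
    finally show ?thesis .
  qed
  have h1: "\<bar>\<Sum>k\<in>I. LINT x|lebesgue_on \<Omega>. (F x \<bullet> a) * (indicator (S k) x * max 0 (\<phi> (P k x)))\<bar> \<le> T"
    by (rule half[OF \<phi> g K(2)]) auto
  have h2: "\<bar>\<Sum>k\<in>I. LINT x|lebesgue_on \<Omega>. (F x \<bullet> a) * (indicator (S k) x * max 0 (- \<phi> (P k x)))\<bar> \<le> T"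
  proof (rule half[of "\<lambda>x. - \<phi> x" "\<lambda>x. - g x"])
    show "((\<lambda>x. - \<phi> x) has_derivative (\<lambda>v. - g x \<bullet> v)) (at x)" for x
      using has_derivative_minus[OF \<phi>] by simp
  qed (use K(2) g in \<open>auto intro: continuous_intros\<close>)
  \<comment> \<open>The error of replacing \<phi>(x) by its value at the oblique projection of x to
    the base of its slab.\<close>
  define r where "r x = (\<Sum>k\<in>I. indicator (S k) x * (\<phi> x - \<phi> (P k x)))" for x
  have r\<eta>: "\<bar>r x\<bar> \<le> \<eta>" for x
    unfolding r_def sumI using d1(2)[of x "P (kk x) x"] Pd[of x "kk x"] \<eta>(1) by (auto simp: S d_def)
  have rm: "r \<in> borel_measurable (lebesgue_on \<Omega>)"
    by (rule leb_measurable) (unfold r_def, measurable)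
  note r = integrable_mult_bounded[OF iFa rm r\<eta>]
  have i1: "integrable (lebesgue_on \<Omega>) (\<lambda>x. (F x \<bullet> a) * (indicator (S k) x * max 0 (\<phi> (P k x))))" for k
    by (rule integrable_mult_bounded(1)[OF iFa, of _ B])
      (use B(2)[unfolded real_norm_def] B(1) in \<open>auto intro!: leb_measurable simp: indicator_def max_def abs_le_iff split: if_splits\<close>)
  have i2: "integrable (lebesgue_on \<Omega>) (\<lambda>x. (F x \<bullet> a) * (indicator (S k) x * max 0 (- \<phi> (P k x))))" for k
    by (rule integrable_mult_bounded(1)[OF iFa, of _ B])
      (use B(2)[unfolded real_norm_def] B(1) in \<open>auto intro!: leb_measurable simp: indicator_def max_def abs_le_iff split: if_splits\<close>)
  have dec: "\<phi> x = r x + (\<Sum>k\<in>I. indicator (S k) x * max 0 (\<phi> (P k x))) - (\<Sum>k\<in>I. indicator (S k) x * max 0 (- \<phi> (P k x)))" for x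
    unfolding r_def sumI using kI[of x] K(2)[of x] by (auto simp: max_def)
  have "(F x \<bullet> a) * \<phi> x = (F x \<bullet> a) * r x + (\<Sum>k\<in>I. (F x \<bullet> a) * (indicator (S k) x * max 0 (\<phi> (P k x))))
      - (\<Sum>k\<in>I. (F x \<bullet> a) * (indicator (S k) x * max 0 (- \<phi> (P k x))))" for x
    by (subst dec[of x]) (simp only: distrib_left right_diff_distrib sum_distrib_left)
  then have "(LINT x|lebesgue_on \<Omega>. (F x \<bullet> a) * \<phi> x) = (LINT x|lebesgue_on \<Omega>. (F x \<bullet> a) * r x)
      + (\<Sum>k\<in>I. LINT x|lebesgue_on \<Omega>. (F x \<bullet> a) * (indicator (S k) x * max 0 (\<phi> (P k x))))
      - (\<Sum>k\<in>I. LINT x|lebesgue_on \<Omega>. (F x \<bullet> a) * (indicator (S k) x * max 0 (- \<phi> (P k x))))"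
    using r(1) i1 i2 by simp
  moreover have "\<eta> * (LINT x|lebesgue_on \<Omega>. \<bar>F x \<bullet> a\<bar>) \<le> D * (norm a * N)"
  proof (intro mult_mono \<eta>)
    have "(LINT x|lebesgue_on \<Omega>. \<bar>F x \<bullet> a\<bar>) \<le> (LINT x|lebesgue_on \<Omega>. norm a * norm (F x))"
      by (rule integral_mono) (use F(1) Cauchy_Schwarz_ineq2 in \<open>auto simp: mult.commute[of "norm a"]\<close>)
    then show "(LINT x|lebesgue_on \<Omega>. \<bar>F x \<bullet> a\<bar>) \<le> norm a * N" by (simp add: N_def)
  qed (use D in auto)
  ultimately have "\<bar>LINT x|lebesgue_on \<Omega>. (F x \<bullet> a) * \<phi> x\<bar> \<le> D * (norm a * N) + 2 * T"
    using r(2) h1 h2 by linarith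
  also have "\<dots> = local_const * N * D"
    unfolding local_const_def Let_def L0_def[symmetric] T_def E_def using \<tau> by (simp add: field_simps)
  finally show ?thesis .
qed

end

section \<open>Inward directions at the boundary\<close>

lemma smooth_lipschitz_on_cball:
  fixes g :: "real^'n \<Rightarrow> real"
  assumes "smooth g"
  obtains L where "L \<ge> 0" "\<And>x y. x \<in> cball x0 r \<Longrightarrow> y \<in> cball x0 r \<Longrightarrow> \<bar>g x - g y\<bar> \<le> L * norm (x - y)"
proof -
  have "bounded (grad g ` cball x0 r)"
    by (intro compact_imp_bounded compact_continuous_image continuous_on_subset[OF continuous_on_grad[OF assms]]) auto
  then obtain L where L: "L > 0" "\<And>x. x \<in> cball x0 r \<Longrightarrow> norm (grad g x) \<le> L"
    by (auto simp: bounded_pos)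
  have "norm (g x - g y) \<le> L * norm (x - y)" if "x \<in> cball x0 r" "y \<in> cball x0 r" for x y
  proof (rule differentiable_bound[OF convex_cball _ _ that])
    show "(g has_derivative (\<lambda>v. grad g z \<bullet> v)) (at z within cball x0 r)" for z
      using has_derivative_grad[OF assms] by (rule has_derivative_at_withinI)
    show "onorm (\<lambda>v. grad g z \<bullet> v) \<le> L" if "z \<in> cball x0 r" for z
    proof (rule onorm_le)
      show "norm (grad g z \<bullet> v) \<le> L * norm v" for v
        using Cauchy_Schwarz_ineq2[of "grad g z" v] mult_right_mono[OF L(2)[OF that] norm_ge_zero[of v]] by simp
    qed
  qed
  with L(1) show ?thesis by (intro that[of L]) auto
qed

text \<open>Tilting \<open>\<nu>\<close> slightly keeps the direction inward, because \<open>g\<close> is locally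
  Lipschitz, and makes it transversal to all coordinate hyperplanes.\<close>

lemma inward_direction:
  fixes \<Omega> :: "(real^'n) set"
  assumes \<Omega>: "open \<Omega>" "smooth_boundary \<Omega>" and x0: "x0 \<in> closure \<Omega>"
  shows "\<exists>\<rho> \<tau> e. \<rho> > 0 \<and> \<tau> > 0 \<and> (\<forall>i. e $ i \<noteq> 0) \<and>
    (\<forall>p t. p \<in> \<Omega> \<longrightarrow> p \<in> ball x0 \<rho> \<longrightarrow> 0 \<le> t \<longrightarrow> t \<le> 2 * \<tau> \<longrightarrow> p + t *\<^sub>R e \<in> \<Omega>)"
proof -
  have near: "p + t *\<^sub>R e \<in> ball x0 r" if "r > 0" "p \<in> ball x0 (r / 2)" "0 \<le> t" "t \<le> 2 * (r / (4 * (norm e + 1)))" for p t r and e :: "real^'n"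
  proof -
    have ne: "norm e + 1 > 0" using norm_ge_zero[of e] by linarith
    have "t * norm e \<le> 2 * (r / (4 * (norm e + 1))) * (norm e + 1)"
      using that by (intro mult_mono) auto
    also have "\<dots> = r / 2" using ne by (simp add: divide_simps)
    finally have "norm (t *\<^sub>R e) \<le> r / 2" using that by simp
    moreover have "dist x0 (p + t *\<^sub>R e) \<le> dist x0 p + norm (t *\<^sub>R e)"
      using dist_triangle[of x0 "p + t *\<^sub>R e" p] by (simp add: dist_norm)
    ultimately show ?thesis using that by simp
  qed
  \<comment> \<open>Tilting by \<theta> q adds \<theta> to every coordinate, so only the finitely
    many values \<theta> = -\<nu>_i have to be avoided.\<close>
  define q :: "real^'n" where "q = (\<chi> i. 1)"
  show ?thesis
  proof (cases "x0 \<in> \<Omega>")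
    case True
    then obtain r where r: "r > 0" "ball x0 r \<subseteq> \<Omega>" using \<Omega>(1) open_contains_ball by blast
    show ?thesis
    proof (intro exI conjI allI impI)
      show "r / 2 > 0" "r / (4 * (norm q + 1)) > 0" using r(1) by (auto intro!: divide_pos_pos add_nonneg_pos)
      show "q $ i \<noteq> 0" for i by (simp add: q_def)
      show "p + t *\<^sub>R q \<in> \<Omega>" if "p \<in> ball x0 (r / 2)" "0 \<le> t" "t \<le> 2 * (r / (4 * (norm q + 1)))" for p t
        using near[OF r(1) that] r(2) by blast
    qed
  next
    case False
    then have "x0 \<in> frontier \<Omega>" using x0 \<Omega>(1) by (simp add: frontier_def interior_open)
    then obtain r \<nu> and g :: "real^'n \<Rightarrow> real" where r: "r > 0" and \<nu>: "norm \<nu> = 1" and g: "smooth g"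
      "\<And>x t. g (x + t *\<^sub>R \<nu>) = g x" and eq: "\<Omega> \<inter> ball x0 r = {x \<in> ball x0 r. g x < x \<bullet> \<nu>}"
      using \<Omega>(2) unfolding smooth_boundary_def by meson
    obtain L where L: "L \<ge> 0" "\<And>x y. x \<in> cball x0 r \<Longrightarrow> y \<in> cball x0 r \<Longrightarrow> \<bar>g x - g y\<bar> \<le> L * norm (x - y)"
      using smooth_lipschitz_on_cball[OF g(1)] by blast
    \<comment> \<open>Since g does not change along \<nu>, moving by t e raises g by at most t
      \<theta> L |q|, while x . \<nu> grows by at least t (1 - \<theta> |q|). For \<theta> \<le>
      \<theta>0 the second quantity is not smaller than the first, so the strict epigraph is not
      left.\<close>
    define \<theta>0 where "\<theta>0 = 1 / ((L + 1) * (norm q + 1))"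
    have q0: "norm q + 1 > 0" using norm_ge_zero[of q] by linarith
    have \<theta>0: "\<theta>0 > 0" using L q0 by (simp add: \<theta>0_def)
    have "infinite ({0<..<\<theta>0} - range (\<lambda>i. - \<nu> $ i))"
      using \<theta>0 by (intro Diff_infinite_finite) (auto simp: infinite_Ioo)
    then obtain \<theta> where \<theta>: "0 < \<theta>" "\<theta> < \<theta>0" "\<theta> \<notin> range (\<lambda>i. - \<nu> $ i)"
      by (metis DiffE finite.emptyI ex_in_conv greaterThanLessThan_iff)
    define e where "e = \<nu> + \<theta> *\<^sub>R q"
    have \<theta>q: "\<theta> * ((L + 1) * (norm q + 1)) \<le> 1"
    proof -
      have "\<theta> * ((L + 1) * (norm q + 1)) \<le> \<theta>0 * ((L + 1) * (norm q + 1))"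
        using \<theta> L q0 by (intro mult_right_mono) auto
      then show ?thesis using L q0 by (simp add: \<theta>0_def)
    qed
    have \<theta>q1: "\<theta> * (L * norm q) + \<theta> * norm q \<le> 1"
    proof -
      have "\<theta> * (L * norm q) + \<theta> * norm q \<le> \<theta> * ((L + 1) * (norm q + 1))"
        using \<theta> L by (simp add: algebra_simps)
      then show ?thesis using \<theta>q by linarith
    qed
    have Lq: "0 \<le> \<theta> * (L * norm q)" using \<theta> L by simp
    define \<tau> where "\<tau> = r / (4 * (norm e + 1))"
    have ne: "norm e + 1 > 0" using norm_ge_zero[of e] by linarith
    show ?thesis
    proof (intro exI conjI allI impI)
      show "r / 2 > 0" "\<tau> > 0" using r ne by (auto simp: \<tau>_def)
      show "e $ i \<noteq> 0" for i
      proof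
        assume "e $ i = 0"
        then have "\<theta> = - \<nu> $ i" by (simp add: e_def q_def)
        with \<theta>(3) show False by blast
      qed
      fix p t assume p: "p \<in> \<Omega>" "p \<in> ball x0 (r / 2)" and t: "0 \<le> t" "t \<le> 2 * \<tau>"
      have pe: "p + t *\<^sub>R e \<in> ball x0 r" using near[OF r p(2) t(1)] t(2) by (simp add: \<tau>_def)
      have pr: "p \<in> ball x0 r" using p(2) r by auto
      have t2: "t \<le> r / 2"
      proof -
        have "\<tau> \<le> r / 4" unfolding \<tau>_def using r ne by (intro divide_left_mono) auto
        then show ?thesis using t by linarith
      qed
      have "norm (t *\<^sub>R (\<theta> *\<^sub>R q)) \<le> r / 2"
      proof -
        have "\<theta> * norm q \<le> 1" using \<theta>q1 Lq by linarith
        then have "t * (\<theta> * norm q) \<le> t * 1" using t(1) by (intro mult_left_mono) auto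
        then show ?thesis using t t2 \<theta>(1) by simp
      qed
      moreover have "dist x0 (p + t *\<^sub>R (\<theta> *\<^sub>R q)) \<le> dist x0 p + norm (t *\<^sub>R (\<theta> *\<^sub>R q))"
        using dist_triangle[of x0 "p + t *\<^sub>R (\<theta> *\<^sub>R q)" p] by (simp add: dist_norm)
      ultimately have "p + t *\<^sub>R (\<theta> *\<^sub>R q) \<in> cball x0 r" using p(2) by simp
      then have "g (p + t *\<^sub>R (\<theta> *\<^sub>R q)) - g p \<le> L * norm (t *\<^sub>R (\<theta> *\<^sub>R q))"
        using L(2)[of "p + t *\<^sub>R (\<theta> *\<^sub>R q)" p] pr by simp
      also have "\<dots> = t * (\<theta> * (L * norm q))" using t \<theta> by simp
      finally have "g (p + t *\<^sub>R (\<theta> *\<^sub>R q)) \<le> g p + t * (\<theta> * (L * norm q))" by simp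
      moreover have "g (p + t *\<^sub>R e) = g (p + t *\<^sub>R (\<theta> *\<^sub>R q))"
        using g(2)[of "p + t *\<^sub>R (\<theta> *\<^sub>R q)" t] by (simp add: e_def algebra_simps)
      moreover have "g p < p \<bullet> \<nu>" using p(1) pr eq by blast
      moreover have "p \<bullet> \<nu> + t * (\<theta> * (L * norm q)) \<le> (p + t *\<^sub>R e) \<bullet> \<nu>"
      proof -
        have "- norm q \<le> q \<bullet> \<nu>" using Cauchy_Schwarz_ineq2[of q \<nu>] \<nu> by simp
        then have "\<theta> * - norm q \<le> \<theta> * (q \<bullet> \<nu>)" using \<theta> by (intro mult_left_mono) auto
        then have "\<theta> * (L * norm q) \<le> 1 + \<theta> * (q \<bullet> \<nu>)" using \<theta>q1 by simp
        then have "t * (\<theta> * (L * norm q)) \<le> t * (1 + \<theta> * (q \<bullet> \<nu>))" using t by (intro mult_left_mono)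
        moreover have "\<nu> \<bullet> \<nu> = 1" using \<nu> by (simp add: norm_eq_1)
        ultimately show ?thesis by (simp add: e_def inner_add_left)
      qed
      ultimately have "g (p + t *\<^sub>R e) < (p + t *\<^sub>R e) \<bullet> \<nu>" by linarith
      then show "p + t *\<^sub>R e \<in> \<Omega>" using pe eq by blast
    qed
  qed
qed

section \<open>The Poincare inequality\<close>

text \<open>For n at least 2 this includes the origin, where the quotient is |h|^(n-1); the vectors
  inserted later may vanish.\<close>

lemma has_derivative_norm_power:
  fixes y :: "'a::real_inner"
  assumes "n \<ge> 2"
  shows "((\<lambda>y. norm y ^ n) has_derivative (\<lambda>h. real n * norm y ^ (n - 2) * (y \<bullet> h))) (at y)"
proof (cases "y = 0")
  case True
  have "((\<lambda>h::'a. norm h ^ (n - 1)) \<longlongrightarrow> norm (0::'a) ^ (n - 1)) (at 0)" by (intro tendsto_intros)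
  moreover have "norm (0::'a) ^ (n - 1) = 0" using assms by simp
  moreover have "norm (norm h ^ n) / norm h = norm h ^ (n - 1)" for h :: 'a
    using assms by (cases "h = 0") (auto simp: power_eq_if[of _ n] field_simps)
  ultimately show ?thesis using True assms by (simp add: has_derivative_at power_0_left)
next
  case False
  have e: "real n * norm y ^ (n - 1) * (y \<bullet> h / norm y) = real n * norm y ^ (n - 2) * (y \<bullet> h)" for h
  proof -
    have "norm y ^ (n - 1) = norm y * norm y ^ (n - 2)"
      using assms by (metis One_nat_def Suc_1 Suc_diff_le diff_Suc_Suc power_Suc)
    then show ?thesis using False by simp
  qed
  have "((\<lambda>y. norm y ^ n) has_derivative (\<lambda>h. real n * (sgn y \<bullet> h) * norm y ^ (n - 1))) (at y)"
    using has_derivative_power[OF has_derivative_norm[OF False], of n] by (simp add: mult_ac inner_commute)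
  moreover have "(\<lambda>h. real n * (sgn y \<bullet> h) * norm y ^ (n - 1)) = (\<lambda>h. real n * norm y ^ (n - 2) * (y \<bullet> h))"
    using e by (auto simp: sgn_div_norm fun_eq_iff field_simps)
  ultimately show ?thesis by simp
qed

text \<open>The coefficient 1/2 of p^n is what allows this term to be absorbed in the left-hand side
  of the Poincare inequality.\<close>

lemma young_absorb:
  fixes p q c :: real
  assumes "p \<ge> 0" "q \<ge> 0" "c \<ge> 0" "n \<ge> 1"
  shows "c * (p ^ (n - 1) * q) \<le> p ^ n / 2 + (2 * c) ^ n * q ^ n + c * (2 * c) ^ (n - 1) * q ^ n"
proof (cases "2 * c * q \<le> p")
  case True
  have "c * (p ^ (n - 1) * q) = (c * q) * p ^ (n - 1)" by simp
  also have "\<dots> \<le> (p / 2) * p ^ (n - 1)" using True assms by (intro mult_right_mono) auto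
  also have "\<dots> = p ^ n / 2" using assms(4) by (simp add: power_eq_if)
  finally show ?thesis using assms by (simp add: add_increasing2)
next
  case False
  have "c * (p ^ (n - 1) * q) \<le> c * ((2 * c * q) ^ (n - 1) * q)"
    using False assms by (intro mult_left_mono mult_right_mono power_mono) auto
  also have "\<dots> = c * (2 * c) ^ (n - 1) * (q ^ (n - 1) * q)" by (simp add: power_mult_distrib)
  also have "q ^ (n - 1) * q = q ^ n" using assms(4) by (simp add: power_eq_if)
  finally have "c * (p ^ (n - 1) * q) \<le> c * (2 * c) ^ (n - 1) * q ^ n" .
  then show ?thesis using assms by (simp add: add_increasing)
qed

text \<open>The constants of \<open>young_absorb\<close> for c = R n; the outer factor 2 undoes the
  absorption of one half.\<close>

definition poincare_const :: "nat \<Rightarrow> real \<Rightarrow> real" where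
  "poincare_const n R = 2 * ((2 * (R * real n)) ^ n + R * real n * (2 * (R * real n)) ^ (n - 1))"

lemma norm_column_le:
  fixes A :: "real^'n^'m"
  shows "norm (\<chi> i. A $ i $ j) \<le> norm A"
proof -
  have "(\<Sum>i\<in>UNIV. (A $ i $ j)\<^sup>2) \<le> (\<Sum>i\<in>UNIV. (norm (A $ i))\<^sup>2)"
  proof (rule sum_mono)
    show "(A $ i $ j)\<^sup>2 \<le> (norm (A $ i))\<^sup>2" for i
      using component_le_norm_cart[of "A $ i" j] by (simp add: abs_le_square_iff[symmetric])
  qed
  then show ?thesis by (simp add: norm_vec_def[of "\<chi> i. A $ i $ j"] norm_vec_def[of A] L2_set_def)
qed

text \<open>The derivative of x_j |\<Phi>|^n along axis j has integral zero, so the integral of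
  |\<Phi>|^n is minus that of x_j times the j-th derivative of |\<Phi>|^n. With |x_j| \<le> R on the
  support, Young's inequality absorbs half of it.\<close>

lemma poincare:
  fixes \<Phi> :: "real^'n \<Rightarrow> real^'m"
  assumes n: "n \<ge> 2" and \<Phi>: "smooth \<Phi>" and K: "compact K" "\<And>x. x \<notin> K \<Longrightarrow> \<Phi> x = 0" "K \<subseteq> cball 0 R" and R: "R \<ge> 0"
  shows "(LINT x|lborel. norm (\<Phi> x) ^ n) \<le> poincare_const n R * (LINT x|lborel. norm (jacobian \<Phi> (at x)) ^ n)"
proof -
  \<comment> \<open>Any one coordinate direction will do.\<close>
  obtain j :: 'n where True by blast
  let ?v = "axis j 1 :: real^'n"
  let ?D = "\<lambda>x. frechet_derivative \<Phi> (at x) ?v"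
  define f where "f x = norm (\<Phi> x) ^ n" for x
  define f' where "f' x h = real n * norm (\<Phi> x) ^ (n - 2) * (\<Phi> x \<bullet> frechet_derivative \<Phi> (at x) h)" for x h
  have f: "(f has_derivative f' x) (at x)" for x
    unfolding f_def[abs_def] f'_def[abs_def]
    by (rule has_derivative_compose[OF smooth_has_derivative[OF \<Phi>] has_derivative_norm_power[OF n]])
  note c\<Phi> = smooth_continuous[OF \<Phi>]
  have cD: "continuous_on UNIV ?D" by (rule smooth_continuous[OF smooth_directional[OF \<Phi>]])
  have cf: "continuous_on UNIV f" unfolding f_def[abs_def] by (intro continuous_intros c\<Phi>)
  have cf': "continuous_on UNIV (\<lambda>x. f' x ?v)" unfolding f'_def by (intro continuous_intros c\<Phi> cD)
  have f0: "f x = 0" if "x \<notin> K" for x using K(2)[OF that] n by (simp add: f_def)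
  have f'0: "f' x ?v = 0" if "x \<notin> K" for x using K(2)[OF that] by (simp add: f'_def)
  have der: "((\<lambda>x. (?v \<bullet> x) * f x) has_derivative (\<lambda>h. (?v \<bullet> x) * f' x h + (?v \<bullet> h) * f x)) (at x)" for x
    by (rule has_derivative_mult[OF _ f]) (auto intro!: derivative_eq_intros)
  have c1: "continuous_on UNIV (\<lambda>x. (?v \<bullet> x) * f' x ?v)" by (intro continuous_intros cf')
  have "(LINT x|lborel. (?v \<bullet> x) * f' x ?v + (?v \<bullet> ?v) * f x) = 0"
    by (rule integral_directional_derivative_zero(2)[OF der _ K(1)])
      (auto intro!: continuous_intros c1 cf simp: f0)
  moreover have i_f: "integrable lborel f" by (rule integrable_compact_support[OF cf K(1) f0])
  moreover have i1: "integrable lborel (\<lambda>x. (?v \<bullet> x) * f' x ?v)"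
    by (rule integrable_compact_support[OF c1 K(1)]) (simp add: f'0)
  ultimately have 1: "(LINT x|lborel. f x) = - (LINT x|lborel. (?v \<bullet> x) * f' x ?v)"
    by (simp add: inner_axis_axis)
  let ?c = "R * real n"
  let ?M = "(2 * ?c) ^ n + ?c * (2 * ?c) ^ (n - 1)"
  have c: "?c \<ge> 0" using R by simp
  have cJ: "continuous_on UNIV (\<lambda>x. norm (jacobian \<Phi> (at x)) ^ n)"
    by (intro continuous_intros continuous_on_jacobian \<Phi>)
  have iJ: "integrable lborel (\<lambda>x. norm (jacobian \<Phi> (at x)) ^ n)"
    by (rule integrable_compact_support[OF cJ K(1)]) (use jacobian_off_support[OF \<Phi> K(1,2)] n in auto)
  have "- (LINT x|lborel. (?v \<bullet> x) * f' x ?v) \<le> (LINT x|lborel. f x / 2 + ?M * norm (jacobian \<Phi> (at x)) ^ n)"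
    unfolding integral_minus[symmetric]
  proof (rule integral_mono)
    fix x
    have J: "norm (?D x) \<le> norm (jacobian \<Phi> (at x))"
    proof -
      have "?D x = (\<chi> i. jacobian \<Phi> (at x) $ i $ j)" by (simp add: vec_eq_iff jacobian_nth)
      then show ?thesis by (simp add: norm_column_le)
    qed
    show "- ((?v \<bullet> x) * f' x ?v) \<le> f x / 2 + ?M * norm (jacobian \<Phi> (at x)) ^ n"
    proof (cases "x \<in> K")
      case True
      have "\<bar>?v \<bullet> x\<bar> \<le> R"
        using True K(3) component_le_norm_cart[of x j] by (force simp: inner_axis')
      have "\<bar>f' x ?v\<bar> \<le> real n * norm (\<Phi> x) ^ (n - 2) * (norm (\<Phi> x) * norm (?D x))"
        unfolding f'_def by (simp add: abs_mult) (intro mult_left_mono Cauchy_Schwarz_ineq2, auto)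
      also have "\<dots> \<le> real n * norm (\<Phi> x) ^ (n - 2) * (norm (\<Phi> x) * norm (jacobian \<Phi> (at x)))"
        using J by (intro mult_left_mono) auto
      also have "\<dots> = real n * (norm (\<Phi> x) ^ (n - 1) * norm (jacobian \<Phi> (at x)))"
      proof -
        have "norm (\<Phi> x) ^ (n - 1) = norm (\<Phi> x) * norm (\<Phi> x) ^ (n - 2)"
          using n by (metis One_nat_def Suc_1 Suc_diff_le diff_Suc_Suc power_Suc)
        then show ?thesis by simp
      qed
      finally have "\<bar>?v \<bullet> x\<bar> * \<bar>f' x ?v\<bar> \<le> R * (real n * (norm (\<Phi> x) ^ (n - 1) * norm (jacobian \<Phi> (at x))))"
        using \<open>\<bar>?v \<bullet> x\<bar> \<le> R\<close> R by (intro mult_mono) auto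
      also have "\<dots> \<le> f x / 2 + (2 * ?c) ^ n * norm (jacobian \<Phi> (at x)) ^ n + ?c * (2 * ?c) ^ (n - 1) * norm (jacobian \<Phi> (at x)) ^ n"
        using young_absorb[of "norm (\<Phi> x)" "norm (jacobian \<Phi> (at x))" ?c n] c n by (simp add: f_def mult.assoc)
      also have "\<dots> = f x / 2 + ?M * norm (jacobian \<Phi> (at x)) ^ n" by (simp add: distrib_right)
      finally show ?thesis by (simp add: abs_mult[symmetric] abs_le_iff)
    next
      case False
      then show ?thesis using f'0 c by (simp add: f_def)
    qed
  qed (use i1 i_f iJ in auto)
  also have "\<dots> = (LINT x|lborel. f x) / 2 + ?M * (LINT x|lborel. norm (jacobian \<Phi> (at x)) ^ n)"
    using i_f iJ by simp
  finally show ?thesis using 1 unfolding f_def poincare_const_def by (simp add: algebra_simps)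
qed

section \<open>The global estimate\<close>

text \<open>The cut-off \<theta> is controlled only inside \<Omega>. The open sets \<Omega> and the
  complement of K cover the space, and on the latter the product and the proposed gradient vanish,
  so the product is C^1 everywhere.\<close>

lemma cutoff_gradient:
  fixes \<phi> \<theta> :: "real^'n \<Rightarrow> real" and g \<gamma> :: "real^'n \<Rightarrow> real^'n"
  assumes \<Omega>: "open \<Omega>" and \<theta>: "\<And>x. x \<in> \<Omega> \<Longrightarrow> (\<theta> has_derivative (\<lambda>v. \<gamma> x \<bullet> v)) (at x)" "continuous_on \<Omega> \<gamma>"
    and \<phi>: "\<And>x. (\<phi> has_derivative (\<lambda>v. g x \<bullet> v)) (at x)" "continuous_on UNIV g"
    and K: "compact K" "K \<subseteq> \<Omega>" "\<And>x. x \<notin> K \<Longrightarrow> \<phi> x = 0"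
  shows "((\<lambda>x. \<theta> x * \<phi> x) has_derivative (\<lambda>v. (\<theta> x *\<^sub>R g x + \<phi> x *\<^sub>R \<gamma> x) \<bullet> v)) (at x)"
    "continuous_on UNIV (\<lambda>x. \<theta> x *\<^sub>R g x + \<phi> x *\<^sub>R \<gamma> x)"
proof -
  have goff: "g x = 0" if "x \<notin> K" for x by (rule gradient_off_support[OF K(1,3) \<phi>(1) that])
  have oK: "open (- K)" using K(1) by (simp add: compact_imp_closed open_Compl)
  show "((\<lambda>x. \<theta> x * \<phi> x) has_derivative (\<lambda>v. (\<theta> x *\<^sub>R g x + \<phi> x *\<^sub>R \<gamma> x) \<bullet> v)) (at x)"
  proof (cases "x \<in> K")
    case True
    then have "x \<in> \<Omega>" using K by blast
    have "((\<lambda>x. \<theta> x * \<phi> x) has_derivative (\<lambda>v. \<theta> x * (g x \<bullet> v) + (\<gamma> x \<bullet> v) * \<phi> x)) (at x)"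
      by (rule has_derivative_mult[OF \<theta>(1)[OF \<open>x \<in> \<Omega>\<close>] \<phi>(1)])
    then show ?thesis by (simp add: inner_add_left mult.commute)
  next
    case False
    have "((\<lambda>_. 0) has_derivative (\<lambda>_. 0)) (at x)" by simp
    then have "((\<lambda>x. \<theta> x * \<phi> x) has_derivative (\<lambda>_. 0)) (at x)"
      by (rule has_derivative_transform_within_open[OF _ oK]) (use False K(3) in auto)
    then show ?thesis using goff[OF False] K(3)[OF False] by simp
  qed
  have "continuous_on (\<Omega> \<union> - K) (\<lambda>x. \<theta> x *\<^sub>R g x + \<phi> x *\<^sub>R \<gamma> x)"
  proof (rule continuous_on_open_Un[OF \<Omega> oK])
    have "continuous_on \<Omega> \<theta>"
      using \<theta>(1) by (auto intro!: continuous_at_imp_continuous_on has_derivative_continuous)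
    moreover have "continuous_on \<Omega> \<phi>"
      using \<phi>(1) by (auto intro!: continuous_at_imp_continuous_on has_derivative_continuous)
    ultimately show "continuous_on \<Omega> (\<lambda>x. \<theta> x *\<^sub>R g x + \<phi> x *\<^sub>R \<gamma> x)"
      by (intro continuous_intros \<theta>(2) continuous_on_subset[OF \<phi>(2)]) auto
    have "continuous_on (- K) (\<lambda>x. 0 :: real^'n)" by simp
    then show "continuous_on (- K) (\<lambda>x. \<theta> x *\<^sub>R g x + \<phi> x *\<^sub>R \<gamma> x)"
      by (rule continuous_on_eq) (use goff K(3) in auto)
  qed
  moreover have "\<Omega> \<union> - K = UNIV" using K by blast
  ultimately show "continuous_on UNIV (\<lambda>x. \<theta> x *\<^sub>R g x + \<phi> x *\<^sub>R \<gamma> x)" by simp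
qed

text \<open>Normalised bumps flat(\<rho>^2 - |x - k|^2). Their sum is positive on the compact
  closure of \<Omega>, which yields one bound B for all functions and gradients; outside \<Omega>
  the quotients are not controlled.\<close>

lemma partition_of_unity_C1:
  fixes \<Omega> :: "(real^'n) set" and \<rho> :: "real^'n \<Rightarrow> real"
  assumes "bounded \<Omega>" "finite X" "\<And>k. k \<in> X \<Longrightarrow> \<rho> k > 0" "closure \<Omega> \<subseteq> (\<Union>k\<in>X. ball k (\<rho> k))"
  obtains \<theta> :: "real^'n \<Rightarrow> real^'n \<Rightarrow> real" and \<gamma> and B where "B > 0"
    "\<And>k x. x \<in> \<Omega> \<Longrightarrow> (\<theta> k has_derivative (\<lambda>v. \<gamma> k x \<bullet> v)) (at x)"
    "\<And>k. continuous_on \<Omega> (\<gamma> k)"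
    "\<And>k x. k \<in> X \<Longrightarrow> x \<in> \<Omega> \<Longrightarrow> \<bar>\<theta> k x\<bar> \<le> B \<and> norm (\<gamma> k x) \<le> B"
    "\<And>k x. k \<in> X \<Longrightarrow> x \<notin> ball k (\<rho> k) \<Longrightarrow> \<theta> k x = 0"
    "\<And>x. x \<in> \<Omega> \<Longrightarrow> (\<Sum>k\<in>X. \<theta> k x) = 1"
proof -
  define t where "t k x = (\<rho> k)\<^sup>2 - (x - k) \<bullet> (x - k)" for k x :: "real^'n"
  define \<beta> where "\<beta> k x = flat (t k x)" for k x
  define b where "b k x = (-2 * flat_deriv 1 (t k x)) *\<^sub>R (x - k)" for k x
  define \<sigma> where "\<sigma> x = (\<Sum>k\<in>X. \<beta> k x)" for x
  define s where "s x = (\<Sum>k\<in>X. b k x)" for x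
  define \<theta> where "\<theta> k x = \<beta> k x / \<sigma> x" for k x
  define \<gamma> where "\<gamma> k x = (1 / \<sigma> x) *\<^sub>R b k x - (\<beta> k x / (\<sigma> x * \<sigma> x)) *\<^sub>R s x" for k x
  have flat': "(flat has_real_derivative flat_deriv 1 y) (at y)" for y
    using flat_deriv_has_real_derivative[of 0 y] by (simp add: flat_deriv_0)
  have c\<beta>: "continuous_on S (\<beta> k)" for S k
  proof -
    have "continuous_on UNIV flat" using flat' DERIV_continuous by (blast intro: continuous_at_imp_continuous_on)
    then show ?thesis unfolding \<beta>_def t_def by (rule continuous_on_compose2) (auto intro!: continuous_intros)
  qed
  have cb: "continuous_on S (b k)" for S k
  proof -
    have "continuous_on UNIV (flat_deriv 1)"
      using flat_deriv_has_real_derivative DERIV_continuous by (blast intro: continuous_at_imp_continuous_on)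
    then have "continuous_on S (\<lambda>x. flat_deriv 1 (t k x))" unfolding t_def by (rule continuous_on_compose2) (auto intro!: continuous_intros)
    then show ?thesis unfolding b_def by (intro continuous_intros)
  qed
  have c\<sigma>: "continuous_on S \<sigma>" and cs: "continuous_on S s" for S
    unfolding \<sigma>_def s_def by (auto intro!: continuous_intros c\<beta> cb)
  have d\<beta>: "(\<beta> k has_derivative (\<lambda>v. b k x \<bullet> v)) (at x)" for k x
  proof -
    have "(t k has_derivative (\<lambda>v. - 2 * ((x - k) \<bullet> v))) (at x)"
      unfolding t_def by (auto intro!: derivative_eq_intros simp: inner_commute)
    from DERIV_compose_FDERIV[OF flat' this]
    have "((\<lambda>x. flat (t k x)) has_derivative (\<lambda>v. (- 2 * ((x - k) \<bullet> v)) * flat_deriv 1 (t k x))) (at x)" by (simp add: mult.commute)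
    then show ?thesis unfolding \<beta>_def b_def by (simp add: mult_ac)
  qed
  have d\<sigma>: "(\<sigma> has_derivative (\<lambda>v. s x \<bullet> v)) (at x)" for x
    unfolding \<sigma>_def s_def inner_sum_left by (intro has_derivative_sum d\<beta>)
  have t_pos: "t k x > 0 \<longleftrightarrow> x \<in> ball k (\<rho> k)" if "k \<in> X" for k x
  proof -
    have "t k x > 0 \<longleftrightarrow> (norm (x - k))\<^sup>2 < (\<rho> k)\<^sup>2" by (simp add: t_def power2_norm_eq_inner)
    also have "\<dots> \<longleftrightarrow> norm (x - k) < \<rho> k" using assms(3)[OF that]
      by (metis less_imp_le norm_ge_zero power2_less_imp_less power_strict_mono zero_less_numeral)
    finally show ?thesis by (simp add: dist_norm norm_minus_commute)
  qed
  have \<sigma>: "\<sigma> x > 0" if "x \<in> closure \<Omega>" for x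
  proof -
    obtain k where k: "k \<in> X" "x \<in> ball k (\<rho> k)" using assms(4) \<open>x \<in> closure \<Omega>\<close> by blast
    have "0 < \<beta> k x" using t_pos[OF k(1)] k(2) by (simp add: \<beta>_def flat_pos)
    also have "\<beta> k x \<le> \<sigma> x" unfolding \<sigma>_def
      by (rule member_le_sum) (use k assms(2) in \<open>auto simp: \<beta>_def flat_nonneg\<close>)
    finally show ?thesis .
  qed
  have cl: "\<Omega> \<subseteq> closure \<Omega>" by (rule closure_subset)
  have c\<theta>: "continuous_on (closure \<Omega>) (\<theta> k)" for k
    unfolding \<theta>_def using \<sigma> by (intro continuous_intros c\<beta> c\<sigma>) force
  have c\<gamma>: "continuous_on (closure \<Omega>) (\<gamma> k)" for k
    unfolding \<gamma>_def using \<sigma> by (intro continuous_intros c\<beta> c\<sigma> cb cs) force+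
  have comp: "compact (closure \<Omega>)" using assms(1) by simp
  have "\<exists>B. \<forall>x\<in>closure \<Omega>. \<bar>\<theta> k x\<bar> + norm (\<gamma> k x) \<le> B" for k
  proof -
    have "bounded ((\<lambda>x. \<bar>\<theta> k x\<bar> + norm (\<gamma> k x)) ` closure \<Omega>)"
      by (intro compact_imp_bounded compact_continuous_image comp continuous_intros c\<theta> c\<gamma>)
    then show ?thesis by (auto simp: bounded_iff abs_le_iff)
  qed
  then obtain B where B: "\<And>k x. x \<in> closure \<Omega> \<Longrightarrow> \<bar>\<theta> k x\<bar> + norm (\<gamma> k x) \<le> B k" by metis
  define B' where "B' = 1 + (\<Sum>k\<in>X. \<bar>B k\<bar>)"
  show ?thesis
  proof (rule that)
    show "B' > 0" unfolding B'_def by (intro add_pos_nonneg sum_nonneg) auto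
    show "(\<theta> k has_derivative (\<lambda>v. \<gamma> k x \<bullet> v)) (at x)" if "x \<in> \<Omega>" for k x
    proof -
      have s0: "\<sigma> x \<noteq> 0" using \<sigma>[of x] that cl by force
      have "(\<theta> k has_derivative (\<lambda>v. ((b k x \<bullet> v) * \<sigma> x - \<beta> k x * (s x \<bullet> v)) / (\<sigma> x * \<sigma> x))) (at x)"
        unfolding \<theta>_def by (rule has_derivative_divide'[OF d\<beta> d\<sigma> s0])
      moreover have "((b k x \<bullet> v) * \<sigma> x - \<beta> k x * (s x \<bullet> v)) / (\<sigma> x * \<sigma> x) = \<gamma> k x \<bullet> v" for v
        using s0 by (simp add: \<gamma>_def inner_diff_left field_simps)
      ultimately show ?thesis by simp
    qed
    show "continuous_on \<Omega> (\<gamma> k)" for k by (rule continuous_on_subset[OF c\<gamma> cl])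
    show "\<bar>\<theta> k x\<bar> \<le> B' \<and> norm (\<gamma> k x) \<le> B'" if "k \<in> X" "x \<in> \<Omega>" for k x
    proof -
      have "B k \<le> \<bar>B k\<bar>" by simp
      also have "\<bar>B k\<bar> \<le> (\<Sum>k\<in>X. \<bar>B k\<bar>)" by (rule member_le_sum) (use that assms(2) in auto)
      finally have "B k \<le> B'" by (simp add: B'_def)
      moreover have "\<bar>\<theta> k x\<bar> + norm (\<gamma> k x) \<le> B k" using B that cl by blast
      ultimately show ?thesis using norm_ge_zero[of "\<gamma> k x"] by linarith
    qed
    show "\<theta> k x = 0" if "k \<in> X" "x \<notin> ball k (\<rho> k)" for k x
      using t_pos[OF that(1), of x] that(2) by (simp add: \<theta>_def \<beta>_def flat_eq_0)
    show "(\<Sum>k\<in>X. \<theta> k x) = 1" if "x \<in> \<Omega>" for x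
    proof -
      have s0: "\<sigma> x \<noteq> 0" using \<sigma>[of x] that cl by force
      have "(\<Sum>k\<in>X. \<theta> k x) = \<sigma> x / \<sigma> x" unfolding \<theta>_def \<sigma>_def by (rule sum_divide_distrib[symmetric])
      then show ?thesis using s0 by simp
    qed
  qed
qed

lemma power_add_le:
  fixes a b :: real
  assumes "a \<ge> 0" "b \<ge> 0"
  shows "(a + b) ^ n \<le> 2 ^ n * (a ^ n + b ^ n)"
proof -
  have "(a + b) ^ n \<le> (2 * max a b) ^ n" using assms by (intro power_mono) auto
  also have "\<dots> = 2 ^ n * (max a b) ^ n" by (simp add: power_mult_distrib)
  also have "(max a b) ^ n \<le> a ^ n + b ^ n" using assms by (auto simp: max_def)
  finally show ?thesis by simp
qed

text \<open>The product F . \<Phi> is split into terms F_i \<theta>_k \<Phi>_i, each of which lives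
  where one inward direction e_k is valid; Poincare's inequality controls the gradient of the
  cut-off. The bound D on the L^n norm of the Jacobian is left free and positive, so that vanishing
  gradients need no separate case.\<close>

theorem div_free_estimate:
  fixes \<Omega> :: "(real^'n) set"
  assumes n2: "CARD('n) \<ge> 2" and dom: "open \<Omega>" "bounded \<Omega>" "smooth_boundary \<Omega>"
  shows "\<exists>C\<ge>0. \<forall>F. integrable (lebesgue_on \<Omega>) F \<and> div_free_on \<Omega> F \<longrightarrow>
    (\<forall>\<Phi>\<in>test_functions \<Omega>. \<forall>D>0. (LINT x|lborel. norm (jacobian \<Phi> (at x)) ^ CARD('n)) \<le> D ^ CARD('n) \<longrightarrow>
      \<bar>LINT x|lebesgue_on \<Omega>. F x \<bullet> \<Phi> x\<bar> \<le> C * (LINT x|lebesgue_on \<Omega>. norm (F x)) * D)"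
proof -
  let ?n = "CARD('n)"
  obtain R where "R > 0" "\<forall>x\<in>\<Omega>. norm x \<le> R"
    using dom(2) unfolding bounded_pos by blast
  then have R: "R > 0" "\<Omega> \<subseteq> cball 0 R" by auto
  have "\<forall>x0\<in>closure \<Omega>. \<exists>\<rho> \<tau> e. \<rho> > 0 \<and> \<tau> > 0 \<and> (\<forall>i. e $ i \<noteq> 0) \<and>
    (\<forall>p t. p \<in> \<Omega> \<longrightarrow> p \<in> ball x0 \<rho> \<longrightarrow> 0 \<le> t \<longrightarrow> t \<le> 2 * \<tau> \<longrightarrow> p + t *\<^sub>R e \<in> \<Omega>)"
    using inward_direction[OF dom(1,3)] by blast
  then obtain \<rho> \<tau> and e :: "real^'n \<Rightarrow> real^'n" where pt: "\<And>x0. x0 \<in> closure \<Omega> \<Longrightarrow> \<rho> x0 > 0"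
    "\<And>x0. x0 \<in> closure \<Omega> \<Longrightarrow> \<tau> x0 > 0" "\<And>x0 i. x0 \<in> closure \<Omega> \<Longrightarrow> e x0 $ i \<noteq> 0"
    "\<And>x0 p t. x0 \<in> closure \<Omega> \<Longrightarrow> p \<in> \<Omega> \<Longrightarrow> p \<in> ball x0 (\<rho> x0) \<Longrightarrow> 0 \<le> t \<Longrightarrow> t \<le> 2 * \<tau> x0 \<Longrightarrow> p + t *\<^sub>R e x0 \<in> \<Omega>"
    by metis
  have comp: "compact (closure \<Omega>)" using dom(2) by simp
  \<comment> \<open>Half the radius, so that the closed ball carrying the cut-off still lies in the
    open ball where e_k points inward.\<close>
  have cover: "closure \<Omega> \<subseteq> (\<Union>k\<in>closure \<Omega>. ball k (\<rho> k / 2))" using pt(1) by force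
  obtain X where X: "X \<subseteq> closure \<Omega>" "finite X" "closure \<Omega> \<subseteq> (\<Union>k\<in>X. ball k (\<rho> k / 2))"
  proof (rule compactE_image[OF comp _ cover])
    show "open (ball k (\<rho> k / 2))" for k by simp
  qed blast
  obtain \<theta> :: "real^'n \<Rightarrow> real^'n \<Rightarrow> real" and \<gamma> and B where B: "B > 0"
    and \<theta>: "\<And>k x. x \<in> \<Omega> \<Longrightarrow> (\<theta> k has_derivative (\<lambda>v. \<gamma> k x \<bullet> v)) (at x)"
    "\<And>k. continuous_on \<Omega> (\<gamma> k)"
    and \<theta>B: "\<And>k x. k \<in> X \<Longrightarrow> x \<in> \<Omega> \<Longrightarrow> \<bar>\<theta> k x\<bar> \<le> B \<and> norm (\<gamma> k x) \<le> B"
    and \<theta>0: "\<And>k x. k \<in> X \<Longrightarrow> x \<notin> ball k (\<rho> k / 2) \<Longrightarrow> \<theta> k x = 0"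
    and \<theta>1: "\<And>x. x \<in> \<Omega> \<Longrightarrow> (\<Sum>k\<in>X. \<theta> k x) = 1"
  proof (rule partition_of_unity_C1[OF dom(2) X(2) _ X(3)])
    show "0 < \<rho> k / 2" if "k \<in> X" for k using pt(1) X(1) that by auto
  qed blast
  let ?a = "\<lambda>k i. axis i (1 / e k $ i)"
  \<comment> \<open>Outside its locale \<open>local_const\<close> takes only i, e, \<tau>, R, n and
    a as arguments. F is not among them, which is what makes the final constant independent of
    F.\<close>
  define c where "c k i = \<bar>slab_setting.local_const i (e k) (\<tau> k) R ?n (?a k i)\<bar>" for k i
  \<comment> \<open>M absorbs the loss from the cut-off. The maximum with 1 gives M \<le> M^n, so
    that a bound M D^n can be read as (M D)^n, as \<open>local_estimate\<close> requires.\<close>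
  define M where "M = max 1 (B ^ ?n * 2 ^ ?n * (1 + \<bar>poincare_const ?n R\<bar>))"
  define C where "C = (\<Sum>i\<in>UNIV. \<Sum>k\<in>X. \<bar>e k $ i\<bar> * c k i * M)"
  have M1: "M \<ge> 1" by (simp add: M_def)
  show ?thesis
  proof (intro exI[of _ C] conjI allI impI ballI)
    show "0 \<le> C" unfolding C_def c_def using M1 by (intro sum_nonneg mult_nonneg_nonneg) auto
    fix F \<Phi> :: "real^'n \<Rightarrow> real^'n" and D :: real
    assume F: "integrable (lebesgue_on \<Omega>) F \<and> div_free_on \<Omega> F" and \<Phi>: "\<Phi> \<in> test_functions \<Omega>"
      and D: "0 < D" "(LINT x|lborel. norm (jacobian \<Phi> (at x)) ^ ?n) \<le> D ^ ?n"
    let ?N = "LINT x|lebesgue_on \<Omega>. norm (F x)"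
    obtain K where K: "smooth \<Phi>" "compact K" "K \<subseteq> \<Omega>" "\<And>x. x \<notin> K \<Longrightarrow> \<Phi> x = 0"
      using test_functionsE[OF \<Phi>] by blast
    have KR: "K \<subseteq> cball 0 R" using K(3) R(2) by blast
    let ?J = "LINT x|lborel. norm (jacobian \<Phi> (at x)) ^ ?n"
    have cJ: "continuous_on UNIV (\<lambda>x. norm (jacobian \<Phi> (at x)) ^ ?n)"
      by (intro continuous_intros continuous_on_jacobian K(1))
    have iJ: "integrable lborel (\<lambda>x. norm (jacobian \<Phi> (at x)) ^ ?n)"
      by (rule integrable_compact_support[OF cJ K(2)]) (use jacobian_off_support[OF K(1,2,4)] n2 in auto)
    have c\<Phi>: "continuous_on UNIV (\<lambda>x. norm (\<Phi> x) ^ ?n)"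
      by (intro continuous_intros smooth_continuous K(1))
    have i\<Phi>: "integrable lborel (\<lambda>x. norm (\<Phi> x) ^ ?n)"
      by (rule integrable_compact_support[OF c\<Phi> K(2)]) (use K(4) n2 in auto)
    have J0: "0 \<le> ?J" by (intro integral_nonneg_AE) auto
    have poin: "(LINT x|lborel. norm (\<Phi> x) ^ ?n) \<le> \<bar>poincare_const ?n R\<bar> * ?J"
    proof -
      have "(LINT x|lborel. norm (\<Phi> x) ^ ?n) \<le> poincare_const ?n R * ?J"
        by (rule poincare[OF n2 K(1,2,4) KR]) (use R in auto)
      also have "\<dots> \<le> \<bar>poincare_const ?n R\<bar> * ?J" using J0 by (intro mult_right_mono) auto
      finally show ?thesis .
    qed
    have trm: "integrable (lebesgue_on \<Omega>) (\<lambda>x. F x $ i * (\<theta> k x * \<Phi> x $ i))"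
      "\<bar>LINT x|lebesgue_on \<Omega>. F x $ i * (\<theta> k x * \<Phi> x $ i)\<bar> \<le> \<bar>e k $ i\<bar> * c k i * M * ?N * D"
      if k: "k \<in> X" for k i
    proof -
      have kc: "k \<in> closure \<Omega>" using k X(1) by blast
      let ?K = "K \<inter> cball k (\<rho> k / 2)"
      let ?f = "\<lambda>x. \<Phi> x $ i"
      let ?g = "\<lambda>x. \<theta> k x *\<^sub>R grad ?f x + ?f x *\<^sub>R \<gamma> k x"
      note sf = smooth_component[OF K(1), of i]
      have f0: "?f x = 0" if "x \<notin> K" for x using K(4)[OF that] by simp
      note cut = cutoff_gradient[OF dom(1) \<theta>(1) \<theta>(2) has_derivative_grad[OF sf] continuous_on_grad[OF sf] K(2,3) f0, of k]
      have Kc: "compact ?K" using K(2) by (intro compact_Int) auto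
      have z: "\<theta> k x * ?f x = 0" if "x \<notin> ?K" for x
        using that f0[of x] \<theta>0[OF k, of x] ball_subset_cball[of k "\<rho> k / 2"] by auto
      have cf: "continuous_on UNIV (\<lambda>x. \<theta> k x * ?f x)"
        using cut(1) by (auto intro!: continuous_at_imp_continuous_on has_derivative_continuous)
      obtain b where b: "\<And>x. norm (\<theta> k x * ?f x) \<le> b"
        using bounded_compact_support[OF cf Kc z] by blast
      have iFi: "integrable (lebesgue_on \<Omega>) (\<lambda>x. F x $ i)"
        using F by (auto intro: integrable_bounded_linear[OF bounded_linear_vec_nth])
      show int: "integrable (lebesgue_on \<Omega>) (\<lambda>x. F x $ i * (\<theta> k x * ?f x))"
        by (rule integrable_mult_bounded(1)[OF iFi borel_measurable_continuous_lebesgue_on[OF cf], of b])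
          (use b in simp)
      interpret slab_setting \<Omega> F i "e k" "\<tau> k" R ?n "?a k i" ?N
        by unfold_locales (use n2 dom F pt[OF kc] R in auto)
      have gb: "norm (?g x) ^ ?n \<le> B ^ ?n * 2 ^ ?n * (norm (jacobian \<Phi> (at x)) ^ ?n + norm (\<Phi> x) ^ ?n)" for x
      proof (cases "x \<in> K")
        case True
        then have x: "x \<in> \<Omega>" using K(3) by blast
        have "norm (grad ?f x) \<le> norm (jacobian \<Phi> (at x))"
          unfolding jacobian_row[OF K(1), symmetric] by (rule Finite_Cartesian_Product.norm_nth_le)
        moreover have "\<bar>?f x\<bar> \<le> norm (\<Phi> x)" by (rule component_le_norm_cart)
        ultimately have "\<bar>\<theta> k x\<bar> * norm (grad ?f x) + \<bar>?f x\<bar> * norm (\<gamma> k x)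
            \<le> B * norm (jacobian \<Phi> (at x)) + norm (\<Phi> x) * B"
          using \<theta>B[OF k x] B by (intro add_mono mult_mono) auto
        then have "norm (?g x) \<le> B * (norm (jacobian \<Phi> (at x)) + norm (\<Phi> x))"
          using norm_triangle_ineq[of "\<theta> k x *\<^sub>R grad ?f x" "?f x *\<^sub>R \<gamma> k x"] by (simp add: algebra_simps)
        then have "norm (?g x) ^ ?n \<le> (B * (norm (jacobian \<Phi> (at x)) + norm (\<Phi> x))) ^ ?n"
          by (intro power_mono) auto
        also have "\<dots> \<le> B ^ ?n * (2 ^ ?n * (norm (jacobian \<Phi> (at x)) ^ ?n + norm (\<Phi> x) ^ ?n))"
          unfolding power_mult_distrib using B by (intro mult_left_mono power_add_le) auto
        finally show ?thesis by (simp add: mult.assoc)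
      next
        case False
        then have "?g x = 0" using f0 grad_off_support[OF sf K(2) f0] by simp
        then have *: "norm (?g x) ^ ?n = 0" using n2 by simp
        show ?thesis unfolding * using B by simp
      qed
      have "(LINT x|lborel. norm (?g x) ^ ?n) \<le> (LINT x|lborel. B ^ ?n * 2 ^ ?n * (norm (jacobian \<Phi> (at x)) ^ ?n + norm (\<Phi> x) ^ ?n))"
      proof (rule integral_mono[OF _ _ gb])
        have c: "continuous_on UNIV (\<lambda>x. norm (?g x) ^ ?n)" by (intro continuous_on_power continuous_on_norm cut(2))
        show "integrable lborel (\<lambda>x. norm (?g x) ^ ?n)"
        proof (rule integrable_compact_support[OF c K(2)])
          show "norm (?g x) ^ ?n = 0" if "x \<notin> K" for x
            using f0[OF that] grad_off_support[OF sf K(2) f0 that] n2 by simp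
        qed
      qed (use iJ i\<Phi> in simp)
      also have "\<dots> = B ^ ?n * 2 ^ ?n * (?J + (LINT x|lborel. norm (\<Phi> x) ^ ?n))" using iJ i\<Phi> by simp
      also have "\<dots> \<le> B ^ ?n * 2 ^ ?n * (?J + \<bar>poincare_const ?n R\<bar> * ?J)"
        using B poin by (intro mult_left_mono add_left_mono) auto
      also have "\<dots> = (B ^ ?n * 2 ^ ?n * (1 + \<bar>poincare_const ?n R\<bar>)) * ?J" by (simp add: algebra_simps)
      also have "\<dots> \<le> M * D ^ ?n"
        using D J0 M1 by (intro mult_mono) (auto simp: M_def)
      also have "\<dots> \<le> M ^ ?n * D ^ ?n"
        using M1 n2 D power_increasing[of 1 ?n M] by (intro mult_right_mono) auto
      finally have gD: "(LINT x|lborel. norm (?g x) ^ ?n) \<le> (M * D) ^ ?n" by (simp add: power_mult_distrib)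
      have "\<bar>LINT x|lebesgue_on \<Omega>. (F x \<bullet> ?a k i) * (\<theta> k x * ?f x)\<bar> \<le> local_const * ?N * (M * D)"
      proof (rule local_estimate[OF cut(1) cut(2) Kc z _ _ _ gD])
        show "?K \<subseteq> cball 0 R" using KR by blast
        show "p + t *\<^sub>R e k \<in> \<Omega>" if "p \<in> ?K" "0 \<le> t" "t \<le> 2 * \<tau> k" for p t
        proof (rule pt(4)[OF kc _ _ that(2,3)])
          show "p \<in> \<Omega>" using that(1) K(3) by blast
          show "p \<in> ball k (\<rho> k)" using that(1) pt(1)[OF kc] by auto
        qed
        show "M * D > 0" using M1 D by simp
      qed
      also have "\<dots> \<le> c k i * ?N * (M * D)"
        unfolding c_def using M1 D N_nonneg by (intro mult_right_mono) auto
      finally have le: "\<bar>LINT x|lebesgue_on \<Omega>. (F x \<bullet> ?a k i) * (\<theta> k x * ?f x)\<bar> \<le> c k i * ?N * (M * D)" .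
      have "F x $ i * (\<theta> k x * ?f x) = e k $ i * ((F x \<bullet> ?a k i) * (\<theta> k x * ?f x))" for x
        using ei by (simp add: inner_axis)
      then have "(LINT x|lebesgue_on \<Omega>. F x $ i * (\<theta> k x * ?f x)) = e k $ i * (LINT x|lebesgue_on \<Omega>. (F x \<bullet> ?a k i) * (\<theta> k x * ?f x))"
        by (simp only: integral_mult_right_zero)
      then have "\<bar>LINT x|lebesgue_on \<Omega>. F x $ i * (\<theta> k x * ?f x)\<bar> \<le> \<bar>e k $ i\<bar> * (c k i * ?N * (M * D))"
        using mult_left_mono[OF le, of "\<bar>e k $ i\<bar>"] by (simp only: abs_mult abs_ge_zero)
      then show "\<bar>LINT x|lebesgue_on \<Omega>. F x $ i * (\<theta> k x * ?f x)\<bar> \<le> \<bar>e k $ i\<bar> * c k i * M * ?N * D"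
        by (simp add: mult_ac)
    qed
    have "(LINT x|lebesgue_on \<Omega>. F x \<bullet> \<Phi> x) = (LINT x|lebesgue_on \<Omega>. (\<Sum>i\<in>UNIV. \<Sum>k\<in>X. F x $ i * (\<theta> k x * \<Phi> x $ i)))"
    proof (rule Bochner_Integration.integral_cong)
      fix x assume "x \<in> space (lebesgue_on \<Omega>)"
      then have x: "x \<in> \<Omega>" by simp
      have "(\<Sum>k\<in>X. F x $ i * (\<theta> k x * \<Phi> x $ i)) = F x $ i * \<Phi> x $ i" for i
      proof -
        have "(\<Sum>k\<in>X. F x $ i * (\<theta> k x * \<Phi> x $ i)) = F x $ i * ((\<Sum>k\<in>X. \<theta> k x) * \<Phi> x $ i)"
          by (simp add: sum_distrib_left sum_distrib_right)
        then show ?thesis using \<theta>1[OF x] by simp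
      qed
      then show "F x \<bullet> \<Phi> x = (\<Sum>i\<in>UNIV. \<Sum>k\<in>X. F x $ i * (\<theta> k x * \<Phi> x $ i))"
        by (simp add: inner_vec_def)
    qed simp
    also have "\<dots> = (\<Sum>i\<in>UNIV. \<Sum>k\<in>X. LINT x|lebesgue_on \<Omega>. F x $ i * (\<theta> k x * \<Phi> x $ i))"
      using trm(1) by simp
    finally have "\<bar>LINT x|lebesgue_on \<Omega>. F x \<bullet> \<Phi> x\<bar> \<le> (\<Sum>i\<in>UNIV. \<Sum>k\<in>X. \<bar>LINT x|lebesgue_on \<Omega>. F x $ i * (\<theta> k x * \<Phi> x $ i)\<bar>)"
      by (simp only:) (intro order_trans[OF sum_abs sum_mono] sum_abs)
    also have "\<dots> \<le> (\<Sum>i\<in>UNIV. \<Sum>k\<in>X. \<bar>e k $ i\<bar> * c k i * M * ?N * D)"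
      by (intro sum_mono trm(2))
    also have "\<dots> = C * ?N * D" by (simp add: C_def sum_distrib_right)
    finally show "\<bar>LINT x|lebesgue_on \<Omega>. F x \<bullet> \<Phi> x\<bar> \<le> C * ?N * D" .
  qed
qed

section \<open>Functions with integrable n-th power\<close>

lemma power_pred_mult: "n \<ge> 1 \<Longrightarrow> x ^ (n - 1) * x = (x::real) ^ n"
  by (simp add: power_eq_if)

text \<open>The free weight l can be made small to dominate a fixed first factor; this stands in for
  Hoelder's inequality in the limit arguments.\<close>

lemma young_eps:
  fixes a b l :: real
  assumes "a \<ge> 0" "b \<ge> 0" "l > 0" "n \<ge> 1"
  shows "a ^ (n - 1) * b \<le> l * a ^ n + b ^ n / l ^ (n - 1)"
proof (cases "b \<le> l * a")
  case True
  then have "a ^ (n - 1) * b \<le> a ^ (n - 1) * (l * a)" using assms by (intro mult_left_mono) auto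
  also have "\<dots> = l * a ^ n" using power_pred_mult[OF assms(4), of a] by simp
  finally show ?thesis using assms by (simp add: add_increasing2)
next
  case False
  then have "a \<le> b / l" using assms by (simp add: field_simps)
  then have "a ^ (n - 1) * b \<le> (b / l) ^ (n - 1) * b" using assms by (intro mult_right_mono power_mono) auto
  also have "\<dots> = b ^ n / l ^ (n - 1)" using power_pred_mult[OF assms(4), of b] by (simp add: power_divide)
  finally show ?thesis using assms by (simp add: add_increasing)
qed

lemma abs_power_diff_le:
  fixes x y c :: real
  assumes "0 \<le> x" "x \<le> c" "0 \<le> y" "y \<le> c"
  shows "\<bar>x ^ n - y ^ n\<bar> \<le> real n * c ^ (n - 1) * \<bar>x - y\<bar>"
proof (cases n)
  case (Suc m)
  have "\<bar>\<Sum>i<n. y ^ (n - Suc i) * x ^ i\<bar> \<le> (\<Sum>i<n. c ^ (n - 1))"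
  proof (rule order_trans[OF sum_abs sum_mono])
    fix i assume "i \<in> {..<n}"
    then have e: "c ^ (n - Suc i) * c ^ i = c ^ (n - 1)" by (simp add: power_add[symmetric])
    have "y ^ (n - Suc i) * x ^ i \<le> c ^ (n - Suc i) * c ^ i"
      using assms by (intro mult_mono power_mono) auto
    then show "\<bar>y ^ (n - Suc i) * x ^ i\<bar> \<le> c ^ (n - 1)" using assms e by simp
  qed
  then have "\<bar>x - y\<bar> * \<bar>\<Sum>i<n. y ^ (n - Suc i) * x ^ i\<bar> \<le> \<bar>x - y\<bar> * (real n * c ^ (n - 1))"
    by (intro mult_left_mono) auto
  moreover have "x ^ n - y ^ n = (x - y) * (\<Sum>i<n. y ^ (n - Suc i) * x ^ i)"
    unfolding Suc by (rule power_diff_sumr2)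
  ultimately show ?thesis by (simp add: abs_mult mult_ac)
qed simp

text \<open>The tangent inequality of the convex function t^(n/2) at t = r^2, taken at t = a^2. The
  induction on n keeps to natural exponents.\<close>

lemma power_tangent_square:
  fixes a r :: real
  assumes "a \<ge> 0" "r \<ge> 0" "n \<ge> 2"
  shows "real n * r ^ (n - 2) * a\<^sup>2 \<le> 2 * a ^ n + real (n - 2) * r ^ n"
  using assms(3)
proof (induction n rule: dec_induct)
  case base
  then show ?case by simp
next
  case (step n)
  obtain m where m: "n = m + 2" using step(1) by (metis add.commute le_Suc_ex)
  have "0 \<le> (a - r) * (2 * a ^ n - r ^ (n - 1) * (a + r))"
  proof (cases "a \<ge> r")
    case True
    have "r ^ (n - 1) * a \<le> a ^ (n - 1) * a" "r ^ (n - 1) * r \<le> a ^ (n - 1) * a"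
      using True assms by (auto intro!: mult_mono power_mono)
    moreover have "a ^ (n - 1) * a = a ^ n" using step(1) by (intro power_pred_mult) auto
    ultimately have "0 \<le> 2 * a ^ n - r ^ (n - 1) * (a + r)" by (simp add: distrib_left)
    then show ?thesis using True by simp
  next
    case False
    have "a ^ (n - 1) * a \<le> r ^ (n - 1) * a" "a ^ (n - 1) * a \<le> r ^ (n - 1) * r"
      using False assms by (auto intro!: mult_mono power_mono)
    moreover have "a ^ (n - 1) * a = a ^ n" using step(1) by (intro power_pred_mult) auto
    ultimately have "2 * a ^ n - r ^ (n - 1) * (a + r) \<le> 0" by (simp add: distrib_left)
    then show ?thesis using False by (intro mult_nonpos_nonpos) auto
  qed
  moreover have "r * (real n * r ^ (n - 2) * a\<^sup>2) \<le> r * (2 * a ^ n + real (n - 2) * r ^ n)"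
    using step(3) assms by (intro mult_left_mono)
  ultimately show ?case unfolding m by (simp add: algebra_simps power2_eq_square)
qed

text \<open>Let r^2 be the sum of the squared norms of half-sum and half-difference. As n is at
  least 2, the sum of their n-th powers is at most r^n. By the parallelogram law r^2 is the mean of
  |a|^2 and |b|^2, and the tangent inequality at r bounds r^n by the mean of the n-th
  powers.\<close>

lemma clarkson:
  fixes a b :: "'a::real_inner"
  assumes n: "n \<ge> 2"
  shows "norm ((1 / 2) *\<^sub>R (a + b)) ^ n + norm ((1 / 2) *\<^sub>R (a - b)) ^ n \<le> (norm a ^ n + norm b ^ n) / 2"
proof -
  let ?u = "norm ((1 / 2) *\<^sub>R (a + b))" and ?v = "norm ((1 / 2) *\<^sub>R (a - b))"
  define r where "r = sqrt (?u\<^sup>2 + ?v\<^sup>2)"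
  have r2: "r\<^sup>2 = ?u\<^sup>2 + ?v\<^sup>2" by (simp add: r_def)
  have par: "?u\<^sup>2 + ?v\<^sup>2 = ((norm a)\<^sup>2 + (norm b)\<^sup>2) / 2"
    by (simp only: power2_norm_eq_inner) (simp add: inner_add_left inner_add_right inner_diff_left inner_diff_right inner_commute field_simps)
  have r0: "r \<ge> 0" by (simp add: r_def)
  have le: "?u \<le> r" "?v \<le> r" unfolding r_def by (auto intro!: real_le_rsqrt)
  obtain m where m: "n = m + 2" using n by (metis add.commute le_Suc_ex)
  have "?u ^ n + ?v ^ n = ?u ^ m * ?u\<^sup>2 + ?v ^ m * ?v\<^sup>2" by (simp only: m power_add)
  also have "\<dots> \<le> r ^ m * ?u\<^sup>2 + r ^ m * ?v\<^sup>2"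
    using le by (intro add_mono mult_right_mono power_mono) auto
  also have "\<dots> = r ^ m * r\<^sup>2" unfolding r2 by (simp only: distrib_left)
  also have "\<dots> = r ^ n" by (simp only: m power_add)
  finally have 1: "?u ^ n + ?v ^ n \<le> r ^ n" .
  have "real n * r ^ m * (norm a)\<^sup>2 + real n * r ^ m * (norm b)\<^sup>2 \<le> 2 * norm a ^ n + 2 * norm b ^ n + 2 * (real m * r ^ n)"
    using power_tangent_square[OF norm_ge_zero[of a] r0 n] power_tangent_square[OF norm_ge_zero[of b] r0 n] by (simp add: m)
  moreover have "real n * r ^ m * (norm a)\<^sup>2 + real n * r ^ m * (norm b)\<^sup>2 = 2 * (real n * r ^ n)"
  proof -
    have "real n * r ^ m * (norm a)\<^sup>2 + real n * r ^ m * (norm b)\<^sup>2 = real n * r ^ m * (2 * r\<^sup>2)"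
      unfolding r2 par by (simp add: algebra_simps)
    then show ?thesis by (simp add: m power_add power2_eq_square)
  qed
  ultimately have "2 * r ^ n \<le> norm a ^ n + norm b ^ n" by (simp add: m algebra_simps)
  then show ?thesis using 1 by simp
qed

text \<open>With p = |a|^(n-2) and q = |b|^(n-2), twice the inner product is (p - q)(|a|^2 - |b|^2)
  + (p + q)|a - b|^2, and both summands are nonnegative. Equality forces a = b or p = q = 0, and in
  the latter case both vectors vanish.\<close>

lemma power_vector_monotone:
  fixes a b :: "'a::real_inner"
  assumes n: "n \<ge> 2"
  shows "0 \<le> (norm a ^ (n - 2) *\<^sub>R a - norm b ^ (n - 2) *\<^sub>R b) \<bullet> (a - b)"
    "(norm a ^ (n - 2) *\<^sub>R a - norm b ^ (n - 2) *\<^sub>R b) \<bullet> (a - b) = 0 \<Longrightarrow> a = b"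
proof -
  let ?p = "norm a ^ (n - 2)" and ?q = "norm b ^ (n - 2)"
  let ?E = "(?p *\<^sub>R a - ?q *\<^sub>R b) \<bullet> (a - b)"
  have eq: "2 * ?E = (?p - ?q) * ((norm a)\<^sup>2 - (norm b)\<^sup>2) + (?p + ?q) * (norm (a - b))\<^sup>2"
    by (simp only: power2_norm_eq_inner) (simp add: inner_diff_left inner_diff_right inner_commute algebra_simps)
  have 1: "0 \<le> (?p - ?q) * ((norm a)\<^sup>2 - (norm b)\<^sup>2)"
  proof (cases "norm a \<le> norm b")
    case True
    then have "?p \<le> ?q" "(norm a)\<^sup>2 \<le> (norm b)\<^sup>2" by (auto intro: power_mono)
    then show ?thesis by (intro mult_nonpos_nonpos) auto
  next
    case False
    then have "?q \<le> ?p" "(norm b)\<^sup>2 \<le> (norm a)\<^sup>2" by (auto intro: power_mono)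
    then show ?thesis by (intro mult_nonneg_nonneg) auto
  qed
  have 2: "0 \<le> (?p + ?q) * (norm (a - b))\<^sup>2" by simp
  show "0 \<le> ?E" using eq 1 2 by linarith
  assume "?E = 0"
  then have "(?p + ?q) * (norm (a - b))\<^sup>2 = 0" using eq 1 2 by linarith
  then consider "?p + ?q = 0" | "a = b" by auto
  then show "a = b"
  proof cases
    case 1
    then have "?p = 0" "?q = 0" by (simp_all add: add_nonneg_eq_0_iff)
    then show ?thesis by simp
  qed
qed

text \<open>The space L^n with a natural exponent over an arbitrary measure. Convergence is stated
  through integrals of n-th powers, so that neither roots nor the triangle inequality of the norm
  are needed.\<close>

definition Lpow :: "nat \<Rightarrow> 'a measure \<Rightarrow> ('a \<Rightarrow> 'b::euclidean_space) set" where
  "Lpow n M = {f. f \<in> borel_measurable M \<and> integrable M (\<lambda>x. norm (f x) ^ n)}"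

definition Lpow_tendsto :: "nat \<Rightarrow> 'a measure \<Rightarrow> (nat \<Rightarrow> 'a \<Rightarrow> 'b::euclidean_space) \<Rightarrow> ('a \<Rightarrow> 'b) \<Rightarrow> bool" where
  "Lpow_tendsto n M f g \<longleftrightarrow> (\<lambda>k. LINT x|M. norm (f k x - g x) ^ n) \<longlonglongrightarrow> 0"

lemma Lpow_measurable: "f \<in> Lpow n M \<Longrightarrow> f \<in> borel_measurable M"
  and Lpow_integrable: "f \<in> Lpow n M \<Longrightarrow> integrable M (\<lambda>x. norm (f x) ^ n)"
  by (auto simp: Lpow_def)

lemma Lpow_add: 
  assumes "f \<in> Lpow n M" "g \<in> Lpow n M"
  shows "(\<lambda>x. f x + g x) \<in> Lpow n M"
proof -
  note [measurable] = Lpow_measurable[OF assms(1)] Lpow_measurable[OF assms(2)]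
  have "integrable M (\<lambda>x. norm (f x + g x) ^ n)"
  proof (rule Bochner_Integration.integrable_bound)
    show "integrable M (\<lambda>x. 2 ^ n * (norm (f x) ^ n + norm (g x) ^ n))"
      using assms by (intro integrable_mult_right Bochner_Integration.integrable_add) (auto simp: Lpow_def)
    have "norm (f x + g x) ^ n \<le> 2 ^ n * (norm (f x) ^ n + norm (g x) ^ n)" for x
      by (rule order_trans[OF power_mono[OF norm_triangle_ineq] power_add_le]) auto
    then show "AE x in M. norm (norm (f x + g x) ^ n) \<le> norm (2 ^ n * (norm (f x) ^ n + norm (g x) ^ n))"
      by (intro AE_I2) simp
  qed measurable
  then show ?thesis by (simp add: Lpow_def)
qed

lemma Lpow_scaleR: "f \<in> Lpow n M \<Longrightarrow> (\<lambda>x. c *\<^sub>R f x) \<in> Lpow n M"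
  by (auto simp: Lpow_def power_mult_distrib)

lemma Lpow_diff: "f \<in> Lpow n M \<Longrightarrow> g \<in> Lpow n M \<Longrightarrow> (\<lambda>x. f x - g x) \<in> Lpow n M"
  using Lpow_add[of f n M "\<lambda>x. (-1) *\<^sub>R g x"] Lpow_scaleR[of g n M "-1"] by simp

lemma Lpow_add_integral_le:
  assumes "f \<in> Lpow n M" "g \<in> Lpow n M"
  shows "(LINT x|M. norm (f x + g x) ^ n) \<le> 2 ^ n * ((LINT x|M. norm (f x) ^ n) + (LINT x|M. norm (g x) ^ n))"
proof -
  have "(LINT x|M. norm (f x + g x) ^ n) \<le> (LINT x|M. 2 ^ n * (norm (f x) ^ n + norm (g x) ^ n))"
  proof (rule integral_mono)
    show "norm (f x + g x) ^ n \<le> 2 ^ n * (norm (f x) ^ n + norm (g x) ^ n)" for x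
      by (rule order_trans[OF power_mono[OF norm_triangle_ineq] power_add_le]) auto
  qed (use assms Lpow_add[OF assms] in \<open>auto simp: Lpow_def\<close>)
  then show ?thesis using assms by (simp add: Lpow_def)
qed

lemma Lpow_tendsto_diff:
  assumes "Lpow_tendsto n M f g" "Lpow_tendsto n M f' g'" "\<And>k. f k \<in> Lpow n M" "g \<in> Lpow n M" "\<And>k. f' k \<in> Lpow n M" "g' \<in> Lpow n M"
  shows "Lpow_tendsto n M (\<lambda>k x. f k x - f' k x) (\<lambda>x. g x - g' x)"
  unfolding Lpow_tendsto_def
proof (rule tendsto_sandwich[OF _ _ tendsto_const])
  let ?h = "\<lambda>k. 2 ^ n * ((LINT x|M. norm (f k x - g x) ^ n) + (LINT x|M. norm (f' k x - g' x) ^ n))"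
  have "(LINT x|M. norm (f k x - f' k x - (g x - g' x)) ^ n) \<le> ?h k" for k
  proof -
    have "(LINT x|M. norm ((f k x - g x) + (g' x - f' k x)) ^ n) \<le> 2 ^ n * ((LINT x|M. norm (f k x - g x) ^ n) + (LINT x|M. norm (g' x - f' k x) ^ n))"
      by (rule Lpow_add_integral_le) (auto intro!: Lpow_diff assms)
    moreover have "f k x - g x + (g' x - f' k x) = f k x - f' k x - (g x - g' x)" for x by simp
    ultimately show ?thesis by (simp add: norm_minus_commute)
  qed
  then show "\<forall>\<^sub>F k in sequentially. (LINT x|M. norm (f k x - f' k x - (g x - g' x)) ^ n) \<le> ?h k" by simp
  have "?h \<longlonglongrightarrow> 2 ^ n * (0 + 0)"
    by (intro tendsto_intros assms(1,2)[unfolded Lpow_tendsto_def])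
  then show "?h \<longlonglongrightarrow> 0" by simp
qed (auto intro!: always_eventually integral_nonneg_AE)

lemma Lpow_mult_integrable:
  fixes G :: "'a \<Rightarrow> 'b::euclidean_space" and Y :: "'a \<Rightarrow> 'c::euclidean_space"
  assumes n: "n \<ge> 1" and "G \<in> Lpow n M" "Y \<in> Lpow n M"
  shows "integrable M (\<lambda>x. norm (G x) ^ (n - 1) * norm (Y x))"
    "l > 0 \<Longrightarrow> (LINT x|M. norm (G x) ^ (n - 1) * norm (Y x)) \<le> l * (LINT x|M. norm (G x) ^ n) + (LINT x|M. norm (Y x) ^ n) / l ^ (n - 1)"
proof -
  note [measurable] = Lpow_measurable[OF assms(2)] Lpow_measurable[OF assms(3)]
  have i: "integrable M (\<lambda>x. l * norm (G x) ^ n + norm (Y x) ^ n / l ^ (n - 1))" for l :: real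
    using assms by (auto simp: Lpow_def)
  have le: "norm (G x) ^ (n - 1) * norm (Y x) \<le> l * norm (G x) ^ n + norm (Y x) ^ n / l ^ (n - 1)" if "l > 0" for x l
    by (rule young_eps[OF _ _ that n]) auto
  show int: "integrable M (\<lambda>x. norm (G x) ^ (n - 1) * norm (Y x))"
  proof (rule Bochner_Integration.integrable_bound[OF i[of 1]])
    show "AE x in M. norm (norm (G x) ^ (n - 1) * norm (Y x)) \<le> norm (1 * norm (G x) ^ n + norm (Y x) ^ n / 1 ^ (n - 1))"
      using le[of 1] by (intro AE_I2) simp
  qed measurable
  assume l: "l > 0"
  have "(LINT x|M. norm (G x) ^ (n - 1) * norm (Y x)) \<le> (LINT x|M. l * norm (G x) ^ n + norm (Y x) ^ n / l ^ (n - 1))"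
    by (rule integral_mono[OF int i le[OF l]])
  then show "(LINT x|M. norm (G x) ^ (n - 1) * norm (Y x)) \<le> l * (LINT x|M. norm (G x) ^ n) + (LINT x|M. norm (Y x) ^ n) / l ^ (n - 1)"
    using assms by (simp add: Lpow_def)
qed

text \<open>By Young's inequality with weight l: a small l settles the term with G, and then large k
  settles the term with Y, whose factor l^(1-n) is by then fixed.\<close>

lemma Lpow_mult_tendsto_0:
  fixes G :: "'a \<Rightarrow> 'b::euclidean_space" and Y :: "nat \<Rightarrow> 'a \<Rightarrow> 'c::euclidean_space"
  assumes n: "n \<ge> 1" and G: "G \<in> Lpow n M" and Y: "\<And>k. Y k \<in> Lpow n M" "(\<lambda>k. LINT x|M. norm (Y k x) ^ n) \<longlonglongrightarrow> 0"
  shows "(\<lambda>k. LINT x|M. norm (G x) ^ (n - 1) * norm (Y k x)) \<longlonglongrightarrow> 0"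
proof (rule LIMSEQ_I)
  fix \<epsilon> :: real assume \<epsilon>: "\<epsilon> > 0"
  let ?g = "LINT x|M. norm (G x) ^ n"
  have g: "0 \<le> ?g" by (intro integral_nonneg_AE) auto
  \<comment> \<open>Adding 1 avoids division by zero when G vanishes.\<close>
  define A where "A = ?g + 1"
  have A: "A > 0" "?g < A" using g unfolding A_def by linarith+
  define l where "l = \<epsilon> / (2 * A)"
  have l: "l > 0" using \<epsilon> A by (simp add: l_def)
  have lg: "l * ?g < \<epsilon> / 2"
  proof -
    have "l * ?g < l * A" using l A by simp
    also have "l * A = \<epsilon> / 2" using A by (simp add: l_def)
    finally show ?thesis .
  qed
  have "\<epsilon> / 2 * l ^ (n - 1) > 0" using \<epsilon> l by simp
  from LIMSEQ_D[OF Y(2) this] obtain k0 where k0: "\<And>k. k \<ge> k0 \<Longrightarrow> (LINT x|M. norm (Y k x) ^ n) < \<epsilon> / 2 * l ^ (n - 1)"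
    by (force simp: abs_less_iff)
  have "norm ((LINT x|M. norm (G x) ^ (n - 1) * norm (Y k x)) - 0) < \<epsilon>" if "k \<ge> k0" for k
  proof -
    have "(LINT x|M. norm (Y k x) ^ n) / l ^ (n - 1) < \<epsilon> / 2"
      using k0[OF that] l by (simp add: pos_divide_less_eq)
    then have "(LINT x|M. norm (G x) ^ (n - 1) * norm (Y k x)) < \<epsilon>"
      using Lpow_mult_integrable(2)[OF n G Y(1) l, of k] lg by linarith
    moreover have "0 \<le> (LINT x|M. norm (G x) ^ (n - 1) * norm (Y k x))" by (intro integral_nonneg_AE) auto
    ultimately show ?thesis by simp
  qed
  then show "\<exists>no. \<forall>k\<ge>no. norm ((LINT x|M. norm (G x) ^ (n - 1) * norm (Y k x)) - 0) < \<epsilon>" by blast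
qed

lemma tendsto_if_abs_diff_le:
  fixes L :: real
  assumes "\<And>k. \<bar>a k - L\<bar> \<le> b k" "b \<longlonglongrightarrow> 0"
  shows "a \<longlonglongrightarrow> L"
proof (rule LIM_zero_cancel, rule Lim_null_comparison[OF _ assms(2)])
  show "\<forall>\<^sub>F k in sequentially. norm (a k - L) \<le> b k" using assms(1) by simp
qed

text \<open>The difference of n-th powers is at most a multiple of |g|^(n-1) |f - g| plus a multiple
  of |f - g|^n; the first tends to 0 in mean by the mixed estimate, the second by
  assumption.\<close>

lemma Lpow_tendsto_integral_power:
  fixes g :: "'a \<Rightarrow> 'b::euclidean_space"
  assumes n: "n \<ge> 1" and f: "\<And>k. f k \<in> Lpow n M" and g: "g \<in> Lpow n M" and lim: "Lpow_tendsto n M f g"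
  shows "(\<lambda>k. LINT x|M. norm (f k x) ^ n) \<longlonglongrightarrow> (LINT x|M. norm (g x) ^ n)"
proof -
  let ?d = "\<lambda>k x. f k x - g x"
  let ?A = "real n * 2 ^ (n - 1) * 2 ^ (n - 1)" and ?B = "real n * 2 ^ (n - 1)"
  have d: "?d k \<in> Lpow n M" for k by (rule Lpow_diff[OF f g])
  have l1: "(\<lambda>k. LINT x|M. norm (g x) ^ (n - 1) * norm (?d k x)) \<longlonglongrightarrow> 0"
    by (rule Lpow_mult_tendsto_0[OF n g d lim[unfolded Lpow_tendsto_def]])
  have p: "\<bar>norm (f k x) ^ n - norm (g x) ^ n\<bar> \<le> ?A * (norm (g x) ^ (n - 1) * norm (?d k x)) + ?B * norm (?d k x) ^ n" for k x
  proof -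
    let ?c = "2 * norm (g x) + norm (?d k x)"
    have "norm (f k x) \<le> norm (g x) + norm (?d k x)" using norm_triangle_sub[of "f k x" "g x"] by (simp add: add.commute)
    then have fc: "norm (f k x) \<le> ?c" using norm_ge_zero[of "g x"] by linarith
    have gc: "norm (g x) \<le> ?c" by simp
    have "\<bar>norm (f k x) ^ n - norm (g x) ^ n\<bar> \<le> real n * ?c ^ (n - 1) * \<bar>norm (f k x) - norm (g x)\<bar>"
      by (rule abs_power_diff_le[OF norm_ge_zero fc norm_ge_zero gc])
    also have "\<dots> \<le> real n * (2 ^ (n - 1) * ((2 * norm (g x)) ^ (n - 1) + norm (?d k x) ^ (n - 1))) * norm (?d k x)"
      by (intro mult_mono mult_left_mono power_add_le norm_triangle_ineq3) auto
    also have "\<dots> = ?A * (norm (g x) ^ (n - 1) * norm (?d k x)) + ?B * (norm (?d k x) ^ (n - 1) * norm (?d k x))"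
      by (simp add: algebra_simps power_mult_distrib)
    finally show ?thesis by (simp only: power_pred_mult[OF n])
  qed
  have "\<bar>(LINT x|M. norm (f k x) ^ n) - (LINT x|M. norm (g x) ^ n)\<bar> \<le>
      ?A * (LINT x|M. norm (g x) ^ (n - 1) * norm (?d k x)) + ?B * (LINT x|M. norm (?d k x) ^ n)" for k
  proof -
    note i = Lpow_integrable[OF f[of k]] Lpow_integrable[OF g] Lpow_integrable[OF d[of k]] Lpow_mult_integrable(1)[OF n g d[of k]]
    have "\<bar>(LINT x|M. norm (f k x) ^ n) - (LINT x|M. norm (g x) ^ n)\<bar> = \<bar>LINT x|M. norm (f k x) ^ n - norm (g x) ^ n\<bar>"
      using i by simp
    also have "\<dots> \<le> (LINT x|M. ?A * (norm (g x) ^ (n - 1) * norm (?d k x)) + ?B * norm (?d k x) ^ n)"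
      by (rule order_trans[OF integral_abs_bound integral_mono[OF _ _ p]]) (use i in auto)
    finally show ?thesis using i by simp
  qed
  moreover
  have "(\<lambda>k. ?A * (LINT x|M. norm (g x) ^ (n - 1) * norm (?d k x)) + ?B * (LINT x|M. norm (?d k x) ^ n)) \<longlonglongrightarrow> ?A * 0 + ?B * 0"
    by (intro tendsto_intros l1 lim[unfolded Lpow_tendsto_def])
  then have "(\<lambda>k. ?A * (LINT x|M. norm (g x) ^ (n - 1) * norm (?d k x)) + ?B * (LINT x|M. norm (?d k x) ^ n)) \<longlonglongrightarrow> 0" by simp
  ultimately show ?thesis by (rule tendsto_if_abs_diff_le)
qed

text \<open>Consecutive differences are so small in \<open>L\<^sup>n\<close> that their \<open>n\<close>-th powers stay summable after
  multiplication by \<open>2\<^bsup>n k\<^esup>\<close>; hence the differences are pointwise \<open>O(2\<^bsup>-k\<^esup>)\<close> almost everywhere.\<close>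

lemma Lpow_complete:
  fixes f :: "nat \<Rightarrow> 'a \<Rightarrow> 'b::euclidean_space"
  assumes n: "n \<ge> 1" and f: "\<And>k. f k \<in> Lpow n M"
    and cauchy: "\<And>k j. k \<le> j \<Longrightarrow> (LINT x|M. norm (f j x - f k x) ^ n) \<le> B * (1 / 4 ^ n) ^ k"
  obtains g where "g \<in> Lpow n M" "Lpow_tendsto n M f g"
proof -
  note [measurable] = Lpow_measurable[OF f]
  have B: "B \<ge> 0" using cauchy[of 0 0] n by (simp add: power_0_left)
  define a where "a k x = (2 ^ n) ^ k * norm (f (Suc k) x - f k x) ^ n" for k x
  have a0: "0 \<le> a k x" for k x by (simp add: a_def)
  have ia: "integrable M (a k)" for k
    unfolding a_def[abs_def] using Lpow_integrable[OF Lpow_diff[OF f f]] by simp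
  have am[measurable]: "a k \<in> borel_measurable M" for k using ia by auto
  have aI: "(LINT x|M. a k x) \<le> B * (1 / 2) ^ k" for k
  proof -
    have "(LINT x|M. a k x) = (2 ^ n) ^ k * (LINT x|M. norm (f (Suc k) x - f k x) ^ n)" by (simp add: a_def)
    also have "\<dots> \<le> (2 ^ n) ^ k * (B * (1 / 4 ^ n) ^ k)" by (intro mult_left_mono cauchy) auto
    also have "\<dots> = B * ((1 / 2) ^ n) ^ k"
    proof -
      have "(2 ^ n * (1 / 4 ^ n)) = ((1 / 2) ^ n :: real)" by (simp add: power_divide[symmetric] power_mult_distrib[symmetric] flip: power_mult_distrib power_divide)
      then show ?thesis by (simp add: power_mult_distrib[symmetric] mult.left_commute)
    qed
    also have "\<dots> \<le> B * (1 / 2) ^ k"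
    proof (intro mult_left_mono power_mono B)
      show "(1 / 2) ^ n \<le> (1 / 2 :: real)" using power_decreasing[of 1 n "1 / 2 :: real"] n by simp
    qed auto
    finally show ?thesis .
  qed
  have "AE x in M. summable (\<lambda>k. a k x)"
  proof -
    have "(\<integral>\<^sup>+x. (\<Sum>k. ennreal (a k x)) \<partial>M) = (\<Sum>k. \<integral>\<^sup>+x. ennreal (a k x) \<partial>M)"
      by (rule nn_integral_suminf) measurable
    also have "\<dots> = (\<Sum>k. ennreal (LINT x|M. a k x))"
      using a0 ia by (simp add: nn_integral_eq_integral)
    also have "\<dots> \<le> (\<Sum>k. ennreal (B * (1 / 2) ^ k))"
      by (intro suminf_le ennreal_leI aI) auto
    also have "\<dots> = ennreal (\<Sum>k. B * (1 / 2) ^ k)"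
      by (rule suminf_ennreal2) (use B in \<open>auto intro!: summable_mult summable_geometric\<close>)
    finally have "(\<integral>\<^sup>+x. (\<Sum>k. ennreal (a k x)) \<partial>M) \<noteq> \<infinity>" by (auto simp: top_unique)
    then have "AE x in M. (\<Sum>k. ennreal (a k x)) \<noteq> \<infinity>"
      by (intro nn_integral_noteq_infinite) measurable
    then show ?thesis
      by (rule eventually_mono) (auto intro!: summable_suminf_not_top a0)
  qed
  then have conv: "AE x in M. convergent (\<lambda>k. f k x)"
  proof (rule eventually_mono)
    fix x assume "summable (\<lambda>k. a k x)"
    then have "(\<lambda>k. a k x) \<longlonglongrightarrow> 0" by (rule summable_LIMSEQ_zero)
    then have "\<forall>\<^sub>F k in sequentially. a k x < 1" by (rule order_tendstoD) simp
    then have "\<forall>\<^sub>F k in sequentially. norm (f (Suc k) x - f k x) \<le> (1 / 2) ^ k"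
    proof (rule eventually_mono)
      fix k assume "a k x < 1"
      then have "(2 ^ k * norm (f (Suc k) x - f k x)) ^ n < 1 ^ n"
        by (simp add: a_def power_mult_distrib power_mult[symmetric] mult.commute)
      then have "2 ^ k * norm (f (Suc k) x - f k x) < 1" by (rule power_less_imp_less_base) simp
      then show "norm (f (Suc k) x - f k x) \<le> (1 / 2) ^ k" by (simp add: field_simps power_divide)
    qed
    then have "summable (\<lambda>k. f (Suc k) x - f k x)"
      by (rule summable_comparison_test_ev) (simp add: summable_geometric)
    then have "convergent (\<lambda>m. \<Sum>k<m. f (Suc k) x - f k x)" by (rule summable_iff_convergent[THEN iffD1])
    then have "convergent (\<lambda>m. (f m x - f 0 x) + f 0 x)"
      unfolding sum_lessThan_telescope[of "\<lambda>k. f k x"] by (intro convergent_add convergent_const)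
    then show "convergent (\<lambda>k. f k x)" by simp
  qed
  define g where "g x = lim (\<lambda>k. f k x)" for x
  have gm[measurable]: "g \<in> borel_measurable M"
    unfolding g_def[abs_def] by (rule borel_measurable_lim_metric) measurable
  have lim: "AE x in M. (\<lambda>k. f k x) \<longlonglongrightarrow> g x"
    using conv by (rule eventually_mono) (simp add: g_def convergent_LIMSEQ_iff)
  \<comment> \<open>Fatou's lemma for j to infinity passes the Cauchy rate on to the limit, which
    also shows that f k - g belongs to L^n.\<close>
  have nn: "(\<integral>\<^sup>+x. ennreal (norm (f k x - g x) ^ n) \<partial>M) \<le> ennreal (B * (1 / 4 ^ n) ^ k)" for k
  proof -
    have "(\<integral>\<^sup>+x. ennreal (norm (f k x - g x) ^ n) \<partial>M) = (\<integral>\<^sup>+x. liminf (\<lambda>j. ennreal (norm (f k x - f j x) ^ n)) \<partial>M)"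
    proof (rule nn_integral_cong_AE, use lim in \<open>rule eventually_mono\<close>)
      fix x assume "(\<lambda>k. f k x) \<longlonglongrightarrow> g x"
      then have "(\<lambda>j. ennreal (norm (f k x - f j x) ^ n)) \<longlonglongrightarrow> ennreal (norm (f k x - g x) ^ n)"
        by (intro tendsto_intros)
      then show "ennreal (norm (f k x - g x) ^ n) = liminf (\<lambda>j. ennreal (norm (f k x - f j x) ^ n))"
        by (rule lim_imp_Liminf[symmetric, rotated]) simp
    qed
    also have "\<dots> \<le> liminf (\<lambda>j. \<integral>\<^sup>+x. ennreal (norm (f k x - f j x) ^ n) \<partial>M)"
      by (rule nn_integral_liminf) measurable
    also have "\<dots> \<le> liminf (\<lambda>j. ennreal (B * (1 / 4 ^ n) ^ k))"
    proof (rule Liminf_mono, rule eventually_sequentiallyI[of k])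
      fix j assume "k \<le> j"
      have "(\<integral>\<^sup>+x. ennreal (norm (f k x - f j x) ^ n) \<partial>M) = ennreal (LINT x|M. norm (f j x - f k x) ^ n)"
        using Lpow_integrable[OF Lpow_diff[OF f f]] by (simp add: nn_integral_eq_integral norm_minus_commute)
      also have "\<dots> \<le> ennreal (B * (1 / 4 ^ n) ^ k)" by (intro ennreal_leI cauchy[OF \<open>k \<le> j\<close>])
      finally show "(\<integral>\<^sup>+x. ennreal (norm (f k x - f j x) ^ n) \<partial>M) \<le> ennreal (B * (1 / 4 ^ n) ^ k)" .
    qed
    also have "\<dots> = ennreal (B * (1 / 4 ^ n) ^ k)" by (simp add: Liminf_const)
    finally show ?thesis .
  qed
  have d: "(\<lambda>x. f k x - g x) \<in> Lpow n M" for k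
    unfolding Lpow_def
  proof (safe, measurable, rule integrableI_bounded)
    show "(\<integral>\<^sup>+x. ennreal (norm (norm (f k x - g x) ^ n)) \<partial>M) < \<infinity>"
      using le_less_trans[OF nn ennreal_less_top] by (simp add: top.not_eq_extremum)
  qed measurable
  have "(\<lambda>x. f 0 x - (f 0 x - g x)) \<in> Lpow n M" by (rule Lpow_diff[OF f d])
  then have g: "g \<in> Lpow n M" by simp
  moreover have "Lpow_tendsto n M f g"
    unfolding Lpow_tendsto_def
  proof (rule tendsto_sandwich[OF _ _ tendsto_const])
    have "(LINT x|M. norm (f k x - g x) ^ n) \<le> B * (1 / 4 ^ n) ^ k" for k
    proof -
      have "ennreal (LINT x|M. norm (f k x - g x) ^ n) \<le> ennreal (B * (1 / 4 ^ n) ^ k)"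
        using nn[of k] Lpow_integrable[OF d[of k]] by (simp add: nn_integral_eq_integral)
      then show ?thesis using B by (simp add: ennreal_le_iff)
    qed
    then show "\<forall>\<^sub>F k in sequentially. (LINT x|M. norm (f k x - g x) ^ n) \<le> B * (1 / 4 ^ n) ^ k" by simp
    have "(\<lambda>k. B * (1 / 4 ^ n) ^ k) \<longlonglongrightarrow> B * 0"
      by (intro tendsto_intros LIMSEQ_power_zero) (use n in \<open>auto simp: one_less_power\<close>)
    then show "(\<lambda>k. B * (1 / 4 ^ n) ^ k) \<longlonglongrightarrow> 0" by simp
  qed (auto intro!: always_eventually integral_nonneg_AE)
  ultimately show ?thesis by (rule that)
qed

text \<open>Directional differentiability of the energy, along the steps 1/(k+1) \<le> 1 only. The
  mean value bound with base |G| + |H| dominates all difference quotients.\<close>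

lemma Lpow_energy_derivative:
  fixes G H :: "'a \<Rightarrow> 'b::euclidean_space"
  assumes n: "n \<ge> 2" and G: "G \<in> Lpow n M" and H: "H \<in> Lpow n M"
  shows "(\<lambda>k. ((LINT x|M. norm (G x + (1 / real (Suc k)) *\<^sub>R H x) ^ n) - (LINT x|M. norm (G x) ^ n)) / (1 / real (Suc k)))
    \<longlonglongrightarrow> real n * (LINT x|M. (norm (G x) ^ (n - 2) *\<^sub>R G x) \<bullet> H x)"
proof -
  note [measurable] = Lpow_measurable[OF G] Lpow_measurable[OF H]
  define t where "t k = 1 / real (Suc k)" for k
  have t: "0 < t k" "t k \<le> 1" for k by (auto simp: t_def)
  let ?q = "\<lambda>k x. (norm (G x + t k *\<^sub>R H x) ^ n - norm (G x) ^ n) / t k"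
  have iG: "(\<lambda>x. G x + t k *\<^sub>R H x) \<in> Lpow n M" for k by (intro Lpow_add G Lpow_scaleR H)
  have i: "integrable M (\<lambda>x. real n * (2 ^ n * (norm (G x) ^ n + norm (H x) ^ n)))"
    using Lpow_integrable[OF G] Lpow_integrable[OF H] by simp
  have "(\<lambda>k. LINT x|M. ?q k x) \<longlonglongrightarrow> (LINT x|M. real n * ((norm (G x) ^ (n - 2) *\<^sub>R G x) \<bullet> H x))"
  proof (rule integral_dominated_convergence[OF _ _ i])
    show "AE x in M. (\<lambda>k. ?q k x) \<longlonglongrightarrow> real n * ((norm (G x) ^ (n - 2) *\<^sub>R G x) \<bullet> H x)"
    proof (intro AE_I2)
      fix x
      have "((\<lambda>s. norm (G x + s *\<^sub>R H x) ^ n) has_real_derivative (real n * ((norm (G x) ^ (n - 2) *\<^sub>R G x) \<bullet> H x))) (at 0)"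
        using DERIV_along_line[of "\<lambda>y. norm y ^ n" _ "G x" 0 "H x"] has_derivative_norm_power[OF n, of "G x"]
        by (simp add: mult.assoc)
      then have "((\<lambda>s. (norm (G x + s *\<^sub>R H x) ^ n - norm (G x) ^ n) / s) \<longlongrightarrow> real n * ((norm (G x) ^ (n - 2) *\<^sub>R G x) \<bullet> H x)) (at 0)"
        by (simp add: DERIV_def)
      moreover have "filterlim t (at 0) sequentially"
        unfolding filterlim_at using t(1) LIMSEQ_inverse_real_of_nat
        by (auto simp: t_def[abs_def] inverse_eq_divide intro!: always_eventually)
      ultimately show "(\<lambda>k. ?q k x) \<longlonglongrightarrow> real n * ((norm (G x) ^ (n - 2) *\<^sub>R G x) \<bullet> H x)"
        by (rule filterlim_compose)
    qed
    show "AE x in M. norm (?q k x) \<le> real n * (2 ^ n * (norm (G x) ^ n + norm (H x) ^ n))" for k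
    proof (intro AE_I2)
      fix x
      let ?c = "norm (G x) + norm (H x)"
      have tH: "norm (t k *\<^sub>R H x) \<le> norm (H x)"
        using t[of k] mult_right_mono[of "t k" 1 "norm (H x)"] by simp
      have 1: "norm (G x + t k *\<^sub>R H x) \<le> ?c" using norm_triangle_ineq[of "G x" "t k *\<^sub>R H x"] tH by linarith
      have "\<bar>norm (G x + t k *\<^sub>R H x) ^ n - norm (G x) ^ n\<bar> \<le> real n * ?c ^ (n - 1) * \<bar>norm (G x + t k *\<^sub>R H x) - norm (G x)\<bar>"
        by (rule abs_power_diff_le[OF norm_ge_zero 1 norm_ge_zero]) simp
      also have "\<dots> \<le> real n * ?c ^ (n - 1) * (t k * ?c)"
      proof (intro mult_left_mono)
        have "\<bar>norm (G x + t k *\<^sub>R H x) - norm (G x)\<bar> \<le> norm (t k *\<^sub>R H x)"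
          using norm_triangle_ineq3[of "G x + t k *\<^sub>R H x" "G x"] by simp
        also have "\<dots> = t k * norm (H x)" using t(1)[of k] by simp
        also have "\<dots> \<le> t k * ?c" using t(1)[of k] by (intro mult_left_mono) auto
        finally show "\<bar>norm (G x + t k *\<^sub>R H x) - norm (G x)\<bar> \<le> t k * ?c" .
      qed auto
      also have "\<dots> = t k * (real n * (?c ^ (n - 1) * ?c))" by simp
      also have "?c ^ (n - 1) * ?c = ?c ^ n" using n by (intro power_pred_mult) auto
      finally have "norm (?q k x) \<le> real n * ?c ^ n"
        using t(1)[of k] by (simp add: abs_divide pos_divide_le_eq mult.commute)
      also have "\<dots> \<le> real n * (2 ^ n * (norm (G x) ^ n + norm (H x) ^ n))"
        by (intro mult_left_mono power_add_le) auto
      finally show "norm (?q k x) \<le> real n * (2 ^ n * (norm (G x) ^ n + norm (H x) ^ n))" .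
    qed
  qed measurable
  then show ?thesis
    using Lpow_integrable[OF G] Lpow_integrable[OF iG] by (simp add: t_def)
qed

section \<open>The variational problem\<close>

text \<open>The geometry of the boundary reaches the variational argument through the estimate
  assumed in \<open>dirichlet_minimizer\<close>. Here n and \<mu> abbreviate the dimension and
  Lebesgue measure on \<Omega>.\<close>

locale bounded_domain =
  fixes \<Omega> :: "(real^'n) set" and n :: nat and \<mu> :: "(real^'n) measure"
  assumes n_def: "n = CARD('n)" and \<mu>_def: "\<mu> = lebesgue_on \<Omega>"
    and n2: "n \<ge> 2" and \<Omega>: "open \<Omega>" "bounded \<Omega>"
begin

section \<open>Sobolev norms and test functions in terms of n-th powers\<close>

lemma n1: "n \<ge> 1" using n2 by simp

lemma \<Omega>_sets: "\<Omega> \<in> sets lebesgue" using \<Omega>(1) by auto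

lemma finite_\<mu>: "finite_measure \<mu>"
  unfolding \<mu>_def using \<Omega>(2) \<Omega>_sets by (intro finite_measure_lebesgue_on bounded_set_imp_lmeasurable)

lemma powr_n: "norm x powr real n = norm x ^ n"
  using n1 by (cases "norm x = 0") (auto simp: powr_realpow power_0_left)

lemma Lp_iff: "f \<in> Lp (real n) \<Omega> \<longleftrightarrow> f \<in> Lpow n \<mu>"
  unfolding Lp_def Lpow_def \<mu>_def powr_n by simp

lemma Lp_norm_eq: "Lp_norm (real n) \<Omega> f = (LINT x|\<mu>. norm (f x) ^ n) powr (1 / real n)"
  unfolding Lp_norm_def \<mu>_def powr_n by simp

lemma Lp_norm_power: "Lp_norm (real n) \<Omega> f ^ n = (LINT x|\<mu>. norm (f x) ^ n)"
proof -
  have "0 \<le> (LINT x|\<mu>. norm (f x) ^ n)" by (intro integral_nonneg_AE) auto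
  then show ?thesis
    unfolding Lp_norm_eq using n1
    by (cases "(LINT x|\<mu>. norm (f x) ^ n) = 0") (auto simp: powr_realpow[symmetric] powr_powr power_0_left)
qed

lemma Lp_norm_nonneg: "0 \<le> Lp_norm (real n) \<Omega> f"
  by (simp add: Lp_norm_eq)

lemma Lpow_compact_support:
  fixes f :: "real^'n \<Rightarrow> 'b::euclidean_space"
  assumes "continuous_on UNIV f" "compact K" "K \<subseteq> \<Omega>" "\<And>x. x \<notin> K \<Longrightarrow> f x = 0"
  shows "f \<in> Lpow n \<mu>" "(LINT x|\<mu>. norm (f x) ^ n) = (LINT x|lborel. norm (f x) ^ n)"
proof -
  have c: "continuous_on UNIV (\<lambda>x. norm (f x) ^ n)" by (intro continuous_intros assms)
  have z: "norm (f x) ^ n = 0" if "x \<notin> K" for x using assms(4)[OF that] n1 by (simp add: power_0_left)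
  have z': "norm (f x) ^ n = 0" if "x \<notin> \<Omega>" for x using that assms(3) by (intro z) blast
  show "(LINT x|\<mu>. norm (f x) ^ n) = (LINT x|lborel. norm (f x) ^ n)"
    unfolding \<mu>_def by (rule integral_lebesgue_on_eq_lborel(1)[OF c \<Omega>_sets z'])
  have "integrable \<mu> (\<lambda>x. norm (f x) ^ n)"
    unfolding \<mu>_def
    using integral_lebesgue_on_eq_lborel(2)[OF c \<Omega>_sets z'] integrable_compact_support[OF c assms(2) z] by blast
  then show "f \<in> Lpow n \<mu>"
    unfolding Lpow_def \<mu>_def using borel_measurable_continuous_lebesgue_on[OF assms(1)] by blast
qed

abbreviation J :: "(real^'n \<Rightarrow> real^'n) \<Rightarrow> real^'n \<Rightarrow> real^'n^'n" where
  "J \<Phi> \<equiv> \<lambda>x. jacobian \<Phi> (at x)"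

lemma test_Ln:
  assumes "\<Phi> \<in> test_functions \<Omega>"
  shows "\<Phi> \<in> Lpow n \<mu>" "J \<Phi> \<in> Lpow n \<mu>"
    "(LINT x|\<mu>. norm (\<Phi> x) ^ n) = (LINT x|lborel. norm (\<Phi> x) ^ n)"
    "(LINT x|\<mu>. norm (J \<Phi> x) ^ n) = (LINT x|lborel. norm (J \<Phi> x) ^ n)"
proof -
  obtain K where K: "smooth \<Phi>" "compact K" "K \<subseteq> \<Omega>" "\<And>x. x \<notin> K \<Longrightarrow> \<Phi> x = 0"
    using test_functionsE[OF assms] by blast
  note 1 = Lpow_compact_support[OF smooth_continuous[OF K(1)] K(2,3,4)]
  note 2 = Lpow_compact_support[OF continuous_on_jacobian[OF K(1)] K(2,3) jacobian_off_support[OF K(1,2,4)]]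
  show "\<Phi> \<in> Lpow n \<mu>" "J \<Phi> \<in> Lpow n \<mu>"
    "(LINT x|\<mu>. norm (\<Phi> x) ^ n) = (LINT x|lborel. norm (\<Phi> x) ^ n)"
    "(LINT x|\<mu>. norm (J \<Phi> x) ^ n) = (LINT x|lborel. norm (J \<Phi> x) ^ n)"
    using 1 2 by blast+
qed

lemma test_add_scaleR:
  assumes "\<Phi> \<in> test_functions \<Omega>" "\<Psi> \<in> test_functions \<Omega>"
  shows "(\<lambda>x. \<Phi> x + c *\<^sub>R \<Psi> x) \<in> test_functions \<Omega>"
    and "J (\<lambda>x. \<Phi> x + c *\<^sub>R \<Psi> x) x = J \<Phi> x + c *\<^sub>R J \<Psi> x"
proof -
  obtain K where K: "smooth \<Phi>" "compact K" "K \<subseteq> \<Omega>" "\<And>x. x \<notin> K \<Longrightarrow> \<Phi> x = 0"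
    using test_functionsE[OF assms(1)] by blast
  obtain K' where K': "smooth \<Psi>" "compact K'" "K' \<subseteq> \<Omega>" "\<And>x. x \<notin> K' \<Longrightarrow> \<Psi> x = 0"
    using test_functionsE[OF assms(2)] by blast
  have "smooth (\<lambda>x. \<Phi> x + c *\<^sub>R \<Psi> x)"
    by (intro smooth_add K(1) smooth_linear[OF bounded_linear_scaleR_right K'(1)])
  moreover have "\<exists>K. compact K \<and> K \<subseteq> \<Omega> \<and> (\<forall>x. x \<notin> K \<longrightarrow> \<Phi> x + c *\<^sub>R \<Psi> x = 0)"
  proof (intro exI[of _ "K \<union> K'"] conjI allI impI)
    show "\<Phi> x + c *\<^sub>R \<Psi> x = 0" if "x \<notin> K \<union> K'" for x using that K(4)[of x] K'(4)[of x] by simp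
  qed (use K K' in auto)
  ultimately show "(\<lambda>x. \<Phi> x + c *\<^sub>R \<Psi> x) \<in> test_functions \<Omega>"
    unfolding test_functions_def by blast
  have "((\<lambda>x. \<Phi> x + c *\<^sub>R \<Psi> x) has_derivative (\<lambda>v. frechet_derivative \<Phi> (at x) v + c *\<^sub>R frechet_derivative \<Psi> (at x) v)) (at x)"
    by (intro has_derivative_add has_derivative_scaleR_right smooth_has_derivative K(1) K'(1))
  from frechet_derivative_at[OF this] show "J (\<lambda>x. \<Phi> x + c *\<^sub>R \<Psi> x) x = J \<Phi> x + c *\<^sub>R J \<Psi> x"
    by (simp add: vec_eq_iff jacobian_nth fun_eq_iff)
qed

lemma zero_test: "(\<lambda>x. 0) \<in> test_functions \<Omega>" and J_zero: "J (\<lambda>x. 0) x = 0"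
proof -
  show "(\<lambda>x. 0) \<in> test_functions \<Omega>"
    unfolding test_functions_def by (auto intro: smooth_const exI[of _ "{}"])
  show "J (\<lambda>x. 0) x = 0"
    by (simp add: vec_eq_iff jacobian_nth frechet_derivative_at[OF has_derivative_const, symmetric])
qed

lemma test_diff:
  assumes "\<Phi> \<in> test_functions \<Omega>" "\<Psi> \<in> test_functions \<Omega>"
  shows "(\<lambda>x. \<Phi> x - \<Psi> x) \<in> test_functions \<Omega>" "J (\<lambda>x. \<Phi> x - \<Psi> x) x = J \<Phi> x - J \<Psi> x"
  using test_add_scaleR[OF assms, of "-1"] by simp_all

lemma poincare_test: "\<exists>P\<ge>0. \<forall>\<Phi>\<in>test_functions \<Omega>. (LINT x|\<mu>. norm (\<Phi> x) ^ n) \<le> P * (LINT x|\<mu>. norm (J \<Phi> x) ^ n)"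
proof -
  obtain R where "R > 0" "\<forall>x\<in>\<Omega>. norm x \<le> R"
    using \<Omega>(2) unfolding bounded_pos by blast
  then have R: "R \<ge> 0" "\<Omega> \<subseteq> cball 0 R" by auto
  show ?thesis
  proof (intro exI[of _ "poincare_const n R"] conjI ballI)
    show "0 \<le> poincare_const n R" using R by (simp add: poincare_const_def)
    fix \<Phi> :: "real^'n \<Rightarrow> real^'n" assume t: "\<Phi> \<in> test_functions \<Omega>"
    obtain K where K: "smooth \<Phi>" "compact K" "K \<subseteq> \<Omega>" "\<And>x. x \<notin> K \<Longrightarrow> \<Phi> x = 0"
      using test_functionsE[OF t] by blast
    show "(LINT x|\<mu>. norm (\<Phi> x) ^ n) \<le> poincare_const n R * (LINT x|\<mu>. norm (J \<Phi> x) ^ n)"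
      unfolding test_Ln(3,4)[OF t]
      by (rule poincare[OF n2 K(1,2,4) _ R(1)]) (use K(3) R(2) in auto)
  qed
qed

lemma const_Ln: "(\<lambda>_. c) \<in> Lpow n \<mu>"
  unfolding Lpow_def using finite_measure.integrable_const[OF finite_\<mu>] by simp

lemma Lpow_integrable_norm:
  assumes "f \<in> Lpow n \<mu>" shows "integrable \<mu> f"
proof -
  have "integrable \<mu> (\<lambda>x. norm (1::real) ^ (n - 1) * norm (f x))"
    by (rule Lpow_mult_integrable(1)[OF n1 const_Ln assms])
  then show ?thesis using Lpow_measurable[OF assms] by (simp add: integrable_norm_iff)
qed

lemma Lpow_L1_loc:
  assumes "f \<in> Lpow n \<mu>" shows "f \<in> L1_loc \<Omega>"
  unfolding L1_loc_def
proof (safe)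
  show "f \<in> borel_measurable (lebesgue_on \<Omega>)" using Lpow_measurable[OF assms] by (simp add: \<mu>_def)
  fix K assume K: "compact K" "K \<subseteq> \<Omega>"
  have Ks: "K \<in> sets lebesgue" using K(1) by (simp add: lmeasurable_compact fmeasurableD)
  have "integrable lebesgue (\<lambda>x. indicator \<Omega> x *\<^sub>R f x)"
    using Lpow_integrable_norm[OF assms] \<Omega>_sets by (simp add: \<mu>_def integrable_restrict_space)
  then have "integrable lebesgue (\<lambda>x. indicator K x *\<^sub>R (indicator \<Omega> x *\<^sub>R f x))"
    by (rule integrable_mult_indicator[OF Ks])
  moreover have "(\<lambda>x. indicator K x *\<^sub>R (indicator \<Omega> x *\<^sub>R f x)) = (\<lambda>x. indicator K x *\<^sub>R f x)"
    using K(2) by (auto simp: indicator_def fun_eq_iff)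
  ultimately show "integrable (lebesgue_on K) f"
    using Ks by (simp add: integrable_restrict_space)
qed

text \<open>Meant for L a coordinate functional and \<psi> a test function or one of its partial
  derivatives; on a finite measure space L^n convergence is enough for such integrals to
  converge.\<close>

lemma Lpow_pairing_tendsto:
  fixes f :: "nat \<Rightarrow> real^'n \<Rightarrow> 'b::euclidean_space" and L :: "'b \<Rightarrow> real"
  assumes f: "\<And>k. f k \<in> Lpow n \<mu>" and g: "g \<in> Lpow n \<mu>" and lim: "Lpow_tendsto n \<mu> f g"
    and L: "bounded_linear L" "\<And>y. \<bar>L y\<bar> \<le> norm y"
    and \<psi>: "continuous_on UNIV \<psi>" "\<And>x. \<bar>\<psi> x\<bar> \<le> B"
  shows "(\<lambda>k. LINT x|\<mu>. L (f k x) * \<psi> x) \<longlonglongrightarrow> (LINT x|\<mu>. L (g x) * \<psi> x)"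
proof -
  have d: "(\<lambda>x. f k x - g x) \<in> Lpow n \<mu>" for k by (rule Lpow_diff[OF f g])
  have \<psi>m: "\<psi> \<in> borel_measurable \<mu>" unfolding \<mu>_def by (rule borel_measurable_continuous_lebesgue_on[OF \<psi>(1)])
  have i: "integrable \<mu> (\<lambda>x. L (h x) * \<psi> x)"
    and b: "\<bar>LINT x|\<mu>. L (h x) * \<psi> x\<bar> \<le> B * (LINT x|\<mu>. norm (h x))" if h: "h \<in> Lpow n \<mu>" for h
  proof -
    have iL: "integrable \<mu> (\<lambda>x. L (h x))" by (rule integrable_bounded_linear[OF L(1) Lpow_integrable_norm[OF h]])
    note m = integrable_mult_bounded[OF iL \<psi>m, of B, OF \<psi>(2)]
    show "integrable \<mu> (\<lambda>x. L (h x) * \<psi> x)" by (rule m(1))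
    have "(LINT x|\<mu>. \<bar>L (h x)\<bar>) \<le> (LINT x|\<mu>. norm (h x))"
      by (rule integral_mono) (use iL Lpow_integrable_norm[OF h] L(2) in auto)
    moreover have "0 \<le> B" using order_trans[OF abs_ge_zero \<psi>(2)] .
    ultimately show "\<bar>LINT x|\<mu>. L (h x) * \<psi> x\<bar> \<le> B * (LINT x|\<mu>. norm (h x))"
      using m(2) mult_left_mono by (meson order_trans)
  qed
  have "(\<lambda>k. LINT x|\<mu>. norm (1::real) ^ (n - 1) * norm (f k x - g x)) \<longlonglongrightarrow> 0"
    by (rule Lpow_mult_tendsto_0[OF n1 const_Ln d lim[unfolded Lpow_tendsto_def]])
  then have "(\<lambda>k. B * (LINT x|\<mu>. norm (f k x - g x))) \<longlonglongrightarrow> 0"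
    using tendsto_mult_right_zero[of "\<lambda>k. LINT x|\<mu>. norm (f k x - g x)" sequentially B] by simp
  moreover have "\<bar>(LINT x|\<mu>. L (f k x) * \<psi> x) - (LINT x|\<mu>. L (g x) * \<psi> x)\<bar> \<le> B * (LINT x|\<mu>. norm (f k x - g x))" for k
  proof -
    have "(LINT x|\<mu>. L (f k x) * \<psi> x) - (LINT x|\<mu>. L (g x) * \<psi> x) = (LINT x|\<mu>. L (f k x - g x) * \<psi> x)"
      using i[OF f[of k]] i[OF g] by (simp add: linear_diff[OF bounded_linear.linear[OF L(1)]] left_diff_distrib)
    then show ?thesis using b[OF d] by simp
  qed
  ultimately show ?thesis by (rule tendsto_if_abs_diff_le[rotated])
qed

text \<open>The integration by parts identity passes to L^n limits, so G is the weak gradient of U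
  although the two limits arise separately.\<close>

lemma has_weak_gradient_limit:
  assumes \<Phi>: "\<And>k. \<Phi> k \<in> test_functions \<Omega>" and U: "U \<in> Lpow n \<mu>" "Lpow_tendsto n \<mu> \<Phi> U"
    and G: "G \<in> Lpow n \<mu>" "Lpow_tendsto n \<mu> (\<lambda>k. J (\<Phi> k)) G"
  shows "has_weak_gradient \<Omega> U G"
  unfolding has_weak_gradient_def
proof (intro conjI ballI allI Lpow_L1_loc U(1) G(1))
  fix \<phi> :: "real^'n \<Rightarrow> real" and i j assume t: "\<phi> \<in> test_functions \<Omega>"
  obtain K where K: "smooth \<phi>" "compact K" "K \<subseteq> \<Omega>" "\<And>x. x \<notin> K \<Longrightarrow> \<phi> x = 0"
    using test_functionsE[OF t] by blast
  have c: "continuous_on UNIV (\<lambda>x. grad \<phi> x $ j)" by (intro continuous_intros continuous_on_grad K(1))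
  obtain B1 where B1: "\<And>x. \<bar>grad \<phi> x $ j\<bar> \<le> B1"
    using bounded_compact_support[OF c K(2)] grad_off_support[OF K(1,2,4)] by (metis real_norm_def zero_index)
  obtain B2 where B2: "\<And>x. \<bar>\<phi> x\<bar> \<le> B2"
    using bounded_compact_support[OF smooth_continuous[OF K(1)] K(2,4)] by (metis real_norm_def)
  have 1: "(\<lambda>k. LINT x|\<mu>. \<Phi> k x $ i * grad \<phi> x $ j) \<longlonglongrightarrow> (LINT x|\<mu>. U x $ i * grad \<phi> x $ j)"
    by (rule Lpow_pairing_tendsto[OF test_Ln(1)[OF \<Phi>] U bounded_linear_vec_nth _ c B1]) (rule component_le_norm_cart)
  have bl: "bounded_linear (\<lambda>A::real^'n^'n. A $ i $ j)"
    by (rule bounded_linear_compose[OF bounded_linear_vec_nth bounded_linear_vec_nth])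
  have "\<bar>A $ i $ j\<bar> \<le> norm A" for A :: "real^'n^'n"
    using component_le_norm_cart[of "A $ i" j] Finite_Cartesian_Product.norm_nth_le[of A i] by linarith
  then have 2: "(\<lambda>k. LINT x|\<mu>. J (\<Phi> k) x $ i $ j * \<phi> x) \<longlonglongrightarrow> (LINT x|\<mu>. G x $ i $ j * \<phi> x)"
    by (rule Lpow_pairing_tendsto[OF test_Ln(2)[OF \<Phi>] G bl _ smooth_continuous[OF K(1)] B2])
  have "(LINT x|\<mu>. \<Phi> k x $ i * grad \<phi> x $ j) = - (LINT x|\<mu>. J (\<Phi> k) x $ i $ j * \<phi> x)" for k
  proof -
    have "smooth (\<Phi> k)" using \<Phi>[of k] by (simp add: test_functions_def)
    from has_weak_gradient_test[OF \<Omega>(1) this] t show ?thesis unfolding has_weak_gradient_def \<mu>_def by blast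
  qed
  with 1 have "(\<lambda>k. - (LINT x|\<mu>. J (\<Phi> k) x $ i $ j * \<phi> x)) \<longlonglongrightarrow> (LINT x|\<mu>. U x $ i * grad \<phi> x $ j)" by simp
  from LIMSEQ_unique[OF this tendsto_minus[OF 2]]
  show "(LINT x|lebesgue_on \<Omega>. U x $ i * grad \<phi> x $ j) = - (LINT x|lebesgue_on \<Omega>. G x $ i $ j * \<phi> x)"
    by (simp add: \<mu>_def)
qed

lemma weak_gradient_diff_AE:
  assumes "has_weak_gradient \<Omega> U G" "\<Phi> \<in> test_functions \<Omega>"
  shows "AE x in \<mu>. weak_gradient \<Omega> (\<lambda>x. U x - \<Phi> x) x = G x - J \<Phi> x"
proof -
  have "smooth \<Phi>" using assms(2) by (simp add: test_functions_def)
  from weak_gradient_AE[OF \<Omega>(1) has_weak_gradient_diff[OF \<Omega>(1) assms(1) has_weak_gradient_test[OF \<Omega>(1) this]]]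
  show ?thesis unfolding \<mu>_def .
qed

lemma weak_gradient_measurable:
  assumes "has_weak_gradient \<Omega> U G"
  shows "weak_gradient \<Omega> U \<in> borel_measurable \<mu>"
  using weak_gradient_works[OF assms] by (simp add: has_weak_gradient_def L1_loc_def \<mu>_def)

text \<open>The Sobolev norm of U - \<Phi> refers to a representative chosen afresh for that
  difference; it is replaced here by a concrete gradient.\<close>

lemma W1p_norm_diff:
  assumes U: "has_weak_gradient \<Omega> U G" "G \<in> Lpow n \<mu>" and \<Phi>: "\<Phi> \<in> test_functions \<Omega>"
  shows "W1p_norm (real n) \<Omega> (\<lambda>x. U x - \<Phi> x) = Lp_norm (real n) \<Omega> (\<lambda>x. U x - \<Phi> x) + Lp_norm (real n) \<Omega> (\<lambda>x. G x - J \<Phi> x)"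
proof -
  have sm: "smooth \<Phi>" using \<Phi> by (simp add: test_functions_def)
  have "(LINT x|\<mu>. norm (weak_gradient \<Omega> (\<lambda>x. U x - \<Phi> x) x) ^ n) = (LINT x|\<mu>. norm (G x - J \<Phi> x) ^ n)"
  proof (rule integral_cong_AE)
    have "weak_gradient \<Omega> (\<lambda>x. U x - \<Phi> x) \<in> borel_measurable \<mu>"
      by (rule weak_gradient_measurable[OF has_weak_gradient_diff[OF \<Omega>(1) U(1) has_weak_gradient_test[OF \<Omega>(1) sm]]])
    then show "(\<lambda>x. norm (weak_gradient \<Omega> (\<lambda>x. U x - \<Phi> x) x) ^ n) \<in> borel_measurable \<mu>" by measurable
    have "(\<lambda>x. G x - J \<Phi> x) \<in> Lpow n \<mu>" by (intro Lpow_diff U(2) test_Ln \<Phi>)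
    then show "(\<lambda>x. norm (G x - J \<Phi> x) ^ n) \<in> borel_measurable \<mu>" using Lpow_measurable by measurable
    show "AE x in \<mu>. norm (weak_gradient \<Omega> (\<lambda>x. U x - \<Phi> x) x) ^ n = norm (G x - J \<Phi> x) ^ n"
      using weak_gradient_diff_AE[OF U(1) \<Phi>] by (rule eventually_mono) simp
  qed
  then show ?thesis unfolding W1p_norm_def Lp_norm_eq by simp
qed

text \<open>With its converse below, this trades the definition of the closure for a sequence of
  test functions converging together with its Jacobians.\<close>

lemma W1p_0_I:
  assumes \<Phi>: "\<And>k. \<Phi> k \<in> test_functions \<Omega>" and U: "U \<in> Lpow n \<mu>" "Lpow_tendsto n \<mu> \<Phi> U"
    and G: "G \<in> Lpow n \<mu>" "Lpow_tendsto n \<mu> (\<lambda>k. J (\<Phi> k)) G"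
  shows "U \<in> W1p_0 (real n) \<Omega>"
proof -
  note wg = has_weak_gradient_limit[OF assms]
  have lim: "(\<lambda>k. Lp_norm (real n) \<Omega> (\<lambda>x. f x - g k x)) \<longlonglongrightarrow> 0" if "Lpow_tendsto n \<mu> g f"
    for f :: "real^'n \<Rightarrow> 'b::euclidean_space" and g
  proof -
    have "(\<lambda>k. (LINT x|\<mu>. norm (g k x - f x) ^ n) powr (1 / real n)) \<longlonglongrightarrow> 0 powr (1 / real n)"
      using that n1 unfolding Lpow_tendsto_def
      by (intro tendsto_powr' tendsto_const) (auto intro!: always_eventually integral_nonneg_AE)
    then show ?thesis unfolding Lp_norm_eq by (simp add: norm_minus_commute)
  qed
  have l: "(\<lambda>k. W1p_norm (real n) \<Omega> (\<lambda>x. U x - \<Phi> k x)) \<longlonglongrightarrow> 0 + 0"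
    unfolding W1p_norm_diff[OF wg G(1) \<Phi>] by (intro tendsto_add lim U(2) G(2))
  have "\<exists>\<Psi>\<in>test_functions \<Omega>. W1p_norm (real n) \<Omega> (\<lambda>x. U x - \<Psi> x) < \<epsilon>" if "\<epsilon> > 0" for \<epsilon>
  proof -
    have "\<forall>\<^sub>F k in sequentially. W1p_norm (real n) \<Omega> (\<lambda>x. U x - \<Phi> k x) < \<epsilon>"
      using l that by (intro order_tendstoD(2)[OF l]) simp
    then obtain k where "W1p_norm (real n) \<Omega> (\<lambda>x. U x - \<Phi> k x) < \<epsilon>"
      by (auto simp: eventually_sequentially)
    then show ?thesis using \<Phi> by blast
  qed
  moreover have "U \<in> W1p (real n) \<Omega>" unfolding W1p_def using U(1) G(1) wg by (auto simp: Lp_iff)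
  ultimately show ?thesis unfolding W1p_0_def by blast
qed

lemma W1p_0_E:
  assumes "U \<in> W1p_0 (real n) \<Omega>"
  obtains \<Phi> where "\<And>k. \<Phi> k \<in> test_functions \<Omega>" "U \<in> Lpow n \<mu>" "Lpow_tendsto n \<mu> \<Phi> U"
    "weak_gradient \<Omega> U \<in> Lpow n \<mu>" "Lpow_tendsto n \<mu> (\<lambda>k. J (\<Phi> k)) (weak_gradient \<Omega> U)"
proof -
  let ?G = "weak_gradient \<Omega> U"
  obtain G' where G': "has_weak_gradient \<Omega> U G'" "G' \<in> Lpow n \<mu>" and U: "U \<in> Lpow n \<mu>"
    using assms unfolding W1p_0_def W1p_def by (auto simp: Lp_iff)
  note wg = weak_gradient_works[OF G'(1)]
  have G: "?G \<in> Lpow n \<mu>"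
  proof -
    have m: "?G \<in> borel_measurable \<mu>" by (rule weak_gradient_measurable[OF G'(1)])
    have "AE x in \<mu>. norm (G' x) ^ n = norm (?G x) ^ n"
      using weak_gradient_AE[OF \<Omega>(1) G'(1)] unfolding \<mu>_def by (rule eventually_mono) simp
    then have "integrable \<mu> (\<lambda>x. norm (?G x) ^ n)"
      using m Lpow_measurable[OF G'(2)] Lpow_integrable[OF G'(2)] by (subst integrable_cong_AE[symmetric]) auto
    then show ?thesis using m by (simp add: Lpow_def)
  qed
  have "\<exists>\<Phi>\<in>test_functions \<Omega>. W1p_norm (real n) \<Omega> (\<lambda>x. U x - \<Phi> x) < 1 / real (Suc k)" for k
    using assms unfolding W1p_0_def by simp
  then obtain \<Phi> where \<Phi>: "\<And>k. \<Phi> k \<in> test_functions \<Omega>" "\<And>k. W1p_norm (real n) \<Omega> (\<lambda>x. U x - \<Phi> k x) < 1 / real (Suc k)"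
    by metis
  have b: "Lp_norm (real n) \<Omega> (\<lambda>x. U x - \<Phi> k x) \<le> 1 / real (Suc k)" "Lp_norm (real n) \<Omega> (\<lambda>x. ?G x - J (\<Phi> k) x) \<le> 1 / real (Suc k)" for k
    using \<Phi>(2)[of k] W1p_norm_diff[OF wg G \<Phi>(1)[of k]] Lp_norm_nonneg[of "\<lambda>x. U x - \<Phi> k x"] Lp_norm_nonneg[of "\<lambda>x. ?G x - J (\<Phi> k) x"]
    by linarith+
  have lim: "Lpow_tendsto n \<mu> g f" if "\<And>k. Lp_norm (real n) \<Omega> (\<lambda>x. f x - g k x) \<le> 1 / real (Suc k)"
    for f :: "real^'n \<Rightarrow> 'b::euclidean_space" and g
    unfolding Lpow_tendsto_def
  proof (rule tendsto_sandwich[OF _ _ tendsto_const])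
    have "(LINT x|\<mu>. norm (g k x - f x) ^ n) \<le> (1 / real (Suc k)) ^ n" for k
    proof -
      have "(LINT x|\<mu>. norm (g k x - f x) ^ n) = Lp_norm (real n) \<Omega> (\<lambda>x. f x - g k x) ^ n"
        unfolding Lp_norm_power by (simp add: norm_minus_commute)
      also have "\<dots> \<le> (1 / real (Suc k)) ^ n" by (intro power_mono that Lp_norm_nonneg)
      finally show ?thesis .
    qed
    then show "\<forall>\<^sub>F k in sequentially. (LINT x|\<mu>. norm (g k x - f x) ^ n) \<le> (1 / real (Suc k)) ^ n" by simp
    have "(\<lambda>k. (1 / real (Suc k)) ^ n) \<longlonglongrightarrow> 0 ^ n"
      using LIMSEQ_inverse_real_of_nat by (intro tendsto_power) (simp add: inverse_eq_divide)
    then show "(\<lambda>k. (1 / real (Suc k)) ^ n) \<longlonglongrightarrow> 0" using n1 by (simp add: power_0_left)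
  qed (auto intro!: always_eventually integral_nonneg_AE)
  show ?thesis by (rule that[OF \<Phi>(1) U lim[OF b(1)] G lim[OF b(2)]])
qed

section \<open>The nonlinear flux and the minimisation\<close>

abbreviation flux :: "real^'n^'n \<Rightarrow> real^'n^'n" where
  "flux A \<equiv> norm A ^ (n - 2) *\<^sub>R A"

lemma norm_flux_inner_le: "\<bar>flux A \<bullet> B\<bar> \<le> norm A ^ (n - 1) * norm B"
proof -
  have "norm A ^ (n - 1) = norm A ^ (n - 2) * norm A"
    using n2 by (metis One_nat_def Suc_1 Suc_diff_le diff_Suc_Suc power_Suc2)
  then show ?thesis using Cauchy_Schwarz_ineq2[of "flux A" B] by simp
qed

lemma flux_inner_integrable:
  assumes "G \<in> Lpow n \<mu>" "H \<in> Lpow n \<mu>"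
  shows "integrable \<mu> (\<lambda>x. flux (G x) \<bullet> H x)"
proof (rule Bochner_Integration.integrable_bound[OF Lpow_mult_integrable(1)[OF n1 assms]])
  note [measurable] = Lpow_measurable[OF assms(1)] Lpow_measurable[OF assms(2)]
  show "(\<lambda>x. flux (G x) \<bullet> H x) \<in> borel_measurable \<mu>" by measurable
  show "AE x in \<mu>. norm (flux (G x) \<bullet> H x) \<le> norm (norm (G x) ^ (n - 1) * norm (H x))"
    using norm_flux_inner_le by (intro AE_I2) simp
qed

lemma flux_inner_tendsto:
  assumes G: "G \<in> Lpow n \<mu>" and H: "\<And>k. H k \<in> Lpow n \<mu>" "H' \<in> Lpow n \<mu>" "Lpow_tendsto n \<mu> H H'"
  shows "(\<lambda>k. LINT x|\<mu>. flux (G x) \<bullet> H k x) \<longlonglongrightarrow> (LINT x|\<mu>. flux (G x) \<bullet> H' x)"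
proof (rule tendsto_if_abs_diff_le)
  have d: "(\<lambda>x. H k x - H' x) \<in> Lpow n \<mu>" for k by (rule Lpow_diff[OF H(1,2)])
  show "(\<lambda>k. LINT x|\<mu>. norm (G x) ^ (n - 1) * norm (H k x - H' x)) \<longlonglongrightarrow> 0"
    by (rule Lpow_mult_tendsto_0[OF n1 G d H(3)[unfolded Lpow_tendsto_def]])
  fix k
  have "(LINT x|\<mu>. flux (G x) \<bullet> H k x) - (LINT x|\<mu>. flux (G x) \<bullet> H' x) = (LINT x|\<mu>. flux (G x) \<bullet> (H k x - H' x))"
    unfolding inner_diff_right
    by (rule Bochner_Integration.integral_diff[symmetric]) (intro flux_inner_integrable G H)+
  also have "\<bar>\<dots>\<bar> \<le> (LINT x|\<mu>. norm (G x) ^ (n - 1) * norm (H k x - H' x))"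
    by (rule order_trans[OF integral_abs_bound integral_mono])
      (intro integrable_abs flux_inner_integrable G d Lpow_mult_integrable(1) n1 norm_flux_inner_le)+
  finally show "\<bar>(LINT x|\<mu>. flux (G x) \<bullet> H k x) - (LINT x|\<mu>. flux (G x) \<bullet> H' x)\<bar>
    \<le> (LINT x|\<mu>. norm (G x) ^ (n - 1) * norm (H k x - H' x))" .
qed

text \<open>The estimate makes F a bounded functional on test functions in the gradient norm,
  although it is not given by an L^n dual function. The last conclusion allows any D strictly above
  the norm of G, because a strict inequality at the limit holds for almost all members of the
  minimising sequence.\<close>

lemma dirichlet_minimizer:
  fixes F :: "real^'n \<Rightarrow> real^'n"
  assumes F: "integrable \<mu> F" and c: "c \<ge> 0"
    and est: "\<And>\<Phi> D. \<Phi> \<in> test_functions \<Omega> \<Longrightarrow> D > 0 \<Longrightarrow> (LINT x|\<mu>. norm (J \<Phi> x) ^ n) \<le> D ^ n \<Longrightarrow>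
      \<bar>LINT x|\<mu>. F x \<bullet> \<Phi> x\<bar> \<le> c * D"
  obtains U G where "U \<in> W1p_0 (real n) \<Omega>" "has_weak_gradient \<Omega> U G" "G \<in> Lpow n \<mu>"
    "\<And>\<Phi>. \<Phi> \<in> test_functions \<Omega> \<Longrightarrow> (LINT x|\<mu>. flux (G x) \<bullet> J \<Phi> x) = (LINT x|\<mu>. F x \<bullet> \<Phi> x)"
    "\<And>D. D > 0 \<Longrightarrow> (LINT x|\<mu>. norm (G x) ^ n) < D ^ n \<Longrightarrow> (LINT x|\<mu>. norm (G x) ^ n) \<le> real n * c * D"
proof -
  define l where "l \<Phi> = (LINT x|\<mu>. F x \<bullet> \<Phi> x)" for \<Phi>
  define a where "a \<Phi> = (LINT x|\<mu>. norm (J \<Phi> x) ^ n)" for \<Phi>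
  define I where "I \<Phi> = a \<Phi> / real n - l \<Phi>" for \<Phi>
  let ?T = "test_functions \<Omega> :: (real^'n \<Rightarrow> real^'n) set"
  have n0: "real n > 0" using n1 by simp
  have a0: "0 \<le> a \<Phi>" for \<Phi> unfolding a_def by (intro integral_nonneg_AE) auto
  have F_int: "integrable \<mu> (\<lambda>x. F x \<bullet> \<Phi> x)" if t: "\<Phi> \<in> ?T" for \<Phi>
  proof -
    obtain K where K: "smooth \<Phi>" "compact K" "K \<subseteq> \<Omega>" "\<And>x. x \<notin> K \<Longrightarrow> \<Phi> x = 0"
      using test_functionsE[OF t] by blast
    obtain B where B: "\<And>x. norm (\<Phi> x) \<le> B"
      using bounded_compact_support[OF smooth_continuous[OF K(1)] K(2,4)] by metis
    have [measurable]: "F \<in> borel_measurable \<mu>" "\<Phi> \<in> borel_measurable \<mu>"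
      using F Lpow_measurable[OF test_Ln(1)[OF t]] by auto
    show ?thesis
    proof (rule Bochner_Integration.integrable_bound)
      show "integrable \<mu> (\<lambda>x. B * norm (F x))" using F by simp
      have "\<bar>F x \<bullet> \<Phi> x\<bar> \<le> B * norm (F x)" for x
        using Cauchy_Schwarz_ineq2[of "F x" "\<Phi> x"] mult_right_mono[OF B[of x] norm_ge_zero[of "F x"]]
        by (simp add: mult.commute)
      then show "AE x in \<mu>. norm (F x \<bullet> \<Phi> x) \<le> norm (B * norm (F x))"
        by (intro AE_I2) (metis abs_ge_self order_trans real_norm_def)
    qed measurable
  qed
  have l_add: "l (\<lambda>x. \<Phi> x + s *\<^sub>R \<Psi> x) = l \<Phi> + s * l \<Psi>" if "\<Phi> \<in> ?T" "\<Psi> \<in> ?T" for \<Phi> \<Psi> s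
    unfolding l_def inner_add_right using F_int[OF that(1)] F_int[OF that(2)] by simp
  have est': "\<bar>l \<Phi>\<bar> \<le> c * D" if "\<Phi> \<in> ?T" "D > 0" "a \<Phi> \<le> D ^ n" for \<Phi> D
    using est[OF that(1,2)] that(3) unfolding l_def a_def by blast
  have lower: "- (1 + real n * c\<^sup>2) \<le> I \<Phi>" if t: "\<Phi> \<in> ?T" for \<Phi>
  proof -
    \<comment> \<open>The added 1 gives D \<ge> 1 and hence D \<le> D^(n-1). If D is at least n c,
      then D^n / n dominates c D; otherwise c D is at most n c^2.\<close>
    define D where "D = root n (a \<Phi> + 1)"
    have Dn: "D ^ n = a \<Phi> + 1" unfolding D_def using a0[of \<Phi>] n1 by (intro real_root_pow_pos2) auto
    have D1: "D \<ge> 1" unfolding D_def using a0[of \<Phi>] n1 by (simp add: real_root_ge_1_iff)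
    have lc: "l \<Phi> \<le> c * D" using est'[OF t, of D] D1 Dn by (auto simp: abs_le_iff)
    have I: "I \<Phi> \<ge> (D ^ n - 1) / real n - c * D" unfolding I_def Dn using lc by simp
    have inv: "1 / real n \<le> 1" using n1 by simp
    show ?thesis
    proof (cases "D \<ge> real n * c")
      case True
      have "D ^ 1 \<le> D ^ (n - 1)" using D1 n2 by (intro power_increasing) auto
      then have "real n * c \<le> D ^ (n - 1)" using True by simp
      then have "real n * c * D \<le> D ^ (n - 1) * D" using D1 by (intro mult_right_mono) auto
      also have "\<dots> = D ^ n" by (rule power_pred_mult[OF n1])
      finally have "c * D \<le> D ^ n / real n" using n0 by (simp add: field_simps)
      then have "- (1 / real n) \<le> I \<Phi>" using I by (simp add: diff_divide_distrib)
      moreover have "0 \<le> real n * c\<^sup>2" by simp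
      ultimately show ?thesis using inv by linarith
    next
      case False
      have "c * D \<le> c * (real n * c)" using False c by (intro mult_left_mono) auto
      moreover have "0 \<le> (D ^ n - 1) / real n" unfolding Dn using a0[of \<Phi>] n0 by simp
      ultimately have "- (real n * c\<^sup>2) \<le> I \<Phi>" using I by (simp add: power2_eq_square mult_ac)
      then show ?thesis by simp
    qed
  qed
  define j where "j = Inf (I ` ?T)"
  have bdd: "bdd_below (I ` ?T)" by (rule bdd_belowI2[where m = "- (1 + real n * c\<^sup>2)"]) (rule lower)
  have j_le: "j \<le> I \<Phi>" if "\<Phi> \<in> ?T" for \<Phi> unfolding j_def using that by (intro cINF_lower bdd)
  \<comment> \<open>The geometric rate is the one \<open>Lpow_complete\<close> asks for, and the
    division by n cancels the factor n met in the Cauchy estimate.\<close>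
  define \<epsilon> where "\<epsilon> k = (1 / 4 ^ n) ^ k / real n" for k :: nat
  have \<epsilon>0: "\<epsilon> k > 0" for k using n0 by (simp add: \<epsilon>_def)
  have "\<exists>\<Phi>\<in>?T. I \<Phi> < j + \<epsilon> k" for k
  proof -
    have "I ` ?T \<noteq> {}" using zero_test by blast
    then show ?thesis using cInf_lessD[of "I ` ?T" "j + \<epsilon> k"] \<epsilon>0[of k] by (auto simp: j_def)
  qed
  then obtain \<Phi> where \<Phi>: "\<And>k. \<Phi> k \<in> ?T" "\<And>k. I (\<Phi> k) < j + \<epsilon> k" by metis
  note JL = test_Ln(2)
  have cauchy: "a (\<lambda>x. \<Phi> m x - \<Phi> k x) \<le> 2 ^ n * (1 / 4 ^ n) ^ k" if "k \<le> m" for k m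
  proof -
    define A where "A x = J (\<Phi> m) x" for x
    define B where "B x = J (\<Phi> k) x" for x
    have AB: "A \<in> Lpow n \<mu>" "B \<in> Lpow n \<mu>" unfolding A_def B_def using JL[OF \<Phi>(1)] by auto
    \<comment> \<open>The midpoint is a test function, so its energy is at least j, while by
      Clarkson's inequality it lies below the mean of the two energies by a multiple of the integral
      of |J(\<Phi> m) - J(\<Phi> k)|^n; the linear part cancels.\<close>
    define \<Psi> where "\<Psi> x = (1 / 2) *\<^sub>R (\<Phi> m x + \<Phi> k x)" for x
    have \<Psi>_eq: "\<Psi> = (\<lambda>x. 0 + (1 / 2) *\<^sub>R (\<Phi> m x + 1 *\<^sub>R \<Phi> k x))" by (simp add: \<Psi>_def fun_eq_iff)
    note t1 = test_add_scaleR[OF \<Phi>(1)[of m] \<Phi>(1)[of k], of 1]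
    note t2 = test_add_scaleR[OF zero_test t1(1), of "1 / 2"]
    have \<Psi>: "\<Psi> \<in> ?T" "J \<Psi> x = (1 / 2) *\<^sub>R (A x + B x)" for x
      using t1 t2 J_zero unfolding \<Psi>_eq A_def B_def by simp_all
    have l\<Psi>: "l \<Psi> = (l (\<Phi> m) + l (\<Phi> k)) / 2"
    proof -
      have "l (\<lambda>x. 0) = 0" by (simp add: l_def)
      then show ?thesis
        unfolding \<Psi>_eq l_add[OF zero_test t1(1), of "1 / 2"] l_add[OF \<Phi>(1) \<Phi>(1)] by simp
    qed
    have sum_Ln: "(\<lambda>x. (1 / 2) *\<^sub>R (A x + B x)) \<in> Lpow n \<mu>" "(\<lambda>x. (1 / 2) *\<^sub>R (A x - B x)) \<in> Lpow n \<mu>"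
      by (intro Lpow_scaleR Lpow_add Lpow_diff AB)+
    have "(LINT x|\<mu>. norm ((1 / 2) *\<^sub>R (A x + B x)) ^ n + norm ((1 / 2) *\<^sub>R (A x - B x)) ^ n) \<le> (LINT x|\<mu>. (norm (A x) ^ n + norm (B x) ^ n) / 2)"
    proof (rule integral_mono[OF _ _ clarkson[OF n2]])
      show "integrable \<mu> (\<lambda>x. norm ((1 / 2) *\<^sub>R (A x + B x)) ^ n + norm ((1 / 2) *\<^sub>R (A x - B x)) ^ n)"
        by (intro Bochner_Integration.integrable_add Lpow_integrable sum_Ln)
      show "integrable \<mu> (\<lambda>x. (norm (A x) ^ n + norm (B x) ^ n) / 2)"
        by (intro integrable_divide Bochner_Integration.integrable_add Lpow_integrable AB)
    qed
    then have "(LINT x|\<mu>. norm ((1 / 2) *\<^sub>R (A x + B x)) ^ n) + (LINT x|\<mu>. norm ((1 / 2) *\<^sub>R (A x - B x)) ^ n)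
       \<le> ((LINT x|\<mu>. norm (A x) ^ n) + (LINT x|\<mu>. norm (B x) ^ n)) / 2"
      using Lpow_integrable[OF sum_Ln(1)] Lpow_integrable[OF sum_Ln(2)] Lpow_integrable[OF AB(1)] Lpow_integrable[OF AB(2)]
      by (simp only: Bochner_Integration.integral_add integral_divide_zero Bochner_Integration.integrable_add)
    moreover have "(LINT x|\<mu>. norm ((1 / 2) *\<^sub>R (A x + B x)) ^ n) = a \<Psi>" unfolding a_def \<Psi>(2) ..
    moreover have "(LINT x|\<mu>. norm (A x) ^ n) = a (\<Phi> m)" "(LINT x|\<mu>. norm (B x) ^ n) = a (\<Phi> k)"
      by (simp_all add: a_def A_def B_def)
    moreover have "(LINT x|\<mu>. norm ((1 / 2) *\<^sub>R (A x - B x)) ^ n) = (1 / 2) ^ n * a (\<lambda>x. \<Phi> m x - \<Phi> k x)"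
      unfolding a_def test_diff(2)[OF \<Phi>(1) \<Phi>(1)] A_def B_def norm_scaleR power_mult_distrib by simp
    ultimately have q: "a \<Psi> + (1 / 2) ^ n * a (\<lambda>x. \<Phi> m x - \<Phi> k x) \<le> (a (\<Phi> m) + a (\<Phi> k)) / 2" by simp
    have "\<epsilon> m \<le> \<epsilon> k"
      unfolding \<epsilon>_def using that n0 by (intro divide_right_mono power_decreasing) auto
    then have "I (\<Phi> m) \<le> j + \<epsilon> k" "I (\<Phi> k) \<le> j + \<epsilon> k" using \<Phi>(2)[of m] \<Phi>(2)[of k] by simp_all
    then have Im: "(I (\<Phi> m) + I (\<Phi> k)) / 2 \<le> j + \<epsilon> k" by simp
    have nI: "real n * I X = a X - real n * l X" for X
      unfolding I_def right_diff_distrib using n0 by simp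
    have "real n * ((I (\<Phi> m) + I (\<Phi> k)) / 2 - I \<Psi>) = (real n * I (\<Phi> m) + real n * I (\<Phi> k)) / 2 - real n * I \<Psi>"
      by (simp add: algebra_simps)
    also have "\<dots> = (a (\<Phi> m) + a (\<Phi> k)) / 2 - a \<Psi>"
    proof -
      have "(p - N * x + (q - N * y)) / 2 - (r - N * ((x + y) / 2)) = (p + q) / 2 - r" for p q r x y N :: real
        by (simp add: field_simps)
      then show ?thesis unfolding nI l\<Psi> .
    qed
    finally have e: "real n * ((I (\<Phi> m) + I (\<Phi> k)) / 2 - I \<Psi>) = (a (\<Phi> m) + a (\<Phi> k)) / 2 - a \<Psi>" .
    have "(1 / 2) ^ n * a (\<lambda>x. \<Phi> m x - \<Phi> k x) \<le> real n * ((I (\<Phi> m) + I (\<Phi> k)) / 2 - I \<Psi>)"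
      unfolding e le_diff_eq by (subst add.commute) (rule q)
    also have "\<dots> \<le> real n * \<epsilon> k"
    proof (rule mult_left_mono)
      have "x - p \<le> e" if "x \<le> y + e" "y \<le> p" for x y p e :: real using that by linarith
      from this[OF Im j_le[OF \<Psi>(1)]] show "(I (\<Phi> m) + I (\<Phi> k)) / 2 - I \<Psi> \<le> \<epsilon> k" .
    qed (use n0 in simp)
    also have "\<dots> = (1 / 4 ^ n) ^ k" using n0 by (simp add: \<epsilon>_def)
    finally have "2 ^ n * ((1 / 2) ^ n * a (\<lambda>x. \<Phi> m x - \<Phi> k x)) \<le> 2 ^ n * (1 / 4 ^ n) ^ k" by (intro mult_left_mono) auto
    then show ?thesis by (simp add: power_one_over)
  qed
  obtain P where P: "P \<ge> 0" "\<And>\<Psi>. \<Psi> \<in> ?T \<Longrightarrow> (LINT x|\<mu>. norm (\<Psi> x) ^ n) \<le> P * a \<Psi>"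
    using poincare_test unfolding a_def by blast
  have c1: "(LINT x|\<mu>. norm (J (\<Phi> m) x - J (\<Phi> k) x) ^ n) \<le> 2 ^ n * (1 / 4 ^ n) ^ k" if "k \<le> m" for k m
    using cauchy[OF that] unfolding a_def test_diff(2)[OF \<Phi>(1) \<Phi>(1)] .
  have c2: "(LINT x|\<mu>. norm (\<Phi> m x - \<Phi> k x) ^ n) \<le> (P * 2 ^ n) * (1 / 4 ^ n) ^ k" if "k \<le> m" for k m
    using order_trans[OF P(2)[OF test_diff(1)[OF \<Phi>(1) \<Phi>(1)]] mult_left_mono[OF cauchy[OF that] P(1)]] by (simp add: mult.assoc)
  obtain G where G: "G \<in> Lpow n \<mu>" "Lpow_tendsto n \<mu> (\<lambda>k. J (\<Phi> k)) G"
    by (rule Lpow_complete[OF n1 JL[OF \<Phi>(1)] c1])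
  obtain U where U: "U \<in> Lpow n \<mu>" "Lpow_tendsto n \<mu> \<Phi> U"
    by (rule Lpow_complete[OF n1 test_Ln(1)[OF \<Phi>(1)] c2])
  define g where "g = (LINT x|\<mu>. norm (G x) ^ n)"
  have a_lim: "(\<lambda>k. a (\<Phi> k)) \<longlonglongrightarrow> g"
    unfolding a_def g_def by (rule Lpow_tendsto_integral_power[OF n1 JL[OF \<Phi>(1)] G])
  have I_lim: "(\<lambda>k. I (\<Phi> k)) \<longlonglongrightarrow> j"
  proof (rule tendsto_if_abs_diff_le)
    show "\<bar>I (\<Phi> k) - j\<bar> \<le> \<epsilon> k" for k using \<Phi>(2)[of k] j_le[OF \<Phi>(1)[of k]] by linarith
    have "(\<lambda>k. (1 / 4 ^ n) ^ k / real n) \<longlonglongrightarrow> 0 / real n"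
      by (intro tendsto_divide LIMSEQ_power_zero tendsto_const) (use n1 in \<open>auto simp: one_less_power\<close>)
    then show "\<epsilon> \<longlonglongrightarrow> 0" by (simp add: \<epsilon>_def[abs_def])
  qed
  \<comment> \<open>The functional is given a value at the limit as the limit of l (\<Phi> k); the
    integral of F . U is never formed, as F is only integrable and U may be unbounded.\<close>
  have l_lim: "(\<lambda>k. l (\<Phi> k)) \<longlonglongrightarrow> g / real n - j"
  proof -
    have "(\<lambda>k. a (\<Phi> k) / real n - I (\<Phi> k)) \<longlonglongrightarrow> g / real n - j"
      using n0 by (intro tendsto_intros a_lim I_lim) auto
    then show ?thesis by (simp add: I_def)
  qed
  \<comment> \<open>Minimality of the limit pair, obtained by letting k tend to infinity in j \<le>
    I(\<Phi> k + t \<Psi>).\<close>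
  have min: "g / real n \<le> (LINT x|\<mu>. norm (G x + t *\<^sub>R J \<Psi> x) ^ n) / real n - t * l \<Psi>" if \<Psi>: "\<Psi> \<in> ?T" for \<Psi> t
  proof -
    let ?f = "\<lambda>k x. J (\<Phi> k) x + t *\<^sub>R J \<Psi> x" and ?g = "\<lambda>x. G x + t *\<^sub>R J \<Psi> x"
    note t = test_add_scaleR[OF \<Phi>(1) \<Psi>, of _ t]
    have "?f k \<in> Lpow n \<mu>" for k by (intro Lpow_add Lpow_scaleR JL \<Phi>(1) \<Psi>)
    moreover have "?g \<in> Lpow n \<mu>" by (intro Lpow_add Lpow_scaleR JL G(1) \<Psi>)
    moreover have "Lpow_tendsto n \<mu> ?f ?g" using G(2) by (simp add: Lpow_tendsto_def)
    ultimately have "(\<lambda>k. LINT x|\<mu>. norm (?f k x) ^ n) \<longlonglongrightarrow> (LINT x|\<mu>. norm (?g x) ^ n)"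
      by (intro Lpow_tendsto_integral_power[OF n1])
    then have "(\<lambda>k. (LINT x|\<mu>. norm (?f k x) ^ n) / real n - (l (\<Phi> k) + t * l \<Psi>)) \<longlonglongrightarrow>
        (LINT x|\<mu>. norm (?g x) ^ n) / real n - ((g / real n - j) + t * l \<Psi>)"
      using n0 by (intro tendsto_intros l_lim) auto
    moreover have "j \<le> (LINT x|\<mu>. norm (?f k x) ^ n) / real n - (l (\<Phi> k) + t * l \<Psi>)" for k
      using j_le[OF t(1)[of k]] unfolding I_def a_def t(2) l_add[OF \<Phi>(1) \<Psi>] .
    ultimately have "j \<le> (LINT x|\<mu>. norm (?g x) ^ n) / real n - ((g / real n - j) + t * l \<Psi>)"
      by (intro LIMSEQ_le_const) auto
    then show ?thesis by simp
  qed
  \<comment> \<open>Steps t > 0 yield one inequality; applied to -\<Psi> it gives the other.\<close>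
  have EL_le: "l \<Psi> \<le> (LINT x|\<mu>. flux (G x) \<bullet> J \<Psi> x)" if \<Psi>: "\<Psi> \<in> ?T" for \<Psi>
  proof -
    have "real n * l \<Psi> \<le> ((LINT x|\<mu>. norm (G x + (1 / real (Suc k)) *\<^sub>R J \<Psi> x) ^ n) - (LINT x|\<mu>. norm (G x) ^ n)) / (1 / real (Suc k))" for k
    proof -
      define t where "t = 1 / real (Suc k)"
      have t: "t > 0" by (simp add: t_def)
      have "g \<le> (LINT x|\<mu>. norm (G x + t *\<^sub>R J \<Psi> x) ^ n) - real n * (t * l \<Psi>)"
        using min[OF \<Psi>, of t] n0 by (simp add: field_simps)
      then show ?thesis using t unfolding t_def[symmetric] g_def[symmetric] by (simp add: field_simps)
    qed
    then have "real n * l \<Psi> \<le> real n * (LINT x|\<mu>. flux (G x) \<bullet> J \<Psi> x)"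
      by (intro LIMSEQ_le_const[OF Lpow_energy_derivative[OF n2 G(1) JL[OF \<Psi>]]]) auto
    then show ?thesis using n0 by simp
  qed
  have EL: "(LINT x|\<mu>. flux (G x) \<bullet> J \<Psi> x) = (LINT x|\<mu>. F x \<bullet> \<Psi> x)" if \<Psi>: "\<Psi> \<in> ?T" for \<Psi>
  proof -
    note m = test_add_scaleR[OF zero_test \<Psi>, of "-1"]
    have "l (\<lambda>x. 0 + (-1) *\<^sub>R \<Psi> x) = - l \<Psi>" unfolding l_add[OF zero_test \<Psi>] by (simp add: l_def)
    moreover have "(LINT x|\<mu>. flux (G x) \<bullet> J (\<lambda>x. 0 + (-1) *\<^sub>R \<Psi> x) x) = - (LINT x|\<mu>. flux (G x) \<bullet> J \<Psi> x)"
      unfolding m(2) J_zero by simp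
    ultimately have "(LINT x|\<mu>. flux (G x) \<bullet> J \<Psi> x) \<le> l \<Psi>" using EL_le[OF m(1)] by simp
    then show ?thesis using EL_le[OF \<Psi>] unfolding l_def by linarith
  qed
  \<comment> \<open>Comparison with the zero function gives j \<le> 0, so g / n is at most the limit
    of l (\<Phi> k), which the estimate bounds by c D.\<close>
  have bound: "g \<le> real n * c * D" if D: "D > 0" "g < D ^ n" for D
  proof -
    have "I (\<lambda>x. 0) = 0" using n1 by (simp add: I_def a_def l_def J_zero power_0_left)
    then have j0: "j \<le> 0" using j_le[OF zero_test] by simp
    have "\<forall>\<^sub>F k in sequentially. a (\<Phi> k) < D ^ n" by (rule order_tendstoD(2)[OF a_lim D(2)])
    then have "\<forall>\<^sub>F k in sequentially. l (\<Phi> k) \<le> c * D"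
      by (rule eventually_mono) (use est'[OF \<Phi>(1) D(1)] in \<open>auto simp: abs_le_iff\<close>)
    then have "g / real n - j \<le> c * D" by (intro tendsto_upperbound[OF l_lim]) auto
    then have "g / real n \<le> c * D" using j0 by linarith
    then show ?thesis using n0 by (simp add: field_simps)
  qed
  show ?thesis
    by (rule that[OF W1p_0_I[OF \<Phi>(1) U G] has_weak_gradient_limit[OF \<Phi>(1) U G] G(1) EL bound[unfolded g_def]])
qed

lemma weak_solution_iff:
  "weak_solution \<Omega> F U \<longleftrightarrow> U \<in> W1p_0 (real n) \<Omega> \<and>
    (\<forall>\<Phi>\<in>test_functions \<Omega>. (LINT x|\<mu>. flux (weak_gradient \<Omega> U x) \<bullet> J \<Phi> x) = (LINT x|\<mu>. F x \<bullet> \<Phi> x))"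
  unfolding weak_solution_def n_def \<mu>_def ..

text \<open>The weak formulation admits test functions only, so U - V is inserted through
  approximations X k, the flux of a fixed L^n gradient being continuous on L^n. Strict monotonicity
  then identifies the gradients; the Jacobians of X k tend to 0, and Poincare's inequality sends X k
  itself to 0.\<close>

lemma weak_solution_unique:
  assumes "weak_solution \<Omega> F U" "weak_solution \<Omega> F V"
  shows "AE x in \<mu>. V x = U x"
proof -
  define G where "G = weak_gradient \<Omega> U"
  define H where "H = weak_gradient \<Omega> V"
  have "U \<in> W1p_0 (real n) \<Omega>" "V \<in> W1p_0 (real n) \<Omega>" using assms unfolding weak_solution_iff by blast+
  obtain \<Phi> where \<Phi>: "\<And>k. \<Phi> k \<in> test_functions \<Omega>" "U \<in> Lpow n \<mu>" "Lpow_tendsto n \<mu> \<Phi> U"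
    "G \<in> Lpow n \<mu>" "Lpow_tendsto n \<mu> (\<lambda>k. J (\<Phi> k)) G"
    unfolding G_def by (rule W1p_0_E[OF \<open>U \<in> W1p_0 (real n) \<Omega>\<close>]) blast
  obtain \<Psi> where \<Psi>: "\<And>k. \<Psi> k \<in> test_functions \<Omega>" "V \<in> Lpow n \<mu>" "Lpow_tendsto n \<mu> \<Psi> V"
    "H \<in> Lpow n \<mu>" "Lpow_tendsto n \<mu> (\<lambda>k. J (\<Psi> k)) H"
    unfolding H_def by (rule W1p_0_E[OF \<open>V \<in> W1p_0 (real n) \<Omega>\<close>]) blast
  define X where "X k x = \<Phi> k x - \<Psi> k x" for k x
  have X: "X k \<in> test_functions \<Omega>" "J (X k) x = J (\<Phi> k) x - J (\<Psi> k) x" for k x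
    unfolding X_def using test_diff[OF \<Phi>(1) \<Psi>(1)] by auto
  have GH: "(\<lambda>x. G x - H x) \<in> Lpow n \<mu>" by (intro Lpow_diff \<Phi>(4) \<Psi>(4))
  have JX: "Lpow_tendsto n \<mu> (\<lambda>k. J (X k)) (\<lambda>x. G x - H x)"
    unfolding X(2) by (rule Lpow_tendsto_diff[OF \<Phi>(5) \<Psi>(5) test_Ln(2)[OF \<Phi>(1)] \<Phi>(4) test_Ln(2)[OF \<Psi>(1)] \<Psi>(4)])
  have XUV: "Lpow_tendsto n \<mu> X (\<lambda>x. U x - V x)"
    unfolding X_def[abs_def] by (rule Lpow_tendsto_diff[OF \<Phi>(3) \<Psi>(3) test_Ln(1)[OF \<Phi>(1)] \<Phi>(2) test_Ln(1)[OF \<Psi>(1)] \<Psi>(2)])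
  have eq: "(LINT x|\<mu>. flux (G x) \<bullet> J (X k) x) = (LINT x|\<mu>. flux (H x) \<bullet> J (X k) x)" for k
    using assms X(1)[of k] unfolding weak_solution_iff G_def H_def by simp
  note lG = flux_inner_tendsto[OF \<Phi>(4) test_Ln(2)[OF X(1)] GH JX]
  note lH = flux_inner_tendsto[OF \<Psi>(4) test_Ln(2)[OF X(1)] GH JX]
  have "(LINT x|\<mu>. flux (G x) \<bullet> (G x - H x)) = (LINT x|\<mu>. flux (H x) \<bullet> (G x - H x))"
    using LIMSEQ_unique[OF lG[unfolded eq] lH] .
  moreover note iG = flux_inner_integrable[OF \<Phi>(4) GH] and iH = flux_inner_integrable[OF \<Psi>(4) GH]
  ultimately have z: "(LINT x|\<mu>. (flux (G x) - flux (H x)) \<bullet> (G x - H x)) = 0"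
    by (simp add: inner_diff_left[of "flux _"])
  have "integrable \<mu> (\<lambda>x. (flux (G x) - flux (H x)) \<bullet> (G x - H x))"
    unfolding inner_diff_left[of "flux _"] by (rule Bochner_Integration.integrable_diff[OF iG iH])
  moreover have "AE x in \<mu>. 0 \<le> (flux (G x) - flux (H x)) \<bullet> (G x - H x)"
    by (intro AE_I2 power_vector_monotone(1)[OF n2])
  ultimately have "AE x in \<mu>. (flux (G x) - flux (H x)) \<bullet> (G x - H x) = 0"
    using z integral_nonneg_eq_0_iff_AE by blast
  then have "AE x in \<mu>. G x = H x"
    by (rule eventually_mono) (rule power_vector_monotone(2)[OF n2])
  then have "(LINT x|\<mu>. norm (G x - H x) ^ n) = 0"
    using n1 by (intro integral_eq_zero_AE) (auto elim!: eventually_mono simp: power_0_left)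
  then have aX: "(\<lambda>k. LINT x|\<mu>. norm (J (X k) x) ^ n) \<longlonglongrightarrow> 0"
    using Lpow_tendsto_integral_power[OF n1 test_Ln(2)[OF X(1)] GH JX] by simp
  obtain P where P: "P \<ge> 0" "\<And>\<Psi>. \<Psi> \<in> test_functions \<Omega> \<Longrightarrow> (LINT x|\<mu>. norm (\<Psi> x) ^ n) \<le> P * (LINT x|\<mu>. norm (J \<Psi> x) ^ n)"
    using poincare_test by blast
  have "(\<lambda>k. LINT x|\<mu>. norm (X k x) ^ n) \<longlonglongrightarrow> 0"
  proof (rule tendsto_if_abs_diff_le)
    show "(\<lambda>k. P * (LINT x|\<mu>. norm (J (X k) x) ^ n)) \<longlonglongrightarrow> 0"
      by (rule tendsto_mult_right_zero[OF aX])
    fix k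
    have "0 \<le> (LINT x|\<mu>. norm (X k x) ^ n)" by (intro integral_nonneg_AE) auto
    then show "\<bar>(LINT x|\<mu>. norm (X k x) ^ n) - 0\<bar> \<le> P * (LINT x|\<mu>. norm (J (X k) x) ^ n)"
      using P(2)[OF X(1)[of k]] by simp
  qed
  moreover have UV: "(\<lambda>x. U x - V x) \<in> Lpow n \<mu>" by (intro Lpow_diff \<Phi>(2) \<Psi>(2))
  ultimately have "(LINT x|\<mu>. norm (U x - V x) ^ n) = 0"
    using LIMSEQ_unique[OF Lpow_tendsto_integral_power[OF n1 test_Ln(1)[OF X(1)] UV XUV]] by blast
  then have "AE x in \<mu>. norm (U x - V x) ^ n = 0"
    using integral_nonneg_eq_0_iff_AE[OF Lpow_integrable[OF UV]] by simp
  then show ?thesis by (rule eventually_mono) (use n1 in auto)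
qed

end

theorem theorem1p7:
  fixes \<Omega> :: "(real^'n) set"
  assumes "CARD('n) \<ge> 2"
    and "smooth_bounded_domain \<Omega>"
  shows "\<exists>C. \<forall>F :: real^'n \<Rightarrow> real^'n. F \<in> Lp 1 \<Omega> \<and> div_free_on \<Omega> F \<longrightarrow>
    (\<exists>U. weak_solution \<Omega> F U \<and>
       (\<forall>V. weak_solution \<Omega> F V \<longrightarrow> (AE x in lebesgue_on \<Omega>. V x = U x)) \<and>
       Lp_norm (real CARD('n)) \<Omega> (weak_gradient \<Omega> U)
         \<le> C * Lp_norm 1 \<Omega> F powr (1 / (real CARD('n) - 1)))"
proof -
  have dom: "open \<Omega>" "bounded \<Omega>" "smooth_boundary \<Omega>"
    using assms(2) by (auto simp: smooth_bounded_domain_def)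
  define n where "n = CARD('n)"
  define \<mu> where "\<mu> = lebesgue_on \<Omega>"
  interpret bounded_domain \<Omega> n \<mu>
    by unfold_locales (use assms(1) dom in \<open>auto simp: n_def \<mu>_def\<close>)
  obtain C where C: "C \<ge> 0" "\<And>F \<Phi> D. integrable \<mu> F \<Longrightarrow> div_free_on \<Omega> F \<Longrightarrow> \<Phi> \<in> test_functions \<Omega> \<Longrightarrow> D > 0 \<Longrightarrow>
      (LINT x|lborel. norm (jacobian \<Phi> (at x)) ^ n) \<le> D ^ n \<Longrightarrow>
      \<bar>LINT x|\<mu>. F x \<bullet> \<Phi> x\<bar> \<le> C * (LINT x|\<mu>. norm (F x)) * D"
    using div_free_estimate[OF assms(1) dom] unfolding n_def \<mu>_def by blast
  show ?thesis
  \<comment> \<open>The minimiser satisfies s^n \<le> n C N s for s the L^n norm of its gradient;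
    solving for s gives this constant and the power 1/(n-1) of N.\<close>
  proof (intro exI[of _ "(real n * C) powr (1 / (real n - 1))"] allI impI)
    fix F :: "real^'n \<Rightarrow> real^'n"
    assume "F \<in> Lp 1 \<Omega> \<and> div_free_on \<Omega> F"
    then have F: "integrable \<mu> F" "div_free_on \<Omega> F" by (auto simp: Lp_1_iff \<mu>_def)
    define N where "N = Lp_norm 1 \<Omega> F"
    have N: "N = (LINT x|\<mu>. norm (F x))" by (simp add: N_def Lp_norm_1 \<mu>_def)
    have N0: "N \<ge> 0" unfolding N by (intro integral_nonneg_AE) auto
    have CN: "C * N \<ge> 0" using C(1) N0 by simp
    have est: "\<bar>LINT x|\<mu>. F x \<bullet> \<Phi> x\<bar> \<le> C * N * D"
      if "\<Phi> \<in> test_functions \<Omega>" "D > 0" "(LINT x|\<mu>. norm (J \<Phi> x) ^ n) \<le> D ^ n" for \<Phi> D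
      using C(2)[OF F that(1,2)] that(3) unfolding test_Ln(4)[OF that(1)] N by blast
    obtain U G where U: "U \<in> W1p_0 (real n) \<Omega>" "has_weak_gradient \<Omega> U G" "G \<in> Lpow n \<mu>"
      "\<And>\<Phi>. \<Phi> \<in> test_functions \<Omega> \<Longrightarrow> (LINT x|\<mu>. flux (G x) \<bullet> J \<Phi> x) = (LINT x|\<mu>. F x \<bullet> \<Phi> x)"
      "\<And>D. D > 0 \<Longrightarrow> (LINT x|\<mu>. norm (G x) ^ n) < D ^ n \<Longrightarrow> (LINT x|\<mu>. norm (G x) ^ n) \<le> real n * (C * N) * D"
      by (rule dirichlet_minimizer[OF F(1) CN est]) blast+
    let ?W = "weak_gradient \<Omega> U"
    have WG: "AE x in \<mu>. ?W x = G x" using weak_gradient_AE[OF dom(1) U(2)] unfolding \<mu>_def .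
    have m[measurable]: "?W \<in> borel_measurable \<mu>" "G \<in> borel_measurable \<mu>"
      using weak_gradient_measurable[OF U(2)] Lpow_measurable[OF U(3)] by auto
    have ws: "weak_solution \<Omega> F U"
      unfolding weak_solution_iff
    proof (intro conjI ballI U(1))
      fix \<Phi> :: "real^'n \<Rightarrow> real^'n" assume t: "\<Phi> \<in> test_functions \<Omega>"
      have [measurable]: "J \<Phi> \<in> borel_measurable \<mu>" by (rule Lpow_measurable[OF test_Ln(2)[OF t]])
      have "(LINT x|\<mu>. flux (?W x) \<bullet> J \<Phi> x) = (LINT x|\<mu>. flux (G x) \<bullet> J \<Phi> x)"
      proof (rule integral_cong_AE)
        show "AE x in \<mu>. flux (?W x) \<bullet> J \<Phi> x = flux (G x) \<bullet> J \<Phi> x"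
          using WG by (rule eventually_mono) simp
      qed measurable
      then show "(LINT x|\<mu>. flux (?W x) \<bullet> J \<Phi> x) = (LINT x|\<mu>. F x \<bullet> \<Phi> x)" using U(4)[OF t] by simp
    qed
    define s where "s = Lp_norm (real n) \<Omega> ?W"
    have s0: "s \<ge> 0" unfolding s_def by (rule Lp_norm_nonneg)
    have "s ^ n = (LINT x|\<mu>. norm (G x) ^ n)"
    proof -
      have "(LINT x|\<mu>. norm (?W x) ^ n) = (LINT x|\<mu>. norm (G x) ^ n)"
      proof (rule integral_cong_AE)
        show "AE x in \<mu>. norm (?W x) ^ n = norm (G x) ^ n" using WG by (rule eventually_mono) simp
      qed measurable
      then show ?thesis unfolding s_def Lp_norm_power .
    qed
    note bound = U(5)[folded this]
    \<comment> \<open>The bound is available for D strictly above s, so D tends to s from the right;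
      this includes s = 0, where D = s would not be positive.\<close>
    have "s ^ n \<le> real n * (C * N) * s"
    proof (rule tendsto_lowerbound)
      show "((\<lambda>D. real n * (C * N) * D) \<longlongrightarrow> real n * (C * N) * s) (at_right s)" by (intro tendsto_intros)
      show "\<forall>\<^sub>F D in at_right s. s ^ n \<le> real n * (C * N) * D"
      proof (rule eventually_at_rightI[of s "s + 1"])
        fix D assume "D \<in> {s<..<s + 1}"
        then have D: "s < D" by simp
        show "s ^ n \<le> real n * (C * N) * D"
          by (rule bound) (use D s0 n1 in \<open>auto intro!: power_strict_mono\<close>)
      qed simp
    qed simp
    have "s \<le> (real n * (C * N)) powr (1 / (real n - 1))"
    proof (cases "s = 0")
      case False
      then have s: "s > 0" using s0 by simp
      have "s ^ (n - 1) * s \<le> real n * (C * N) * s"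
        using \<open>s ^ n \<le> real n * (C * N) * s\<close> by (simp only: power_pred_mult[OF n1])
      then have "s ^ (n - 1) \<le> real n * (C * N)" using s by simp
      then have "(s ^ (n - 1)) powr (1 / (real n - 1)) \<le> (real n * (C * N)) powr (1 / (real n - 1))"
        using s n2 by (intro powr_mono2) auto
      moreover have "(s ^ (n - 1)) powr (1 / (real n - 1)) = s"
      proof -
        have "s ^ (n - 1) = s powr (real n - 1)" using s n2 by (simp add: powr_realpow[symmetric] of_nat_diff)
        then show ?thesis using s n2 by (simp add: powr_powr)
      qed
      ultimately show ?thesis by simp
    qed simp
    also have "\<dots> = (real n * C) powr (1 / (real n - 1)) * N powr (1 / (real n - 1))"
      using C(1) N0 by (simp add: powr_mult[symmetric] mult.assoc)
    finally have "s \<le> (real n * C) powr (1 / (real n - 1)) * N powr (1 / (real n - 1))" .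
    moreover have "AE x in lebesgue_on \<Omega>. V x = U x" if "weak_solution \<Omega> F V" for V
      using weak_solution_unique[OF ws that] unfolding \<mu>_def .
    ultimately show "\<exists>U. weak_solution \<Omega> F U \<and>
       (\<forall>V. weak_solution \<Omega> F V \<longrightarrow> (AE x in lebesgue_on \<Omega>. V x = U x)) \<and>
       Lp_norm (real CARD('n)) \<Omega> (weak_gradient \<Omega> U)
         \<le> (real n * C) powr (1 / (real n - 1)) * Lp_norm 1 \<Omega> F powr (1 / (real CARD('n) - 1))"
      using ws unfolding s_def N_def n_def by blast
  qed
qed

end
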